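(* Let $f:\{0,1\}^n\to\{0,1\}$ be an $(n-k)$-symmetric function and let $\epsilon>0$. Then there exists an $\epsilon$-tester for $f$-isomorphism that makes $O(k\log k/\epsilon^2)$ queries. That is, there is a randomized algorithm which, given query access to an unknown $g:\{0,1\}^n\to\{0,1\}$, makes $O(k\log k/\epsilon^2)$ queries to $g$, accepts with probability at least $2/3$ whenever $g$ is isomorphic to $f$, and rejects with probability at least $2/3$ whenever $g$ is $\epsilon$-far from every function isomorphic to $f$.
   Context: For a permutation $\pi$ of $[n]=\{1,\dots,n\}$ and $x\in\{0,1\}^n$, $\pi x$ denotes the vector whose $\pi(i)$-th coordinate is $x_i$. For $J\subseteq[n]$, $\mathcal{S}_J$ is the set of permutations of $[n]$ that fix every element outside $J$. A function $f$ is $J$-symmetric if $f(\pi x)=f(x)$ for all $x$ and all $\pi\in\mathcal{S}_J$; $f$ is $t$-symmetric if it is $J$-symmetric for some $J$ with $|J|\ge t$. A function $g$ is isomorphic to $f$ if there is a permutation $\pi$ of $[n]$ with $g(x)=f(\pi x)$ for all $x$. The distance between $f$ and $g$ is $\mathrm{dist}(f,g)=\Pr_{x}[f(x)\neq g(x)]$ for uniform $x\in\{0,1\}^n$, and $g$ is $\epsilon$-far from a set of functions if its distance to each member is at least $\epsilon$. *)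

theory Defs
  imports "HOL-Probability.Probability" "HOL-Combinatorics.Permutations"
begin

text \<open>Points of the cube \{0,1\}^n are functions nat => bool vanishing outside {..<n}
  (coordinates indexed 0..n-1). Boolean functions are (nat => bool) => bool; only
  their values on the cube matter.\<close>

definition cube :: "nat \<Rightarrow> (nat \<Rightarrow> bool) set" where
  "cube n = {x. \<forall>i. n \<le> i \<longrightarrow> x i = False}"

definition perm_vec :: "(nat \<Rightarrow> nat) \<Rightarrow> (nat \<Rightarrow> bool) \<Rightarrow> (nat \<Rightarrow> bool)" where
  "perm_vec \<pi> x = (\<lambda>j. x (inv \<pi> j))"

definition J_symmetric :: "nat \<Rightarrow> nat set \<Rightarrow> ((nat \<Rightarrow> bool) \<Rightarrow> bool) \<Rightarrow> bool" where
  "J_symmetric n J f \<longleftrightarrow>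
     (\<forall>\<pi>. \<pi> permutes J \<longrightarrow> (\<forall>x\<in>cube n. f (perm_vec \<pi> x) = f x))"

definition t_symmetric :: "nat \<Rightarrow> nat \<Rightarrow> ((nat \<Rightarrow> bool) \<Rightarrow> bool) \<Rightarrow> bool" where
  "t_symmetric n t f \<longleftrightarrow> (\<exists>J. J \<subseteq> {..<n} \<and> t \<le> card J \<and> J_symmetric n J f)"

definition isomorphic :: "nat \<Rightarrow> ((nat \<Rightarrow> bool) \<Rightarrow> bool) \<Rightarrow> ((nat \<Rightarrow> bool) \<Rightarrow> bool) \<Rightarrow> bool" where
  "isomorphic n g f \<longleftrightarrow>
     (\<exists>\<pi>. \<pi> permutes {..<n} \<and> (\<forall>x\<in>cube n. g x = f (perm_vec \<pi> x)))"

definition bdist :: "nat \<Rightarrow> ((nat \<Rightarrow> bool) \<Rightarrow> bool) \<Rightarrow> ((nat \<Rightarrow> bool) \<Rightarrow> bool) \<Rightarrow> real" where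
  "bdist n f g = real (card {x\<in>cube n. f x \<noteq> g x}) / 2 ^ n"

definition far_from_iso :: "nat \<Rightarrow> real \<Rightarrow> ((nat \<Rightarrow> bool) \<Rightarrow> bool) \<Rightarrow> ((nat \<Rightarrow> bool) \<Rightarrow> bool) \<Rightarrow> bool" where
  "far_from_iso n \<epsilon> g f \<longleftrightarrow> (\<forall>h. isomorphic n h f \<longrightarrow> bdist n g h \<ge> \<epsilon>)"

text \<open>Deterministic adaptive query algorithms: decision trees. Query x t1 t2 queries g at x
  and continues with t1 if g x is true, t2 otherwise; a leaf outputs accept/reject.
  A randomized algorithm is a probability distribution over such trees.\<close>
datatype qtree = Leaf bool | Query "nat \<Rightarrow> bool" qtree qtree

fun run :: "qtree \<Rightarrow> ((nat \<Rightarrow> bool) \<Rightarrow> bool) \<Rightarrow> bool" where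
  "run (Leaf b) g = b"
| "run (Query x t1 t2) g = (if g x then run t1 g else run t2 g)"

fun depth :: "qtree \<Rightarrow> nat" where
  "depth (Leaf b) = 0"
| "depth (Query x t1 t2) = Suc (max (depth t1) (depth t2))"

fun valid_qtree :: "nat \<Rightarrow> qtree \<Rightarrow> bool" where
  "valid_qtree n (Leaf b) = True"
| "valid_qtree n (Query x t1 t2) = (x \<in> cube n \<and> valid_qtree n t1 \<and> valid_qtree n t2)"

definition query_alg :: "nat \<Rightarrow> real \<Rightarrow> qtree pmf \<Rightarrow> bool" where
  "query_alg n q T \<longleftrightarrow> (\<forall>t\<in>set_pmf T. valid_qtree n t \<and> real (depth t) \<le> q)"

definition acc_prob :: "qtree pmf \<Rightarrow> ((nat \<Rightarrow> bool) \<Rightarrow> bool) \<Rightarrow> real" where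
  "acc_prob T g = measure_pmf.prob T {t. run t g}"

definition iso_tester :: "nat \<Rightarrow> real \<Rightarrow> ((nat \<Rightarrow> bool) \<Rightarrow> bool) \<Rightarrow> qtree pmf \<Rightarrow> bool" where
  "iso_tester n \<epsilon> f T \<longleftrightarrow>
     (\<forall>g. isomorphic n g f \<longrightarrow> acc_prob T g \<ge> 2/3) \<and>
     (\<forall>g. far_from_iso n \<epsilon> g f \<longrightarrow> 1 - acc_prob T g \<ge> 2/3)"

end

theory Submission
  imports Defs
begin

text \<open>
  Call a function with core \<open>C\<close> one that depends only on the coordinates in \<open>C\<close> and on the Hamming weight;
  \<open>f\<close> and all its isomorphic copies have cores of size at most \<open>k\<close>. The tester identifies coordinates:
  it cuts the coordinates at random into \<open>m = poly(k/\<epsilon>)\<close> equal classes and a small reservoir, and queries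
  points that are constant on each class, using the reservoir to give them the weight of a uniform point.
  On such points there are only \<open>m\<^sup>k\<close> candidate copies of \<open>f\<close>, so \<open>O(k log m)\<close> samples per unit of
  \<open>1/\<epsilon>\<close> leave only candidates that agree with \<open>g\<close> on most such points. Then it tests that \<open>g\<close> is
  nearly invariant under permutations outside the at most \<open>k\<close> classes used by one surviving candidate.

  Completeness holds since the classes separate the core of \<open>g\<close> with high probability. For soundness it is
  enough to find for \<open>g\<close> a core \<open>U\<close> of size less than \<open>2k\<close>, up to a small error: a random partition separates \<open>U\<close>,
  and a candidate that agrees with \<open>g\<close> there yields a copy of \<open>f\<close> close to \<open>g\<close>.

  To find \<open>U\<close>, fix a partition for which \<open>g\<close> passes and let \<open>V\<close> be the union of its \<open>k\<close> classes. Exchanging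
  coordinates of \<open>V\<close> with partners outside \<open>V\<close> keeps the weight, and these exchanges commute; the
  Fourier weights of \<open>g\<close> for the group they generate are a probability measure \<open>\<mu>\<close> on the subsets of \<open>V\<close>.
  For every other passing partition, with classes of union \<open>W\<close>, a \<open>\<mu>\<close>-random set lies in \<open>W\<close> up to probability
  \<open>O(\<delta>)\<close>. Hence the union of \<open>r = O(k/\<delta>)\<close> independent \<open>\<mu>\<close>-random sets lies in \<open>k\<close> classes of a random
  partition with probability \<open>exp(-O(k))\<close>, which is too large unless that union has fewer than \<open>2k\<close> elements with
  comparable probability; so some set of size less than \<open>2k\<close> contains a \<open>\<mu>\<close>-random set up to probability \<open>O(\<delta>)\<close>.
\<close>

section \<open>Averages over finite sets\<close>

text \<open>Division by zero makes the average over an empty or infinite set 0, so linearity,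
  monotonicity and the exchange of two averages hold without finiteness assumptions.\<close>

definition mean :: "'a set \<Rightarrow> ('a \<Rightarrow> real) \<Rightarrow> real" where
  "mean A \<phi> = (\<Sum>x\<in>A. \<phi> x) / real (card A)"

lemma mean_mono: "(\<And>x. x \<in> A \<Longrightarrow> \<phi> x \<le> \<psi> x) \<Longrightarrow> mean A \<phi> \<le> mean A \<psi>"
  unfolding mean_def by (intro divide_right_mono sum_mono) auto

lemma mean_cong: "(\<And>x. x \<in> A \<Longrightarrow> \<phi> x = \<psi> x) \<Longrightarrow> mean A \<phi> = mean A \<psi>"
  unfolding mean_def by (simp cong: sum.cong)

lemma mean_add: "mean A (\<lambda>x. \<phi> x + \<psi> x) = mean A \<phi> + mean A \<psi>"
  unfolding mean_def by (simp add: sum.distrib add_divide_distrib)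

lemma mean_diff: "mean A (\<lambda>x. \<phi> x - \<psi> x) = mean A \<phi> - mean A \<psi>"
  unfolding mean_def by (simp add: sum_subtractf diff_divide_distrib)

lemma mean_cmult: "mean A (\<lambda>x. c * \<phi> x) = c * mean A \<phi>"
  unfolding mean_def by (simp add: sum_distrib_left)

lemma mean_sum: "mean A (\<lambda>x. \<Sum>i\<in>I. \<phi> i x) = (\<Sum>i\<in>I. mean A (\<phi> i))"
  unfolding mean_def by (subst sum.swap) (simp add: sum_divide_distrib)

lemma mean_const: "finite A \<Longrightarrow> A \<noteq> {} \<Longrightarrow> mean A (\<lambda>_. c) = c"
  unfolding mean_def by (simp add: card_gt_0_iff)

lemma mean_nonneg: "(\<And>x. x \<in> A \<Longrightarrow> 0 \<le> \<phi> x) \<Longrightarrow> 0 \<le> mean A \<phi>"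
  unfolding mean_def by (intro divide_nonneg_nonneg sum_nonneg) auto

lemma mean_le_const: "finite A \<Longrightarrow> A \<noteq> {} \<Longrightarrow> (\<And>x. x \<in> A \<Longrightarrow> \<phi> x \<le> c) \<Longrightarrow> mean A \<phi> \<le> c"
  using mean_mono[of A \<phi> "\<lambda>_. c"] by (simp add: mean_const)

lemma mean_of_bool_le_1: "mean A (\<lambda>x. of_bool (P x)) \<le> 1"
proof (cases "finite A \<and> A \<noteq> {}")
  case True
  then show ?thesis by (intro mean_le_const) auto
qed (auto simp: mean_def)

lemma mean_reindex: "bij_betw h A B \<Longrightarrow> mean A (\<lambda>x. \<phi> (h x)) = mean B \<phi>"
  unfolding mean_def using sum.reindex_bij_betw[of h A B \<phi>] bij_betw_same_card[of h A B] by simp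

lemma mean_swap: "mean A (\<lambda>x. mean B (\<lambda>y. \<phi> x y)) = mean B (\<lambda>y. mean A (\<lambda>x. \<phi> x y))"
  unfolding mean_def
  by (simp add: sum_divide_distrib[symmetric] sum.swap[of _ A B])

lemma mean_prod: "mean A (\<lambda>x. mean B (\<lambda>y. \<phi> x y)) = mean (A \<times> B) (\<lambda>(x, y). \<phi> x y)"
  unfolding mean_def
  by (simp add: sum.cartesian_product[symmetric] sum_divide_distrib[symmetric] card_cartesian_product mult.commute)

lemma mean_exists_le: "finite A \<Longrightarrow> A \<noteq> {} \<Longrightarrow> \<exists>x\<in>A. \<phi> x \<le> mean A \<phi>"
proof (rule ccontr)
  assume A: "finite A" "A \<noteq> {}" and "\<not> (\<exists>x\<in>A. \<phi> x \<le> mean A \<phi>)"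
  then have "(\<Sum>x\<in>A. mean A \<phi>) < (\<Sum>x\<in>A. \<phi> x)"
    by (intro sum_strict_mono) (auto simp: not_le)
  then show False using A by (simp add: mean_def)
qed

lemma mean_markov:
  assumes "\<And>x. x \<in> A \<Longrightarrow> 0 \<le> \<phi> x" "t > 0"
  shows "mean A (\<lambda>x. of_bool (t \<le> \<phi> x)) \<le> mean A \<phi> / t"
proof -
  have "mean A (\<lambda>x. of_bool (t \<le> \<phi> x)) \<le> mean A (\<lambda>x. (1/t) * \<phi> x)"
    using assms by (intro mean_mono) (auto simp: field_simps)
  then show ?thesis by (simp only: mean_cmult) simp
qed

lemma mean_of_bool: "finite A \<Longrightarrow> mean A (\<lambda>x. of_bool (P x)) = real (card {x\<in>A. P x}) / real (card A)"
  unfolding mean_def by (simp add: sum.If_cases of_bool_def Int_def)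

lemma mean_of_bool_not:
  "finite A \<Longrightarrow> A \<noteq> {} \<Longrightarrow> mean A (\<lambda>x. of_bool (\<not> P x)) = 1 - mean A (\<lambda>x. of_bool (P x))"
  using mean_diff[of A "\<lambda>_. 1" "\<lambda>x. of_bool (P x)"] mean_const[of A 1]
  by (simp add: of_bool_not_iff)

section \<open>The cube and permutations of coordinates\<close>

definition wt :: "(nat \<Rightarrow> bool) \<Rightarrow> nat" where
  "wt x = card {i. x i}"

definition core_dep :: "nat \<Rightarrow> nat set \<Rightarrow> ((nat \<Rightarrow> bool) \<Rightarrow> bool) \<Rightarrow> bool" where
  "core_dep n C h \<longleftrightarrow>
     (\<forall>x\<in>cube n. \<forall>z\<in>cube n. (\<forall>i\<in>C. x i = z i) \<longrightarrow> wt x = wt z \<longrightarrow> h x = h z)"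

abbreviation perms :: "nat set \<Rightarrow> (nat \<Rightarrow> nat) set" where
  "perms S \<equiv> {\<pi>. \<pi> permutes S}"

abbreviation avg :: "nat \<Rightarrow> ((nat \<Rightarrow> bool) \<Rightarrow> real) \<Rightarrow> real" where
  "avg n \<equiv> mean (cube n)"

abbreviation avg_perm :: "nat \<Rightarrow> ((nat \<Rightarrow> nat) \<Rightarrow> real) \<Rightarrow> real" where
  "avg_perm n \<equiv> mean (perms {..<n})"

lemma bij_betw_Collect_cube: "bij_betw Collect (cube n) (Pow {..<n})"
  by (rule bij_betwI[where g = "\<lambda>X i. i \<in> X"])
     (use leI in \<open>auto simp: cube_def fun_eq_iff\<close>)

lemma finite_cube [simp]: "finite (cube n)"
  using bij_betw_Collect_cube[of n] bij_betw_finite by blast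

lemma card_cube [simp]: "card (cube n) = 2 ^ n"
  using bij_betw_same_card[OF bij_betw_Collect_cube[of n]] by (simp add: card_Pow)

lemma cube_nonempty [simp]: "cube n \<noteq> {}"
  using card_cube[of n] by (metis card.empty power_not_zero zero_neq_numeral)

lemma cube_support: "x \<in> cube n \<Longrightarrow> {i. x i} \<subseteq> {..<n}"
  by (auto simp: cube_def not_le intro: ccontr)

lemma finite_support: "x \<in> cube n \<Longrightarrow> finite {i. x i}"
  using cube_support finite_subset by blast

lemma wt_eq_sum:
  assumes "x \<in> cube n"
  shows "of_nat (wt x) = (\<Sum>i<n. of_bool (x i) :: 'a :: semiring_1)"
proof -
  have "{i\<in>{..<n}. x i} = {i. x i}" using cube_support[OF assms] by auto
  then show ?thesis by (simp add: wt_def of_bool_def sum.If_cases Int_def)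
qed

lemma bdist_mean: "bdist n f g = avg n (\<lambda>x. of_bool (f x \<noteq> g x))"
  by (simp add: bdist_def mean_of_bool)

lemma bdist_triangle: "bdist n f h \<le> bdist n f g + bdist n g h"
  unfolding bdist_mean mean_add[symmetric] by (intro mean_mono) auto

section \<open>The action of coordinate permutations on the cube\<close>

lemma perm_vec_in_cube: "\<pi> permutes {..<n} \<Longrightarrow> x \<in> cube n \<Longrightarrow> perm_vec \<pi> x \<in> cube n"
  unfolding cube_def perm_vec_def
  using permutes_not_in[OF permutes_inv[of \<pi> "{..<n}"]] by auto

lemma perm_vec_comp: "bij \<pi> \<Longrightarrow> bij \<kappa> \<Longrightarrow> perm_vec \<pi> (perm_vec \<kappa> x) = perm_vec (\<pi> \<circ> \<kappa>) x"
  unfolding perm_vec_def by (simp add: o_inv_distrib)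

lemma perm_vec_id [simp]: "perm_vec id x = x"
  by (simp add: perm_vec_def)

lemma perm_vec_inv: "bij \<pi> \<Longrightarrow> perm_vec (inv \<pi>) (perm_vec \<pi> x) = x"
  by (simp add: perm_vec_comp bij_imp_bij_inv bij_is_inj)

lemma perm_vec_inv': "bij \<pi> \<Longrightarrow> perm_vec \<pi> (perm_vec (inv \<pi>) x) = x"
  by (metis perm_vec_inv bij_imp_bij_inv inv_inv_eq)

lemma perm_vec_apply: "bij \<pi> \<Longrightarrow> perm_vec \<pi> x (\<pi> i) = x i"
  by (simp add: perm_vec_def bij_is_inj)

lemma wt_perm_vec: "bij \<pi> \<Longrightarrow> wt (perm_vec \<pi> x) = wt x"
proof -
  assume b: "bij \<pi>"
  have "{i. perm_vec \<pi> x i} = inv \<pi> -` {i. x i}"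
    by (auto simp: perm_vec_def)
  then have "{i. perm_vec \<pi> x i} = \<pi> ` {i. x i}"
    by (simp only: bij_vimage_eq_inv_image[OF bij_imp_bij_inv[OF b]] inv_inv_eq[OF b])
  then show ?thesis
    unfolding wt_def using card_image[OF inj_on_subset[OF bij_is_inj[OF b] subset_UNIV]] by simp
qed

lemma bij_betw_perm_vec: "\<pi> permutes {..<n} \<Longrightarrow> bij_betw (perm_vec \<pi>) (cube n) (cube n)"
  by (rule bij_betwI[where g = "perm_vec (inv \<pi>)"])
     (auto simp: perm_vec_in_cube permutes_inv perm_vec_inv perm_vec_inv' permutes_bij)

lemma mean_cube_perm:
  "\<pi> permutes {..<n} \<Longrightarrow> avg n (\<lambda>x. \<phi> (perm_vec \<pi> x)) = avg n \<phi>"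
  by (rule mean_reindex[OF bij_betw_perm_vec])

lemma isomorphic_comp:
  assumes "\<pi> permutes {..<n}" "\<zeta> permutes {..<n}"
  shows "isomorphic n (\<lambda>x. f (perm_vec \<pi> (perm_vec (inv \<zeta>) x))) f"
  unfolding isomorphic_def
proof (intro exI[of _ "\<pi> \<circ> inv \<zeta>"] conjI ballI)
  show "\<pi> \<circ> inv \<zeta> permutes {..<n}" using assms by (intro permutes_compose permutes_inv)
  show "f (perm_vec \<pi> (perm_vec (inv \<zeta>) x)) = f (perm_vec (\<pi> \<circ> inv \<zeta>) x)" for x
    by (simp only: perm_vec_comp[OF permutes_bij[OF assms(1)] permutes_bij[OF permutes_inv[OF assms(2)]]])
qed

text \<open>The substitution of \<open>perm_vec \<zeta> u\<close> for a uniform point. It lets a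
  copy of \<open>f\<close> be compared with \<open>g\<close> in the coordinates of the samples
  \<open>u\<close>.\<close>

lemma bdist_perm_vec:
  assumes "\<zeta> permutes {..<n}"
  shows "bdist n g (\<lambda>x. h (perm_vec (inv \<zeta>) x)) = avg n (\<lambda>u. of_bool (g (perm_vec \<zeta> u) \<noteq> h u))"
proof -
  have "bdist n g (\<lambda>x. h (perm_vec (inv \<zeta>) x)) = avg n
      (\<lambda>u. of_bool (g (perm_vec \<zeta> u) \<noteq> h (perm_vec (inv \<zeta>) (perm_vec \<zeta> u))))"
    unfolding bdist_mean by (rule mean_cube_perm[OF assms, symmetric])
  then show ?thesis by (simp add: perm_vec_inv[OF permutes_bij[OF assms]])
qed

text \<open>The complements in \<open>S\<close> of \<open>A\<close> and of its image have equal
  size, so any bijection between them completes \<open>f\<close>.\<close>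

lemma permutes_extend:
  assumes "finite S" "A \<subseteq> S" "inj_on f A" "f ` A \<subseteq> S"
  shows "\<exists>\<kappa>. \<kappa> permutes S \<and> (\<forall>a\<in>A. \<kappa> a = f a)"
proof -
  have fin: "finite A" "finite (f ` A)" using assms finite_subset by auto
  have "card (S - A) = card (S - f ` A)"
    using assms fin by (simp add: card_Diff_subset card_image)
  then obtain h where h: "bij_betw h (S - A) (S - f ` A)"
    using finite_same_card_bij[of "S - A" "S - f ` A"] assms by auto
  define \<kappa> where "\<kappa> = (\<lambda>i. if i \<in> A then f i else if i \<in> S then h i else i)"
  have "bij_betw \<kappa> (A \<union> (S - A)) (f ` A \<union> (S - f ` A))"
  proof (rule bij_betw_combine)
    show "bij_betw \<kappa> A (f ` A)"
      using assms(3) by (auto simp: \<kappa>_def bij_betw_def inj_on_def)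
    show "bij_betw \<kappa> (S - A) (S - f ` A)"
      using h by (rule bij_betw_cong[THEN iffD1, rotated]) (auto simp: \<kappa>_def)
  qed auto
  moreover have "A \<union> (S - A) = S" "f ` A \<union> (S - f ` A) = S" using assms by auto
  ultimately have "\<kappa> permutes S"
    by (intro bij_imp_permutes) (auto simp: \<kappa>_def assms(2)[THEN subsetD])
  then show ?thesis by (intro exI[of _ \<kappa>]) (auto simp: \<kappa>_def)
qed

text \<open>The supports agree on \<open>C\<close> and have equally many points outside it, so a
  bijection between the outer parts extends to a permutation that fixes \<open>C\<close>.\<close>

lemma same_weight_perm:
  assumes x: "x \<in> cube n" and z: "z \<in> cube n"
    and eq: "\<And>i. i \<in> C \<Longrightarrow> x i = z i" and w: "wt x = wt z"
  shows "\<exists>\<kappa>. \<kappa> permutes ({..<n} - C) \<and> perm_vec \<kappa> x = z"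
proof -
  define X Z where "X = {i. x i}" and "Z = {i. z i}"
  have XZ: "X \<subseteq> {..<n}" "Z \<subseteq> {..<n}" "finite X" "finite Z"
    using x z cube_support finite_support by (auto simp: X_def Z_def)
  have int: "X \<inter> C = Z \<inter> C" using eq by (auto simp: X_def Z_def)
  have "card (X - C) = card (Z - C)"
    using w int XZ by (simp add: X_def[symmetric] Z_def[symmetric] wt_def card_Diff_subset_Int)
  then obtain h where h: "bij_betw h (X - C) (Z - C)"
    using finite_same_card_bij[of "X - C" "Z - C"] XZ by auto
  obtain \<kappa> where \<kappa>: "\<kappa> permutes ({..<n} - C)" "\<And>a. a \<in> X - C \<Longrightarrow> \<kappa> a = h a"
    using permutes_extend[of "{..<n} - C" "X - C" h] h XZ unfolding bij_betw_def
    by (metis Diff_mono finite_Diff finite_lessThan order_refl)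
  have img: "\<kappa> ` (X - C) = Z - C"
    using h \<kappa>(2) by (auto simp: bij_betw_def image_iff)
  have fixC: "\<kappa> i = i" if "i \<in> C" for i
    using \<kappa>(1) that by (simp add: permutes_not_in)
  have "\<kappa> ` X = \<kappa> ` (X - C) \<union> \<kappa> ` (X \<inter> C)" by blast
  also have "\<kappa> ` (X \<inter> C) = X \<inter> C" using fixC by force
  finally have "\<kappa> ` X = Z" using img int by blast
  then have "inv \<kappa> -` X = Z"
    by (simp only: bij_vimage_eq_inv_image[OF bij_imp_bij_inv[OF permutes_bij[OF \<kappa>(1)]]]
        inv_inv_eq[OF permutes_bij[OF \<kappa>(1)]])
  then have "perm_vec \<kappa> x = z"
    by (auto simp: fun_eq_iff perm_vec_def X_def Z_def)
  then show ?thesis using \<kappa> by blast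
qed

lemma core_depD:
  "core_dep n C h \<Longrightarrow> x \<in> cube n \<Longrightarrow> z \<in> cube n \<Longrightarrow> (\<And>i. i \<in> C \<Longrightarrow> x i = z i) \<Longrightarrow>
    wt x = wt z \<Longrightarrow> h x = h z"
  unfolding core_dep_def by blast

text \<open>On the cube, the orbits of the permutations outside \<open>C\<close> are exactly the
  classes of points with prescribed values on \<open>C\<close> and prescribed weight.\<close>

lemma core_dep_iff_perm:
  "core_dep n C h \<longleftrightarrow> (\<forall>\<kappa>. \<kappa> permutes ({..<n} - C) \<longrightarrow> (\<forall>x\<in>cube n. h (perm_vec \<kappa> x) = h x))"
proof
  assume h: "core_dep n C h"
  show "\<forall>\<kappa>. \<kappa> permutes ({..<n} - C) \<longrightarrow> (\<forall>x\<in>cube n. h (perm_vec \<kappa> x) = h x)"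
  proof (intro allI impI ballI)
  fix \<kappa> x assume \<kappa>: "\<kappa> permutes ({..<n} - C)" and x: "x \<in> cube n"
  have "\<kappa> permutes {..<n}" using \<kappa> by (rule permutes_subset) auto
  then have 1: "perm_vec \<kappa> x \<in> cube n" "wt (perm_vec \<kappa> x) = wt x"
    using x by (auto simp: perm_vec_in_cube wt_perm_vec permutes_bij)
  have 2: "perm_vec \<kappa> x i = x i" if "i \<in> C" for i
    using permutes_not_in[OF permutes_inv[OF \<kappa>], of i] that by (simp add: perm_vec_def)
  show "h (perm_vec \<kappa> x) = h x" using 1 2 by (intro core_depD[OF h _ x])
  qed
next
  assume "\<forall>\<kappa>. \<kappa> permutes ({..<n} - C) \<longrightarrow> (\<forall>x\<in>cube n. h (perm_vec \<kappa> x) = h x)"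
  then show "core_dep n C h"
    unfolding core_dep_def by (metis same_weight_perm)
qed

lemma core_dep_mono: "core_dep n C h \<Longrightarrow> C \<subseteq> C' \<Longrightarrow> core_dep n C' h"
  unfolding core_dep_def by blast

text \<open>Coordinate \<open>c\<close> of \<open>perm_vec \<pi> x\<close> is
  \<open>x (inv \<pi> c)\<close>, so the core moves by the inverse.\<close>

lemma core_dep_perm_vec:
  assumes h: "core_dep n C h" and \<pi>: "\<pi> permutes {..<n}"
  shows "core_dep n (inv \<pi> ` C) (\<lambda>x. h (perm_vec \<pi> x))"
  unfolding core_dep_def
proof (intro ballI impI)
  fix x z assume xz: "x \<in> cube n" "z \<in> cube n" "\<forall>i\<in>inv \<pi> ` C. x i = z i" "wt x = wt z"
  then show "h (perm_vec \<pi> x) = h (perm_vec \<pi> z)"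
    using \<pi> by (intro core_depD[OF h])
      (auto simp: perm_vec_in_cube wt_perm_vec permutes_bij, auto simp: perm_vec_def)
qed

lemma J_symmetric_core_dep:
  assumes "J \<subseteq> {..<n}" "J_symmetric n J f"
  shows "core_dep n ({..<n} - J) f"
proof -
  have "{..<n} - ({..<n} - J) = J" using assms by auto
  then show ?thesis using assms unfolding core_dep_iff_perm J_symmetric_def by simp
qed

section \<open>Permutation groups as averaging domains\<close>

lemma finite_perms [simp]: "finite S \<Longrightarrow> finite (perms S)"
  by (rule finite_permutations)

lemma perms_nonempty [simp]: "perms S \<noteq> {}"
  using permutes_id[of S] by blast

lemma ex_permutes [simp]: "\<exists>\<pi>. \<pi> permutes S"
  using permutes_id[of S] by blast

lemma bij_betw_perms_comp_right: "\<kappa> permutes S \<Longrightarrow> bij_betw (\<lambda>\<pi>. \<pi> \<circ> \<kappa>) (perms S) (perms S)"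
  by (rule bij_betwI[where g = "\<lambda>\<pi>. \<pi> \<circ> inv \<kappa>"])
     (auto simp: permutes_compose permutes_inv o_assoc[symmetric] permutes_inv_o)

lemma bij_betw_perms_inv: "bij_betw inv (perms S) (perms S)"
  by (rule bij_betwI[where g = inv]) (auto simp: permutes_inv permutes_inv_inv)

section \<open>Symmetric influence\<close>

text \<open>This is the symmetric influence of the complement of \<open>V\<close>: the argument
  names the coordinates that stay fixed.\<close>

definition sym_inf :: "nat \<Rightarrow> nat set \<Rightarrow> ((nat \<Rightarrow> bool) \<Rightarrow> bool) \<Rightarrow> real" where
  "sym_inf n V g =
     mean (perms ({..<n} - V)) (\<lambda>\<pi>. avg n (\<lambda>x. of_bool (g x \<noteq> g (perm_vec \<pi> x))))"

lemma perms_diff_permutes: "\<pi> permutes ({..<n} - V) \<Longrightarrow> \<pi> permutes {..<n}"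
  by (rule permutes_subset) auto

text \<open>Since \<open>h\<close> is unchanged by such a permutation, a change of \<open>g\<close>
  forces \<open>g\<close> to differ from \<open>h\<close> at one of the two points, and each of them
  is uniform.\<close>

lemma sym_inf_le_bdist:
  assumes h: "core_dep n V h"
  shows "sym_inf n V g \<le> 2 * bdist n g h"
  unfolding sym_inf_def
proof (rule mean_le_const)
  fix \<pi> assume "\<pi> \<in> perms ({..<n} - V)"
  then have \<pi>: "\<pi> permutes ({..<n} - V)" "\<pi> permutes {..<n}"
    using perms_diff_permutes by auto
  have "avg n (\<lambda>x. of_bool (g x \<noteq> g (perm_vec \<pi> x)))
      \<le> avg n (\<lambda>x. of_bool (g x \<noteq> h x) + of_bool (g (perm_vec \<pi> x) \<noteq> h (perm_vec \<pi> x)))"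
    using h \<pi>(1) by (intro mean_mono) (auto simp: core_dep_iff_perm)
  also have "... = 2 * bdist n g h"
    using mean_cube_perm[OF \<pi>(2), of "\<lambda>x. of_bool (g x \<noteq> h x)"] by (simp add: mean_add bdist_mean)
  finally show "avg n (\<lambda>x. of_bool (g x \<noteq> g (perm_vec \<pi> x))) \<le> 2 * bdist n g h" .
qed auto

text \<open>The approximating function takes the majority value of \<open>g\<close> on each orbit.\<close>

lemma sym_inf_close:
  "\<exists>G. core_dep n V G \<and> bdist n g G \<le> sym_inf n V g"
proof -
  let ?P = "perms ({..<n} - V)"
  define H where "H = (\<lambda>x. mean ?P (\<lambda>\<pi>. of_bool (g (perm_vec \<pi> x))))"
  define G where "G = (\<lambda>x. H x > 1/2)"
  have H_inv: "H (perm_vec \<kappa> x) = H x" if "\<kappa> permutes ({..<n} - V)" for \<kappa> x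
  proof -
    have "H (perm_vec \<kappa> x) = mean ?P (\<lambda>\<pi>. of_bool (g (perm_vec (\<pi> \<circ> \<kappa>) x)))"
      unfolding H_def using that by (intro mean_cong) (auto simp: perm_vec_comp permutes_bij)
    also have "... = H x"
      unfolding H_def by (rule mean_reindex[OF bij_betw_perms_comp_right[OF that]])
    finally show ?thesis .
  qed
  have H01: "0 \<le> H x" "H x \<le> 1" for x
    unfolding H_def by (auto intro: mean_nonneg mean_of_bool_le_1)
  \<comment> \<open>A permuted uniform point is uniform, so an average over each orbit may be
    inserted.\<close>
  have orbit: "avg n \<psi> = avg n (\<lambda>x. mean ?P (\<lambda>\<pi>. \<psi> (perm_vec \<pi> x)))" for \<psi>
  proof -
    have "avg n (\<lambda>x. mean ?P (\<lambda>\<pi>. \<psi> (perm_vec \<pi> x)))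
        = mean ?P (\<lambda>\<pi>. avg n (\<lambda>x. \<psi> (perm_vec \<pi> x)))" by (rule mean_swap)
    also have "... = mean ?P (\<lambda>\<pi>. avg n \<psi>)"
      using perms_diff_permutes by (intro mean_cong mean_cube_perm) auto
    also have "... = avg n \<psi>"
      by (rule mean_const) auto
    finally show ?thesis by simp
  qed
  have mean_lin: "mean ?P (\<lambda>\<pi>. a + b * of_bool (g (perm_vec \<pi> x))) = a + b * H x" for a b x
    unfolding H_def by (simp add: mean_add mean_cmult mean_const)
  have "core_dep n V G"
    unfolding core_dep_iff_perm G_def using H_inv by simp
  moreover have "bdist n g G \<le> sym_inf n V g"
  proof -
    have "bdist n g G = avg n (\<lambda>x. mean ?P (\<lambda>\<pi>. of_bool (g (perm_vec \<pi> x) \<noteq> G (perm_vec \<pi> x))))"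
      unfolding bdist_mean by (rule orbit)
    also have "... = avg n (\<lambda>x. if G x then 1 - H x else H x)"
    proof (intro mean_cong)
      fix x
      have "mean ?P (\<lambda>\<pi>. of_bool (g (perm_vec \<pi> x) \<noteq> G (perm_vec \<pi> x)))
          = mean ?P (\<lambda>\<pi>. (if G x then 1 else 0) + (if G x then -1 else 1) * of_bool (g (perm_vec \<pi> x)))"
        by (intro mean_cong) (auto simp: G_def H_inv)
      then show "mean ?P (\<lambda>\<pi>. of_bool (g (perm_vec \<pi> x) \<noteq> G (perm_vec \<pi> x))) = (if G x then 1 - H x else H x)"
        by (simp add: mean_lin)
    qed
    \<comment> \<open>With \<open>p = H x\<close>, the smaller of p and 1 - p is at most 2 p (1 -
      p), the probability that two independent points of the orbit receive different values.\<close>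
    also have "... \<le> avg n (\<lambda>x. 2 * H x * (1 - H x))"
    proof (intro mean_mono)
      fix x
      show "(if G x then 1 - H x else H x) \<le> 2 * H x * (1 - H x)"
      proof (cases "G x")
        case True
        then have "1 * (1 - H x) \<le> (2 * H x) * (1 - H x)"
          using H01[of x] by (intro mult_right_mono) (auto simp: G_def)
        then show ?thesis using True by simp
      next
        case False
        then have "H x * 1 \<le> H x * (2 * (1 - H x))"
          using H01[of x] by (intro mult_left_mono) (auto simp: G_def)
        then show ?thesis using False by (simp add: algebra_simps)
      qed
    qed
    \<comment> \<open>Written as an orbit average of an expression linear in the value of
      \<open>g\<close>, the term loses that average by \<open>orbit\<close>, and \<open>x\<close>
      itself becomes one of the two points.\<close>
    also have "... = avg n (\<lambda>x. mean ?P (\<lambda>\<pi>. H x + (1 - 2 * H x) * of_bool (g (perm_vec \<pi> x))))"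
      by (intro mean_cong) (simp only: mean_lin, simp add: algebra_simps)
    also have "... = avg n (\<lambda>x. H x + (1 - 2 * H x) * of_bool (g x))"
    proof -
      have "avg n (\<lambda>x. H x + (1 - 2 * H x) * of_bool (g x)) = avg n
         (\<lambda>x. mean ?P (\<lambda>\<pi>. H (perm_vec \<pi> x) + (1 - 2 * H (perm_vec \<pi> x)) * of_bool (g (perm_vec \<pi> x))))"
        by (rule orbit)
      also have "... = avg n (\<lambda>x. mean ?P (\<lambda>\<pi>. H x + (1 - 2 * H x) * of_bool (g (perm_vec \<pi> x))))"
        by (intro mean_cong) (simp add: H_inv)
      finally show ?thesis by simp
    qed
    also have "... = avg n (\<lambda>x. mean ?P (\<lambda>\<pi>. of_bool (g x \<noteq> g (perm_vec \<pi> x))))"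
    proof (intro mean_cong)
      fix x
      have "mean ?P (\<lambda>\<pi>. of_bool (g x \<noteq> g (perm_vec \<pi> x)))
          = mean ?P (\<lambda>\<pi>. (if g x then 1 else 0) + (if g x then -1 else 1) * of_bool (g (perm_vec \<pi> x)))"
        by (intro mean_cong) auto
      then show "H x + (1 - 2 * H x) * of_bool (g x) = mean ?P (\<lambda>\<pi>. of_bool (g x \<noteq> g (perm_vec \<pi> x)))"
        by (simp add: mean_lin)
    qed
    also have "... = sym_inf n V g"
      unfolding sym_inf_def by (rule mean_swap)
    finally show ?thesis .
  qed
  ultimately show ?thesis by blast
qed

section \<open>Random permutations\<close>

lemma mean_perms_comp: "\<tau> permutes S \<Longrightarrow> mean (perms S) (\<lambda>\<rho>. \<phi> (\<rho> \<circ> \<tau>)) = mean (perms S) \<phi>"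
  by (rule mean_reindex[OF bij_betw_perms_comp_right])

lemma mean_perms_inv: "mean (perms S) (\<lambda>\<rho>. \<phi> (inv \<rho>)) = mean (perms S) \<phi>"
  by (rule mean_reindex[OF bij_betw_perms_inv])

text \<open>Since \<open>b u\<close> has the weight of \<open>u\<close>, a random permutation maps both to the same distribution.\<close>

lemma mean_scrambled_le:
  assumes b: "\<And>u. u \<in> cube n \<Longrightarrow> nv u \<Longrightarrow> b u \<in> cube n \<and> wt (b u) = wt u"
  shows "avg_perm n (\<lambda>\<rho>. avg n (\<lambda>u. of_bool (nv u \<and> P (perm_vec \<rho> (b u)))))
       \<le> avg n (\<lambda>x. of_bool (P x))"
proof -
  have "avg_perm n (\<lambda>\<rho>. avg n (\<lambda>u. of_bool (nv u \<and> P (perm_vec \<rho> (b u)))))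
      = avg n (\<lambda>u. avg_perm n (\<lambda>\<rho>. of_bool (nv u \<and> P (perm_vec \<rho> (b u)))))"
    by (rule mean_swap)
  also have "... \<le> avg n (\<lambda>u. avg_perm n (\<lambda>\<rho>. of_bool (P (perm_vec \<rho> u))))"
  proof (rule mean_mono)
    fix u assume u: "u \<in> cube n"
    show "avg_perm n (\<lambda>\<rho>. of_bool (nv u \<and> P (perm_vec \<rho> (b u))))
        \<le> avg_perm n (\<lambda>\<rho>. of_bool (P (perm_vec \<rho> u)))"
    proof (cases "nv u")
      case True
      then obtain \<kappa> where \<kappa>: "\<kappa> permutes {..<n}" "perm_vec \<kappa> u = b u"
        using same_weight_perm[of u n "b u" "{}"] u b by auto
      have "avg_perm n (\<lambda>\<rho>. of_bool (nv u \<and> P (perm_vec \<rho> (b u))))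
          = avg_perm n (\<lambda>\<rho>. of_bool (P (perm_vec (\<rho> \<circ> \<kappa>) u)))"
        using True \<kappa> by (intro mean_cong) (auto simp: perm_vec_comp[symmetric] permutes_bij)
      also have "... = avg_perm n (\<lambda>\<rho>. of_bool (P (perm_vec \<rho> u)))"
        using \<kappa>(1) by (rule mean_perms_comp)
      finally show ?thesis by simp
    next
      case False
      then show ?thesis by (auto intro!: mean_mono)
    qed
  qed
  also have "... = avg_perm n (\<lambda>\<rho>. avg n (\<lambda>u. of_bool (P (perm_vec \<rho> u))))"
    by (rule mean_swap)
  also have "... = avg_perm n (\<lambda>\<rho>. avg n (\<lambda>x. of_bool (P x)))"
    by (intro mean_cong mean_cube_perm) auto
  finally show ?thesis by (simp add: mean_const)
qed

text \<open>The images of the elements of \<open>U\<close> are drawn without replacement: once j of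
  them lie in \<open>B\<close>, the next one does with probability (|B| - j) / (n - j), which is at
  most |B| / n.\<close>

lemma mean_perms_image_subset:
  assumes "U \<subseteq> {..<n}" "B \<subseteq> {..<n}"
  shows "avg_perm n (\<lambda>\<rho>. of_bool (\<rho> ` U \<subseteq> B)) \<le> (real (card B) / real n) ^ card U"
proof -
  have "finite U" using assms finite_subset by auto
  then show ?thesis using assms(1)
  proof (induction U rule: finite_induct)
    case empty
    then show ?case by (simp add: mean_const)
  next
    case (insert a U)
    define P where "P = (\<lambda>U. avg_perm n (\<lambda>\<rho>. of_bool (\<rho> ` U \<subseteq> B)))"
    have n: "card U < n" "U \<subseteq> {..<n}" "a < n"
      using insert psubset_card_mono[of "{..<n}" U] by auto
    have cB: "card B \<le> n" using card_mono[OF _ assms(2)] by simp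
    \<comment> \<open>A transposition shows that each new element \<open>a'\<close> gives the same
      probability, which may therefore be averaged over \<open>a'\<close>.\<close>
    have sym: "P (insert a' U) = P (insert a U)" if "a' \<in> {..<n} - U" for a'
    proof -
      have tr: "Transposition.transpose a a' permutes {..<n}" using that n by (intro permutes_swap_id) auto
      have "Transposition.transpose a a' ` insert a U = insert a' U"
        using that insert by (auto simp: Transposition.transpose_def image_iff)
      then have "P (insert a' U) = avg_perm n (\<lambda>\<rho>. of_bool ((\<rho> \<circ> Transposition.transpose a a') ` insert a U \<subseteq> B))"
        unfolding P_def by (simp only: image_comp[symmetric])
      then show ?thesis unfolding P_def using mean_perms_comp[OF tr, of "\<lambda>\<rho>. of_bool (\<rho> ` insert a U \<subseteq> B)"] by simp
    qed
    \<comment> \<open>For fixed \<open>\<rho>\<close> mapping \<open>U\<close> into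
      \<open>B\<close>, the suitable \<open>a'\<close> are the preimages of the points of
      \<open>B\<close> not yet hit.\<close>
    have count: "(\<Sum>a'\<in>{..<n} - U. of_bool (\<rho> ` insert a' U \<subseteq> B))
        = (real (card B) - real (card U)) * of_bool (\<rho> ` U \<subseteq> B)" if "\<rho> permutes {..<n}" for \<rho>
    proof (cases "\<rho> ` U \<subseteq> B")
      case True
      have inj: "inj_on \<rho> X" for X using permutes_inj[OF that] inj_on_subset by blast
      have "{a'\<in>{..<n} - U. \<rho> a' \<in> B} = inv \<rho> ` (B - \<rho> ` U)"
      proof -
        have inv_lt: "inv \<rho> y < n" if "y \<in> B" for y
          using permutes_in_image[OF permutes_inv[OF \<open>\<rho> permutes {..<n}\<close>], of y] that assms(2) by auto
        show ?thesis
        proof (intro equalityI subsetI)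
          fix x assume "x \<in> {a' \<in> {..<n} - U. \<rho> a' \<in> B}"
          then have "\<rho> x \<in> B - \<rho> ` U" "x = inv \<rho> (\<rho> x)"
            by (simp_all add: inj_image_mem_iff[OF permutes_inj[OF that]] permutes_inverses[OF that])
          then show "x \<in> inv \<rho> ` (B - \<rho> ` U)" by blast
        next
          fix x assume "x \<in> inv \<rho> ` (B - \<rho> ` U)"
          then obtain y where y: "y \<in> B - \<rho> ` U" "x = inv \<rho> y" by blast
          then have "\<rho> x = y" by (simp add: permutes_inverses[OF that])
          then show "x \<in> {a' \<in> {..<n} - U. \<rho> a' \<in> B}"
            using y inv_lt imageI[of "inv \<rho> y" U \<rho>] by auto
        qed
      qed
      then have "card {a'\<in>{..<n} - U. \<rho> a' \<in> B} = card (B - \<rho> ` U)"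
        using card_image[OF inj_on_subset[OF permutes_inj[OF permutes_inv[OF that]] subset_UNIV]] by simp
      also have "... = card B - card U"
        using True insert inj by (simp add: card_Diff_subset card_image)
      finally have "real (card {a'\<in>{..<n} - U. \<rho> a' \<in> B}) = real (card B) - real (card U)"
        using card_mono[OF _ True] card_image[OF inj, of U] finite_subset[OF assms(2)] by (simp add: of_nat_diff)
      then show ?thesis using True by (simp add: of_bool_def sum.If_cases Int_def)
    qed auto
    have "real (n - card U) * P (insert a U) = (\<Sum>a'\<in>{..<n} - U. P (insert a' U))"
      using sum.cong[OF refl sym, of "{..<n} - U" "\<lambda>b. b"] n insert by (simp add: card_Diff_subset)
    also have "... = avg_perm n (\<lambda>\<rho>. \<Sum>a'\<in>{..<n} - U. of_bool (\<rho> ` insert a' U \<subseteq> B))"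
      unfolding P_def by (rule mean_sum[symmetric])
    also have "... = avg_perm n (\<lambda>\<rho>. (real (card B) - real (card U)) * of_bool (\<rho> ` U \<subseteq> B))"
      by (intro mean_cong count) auto
    finally have eq: "real (n - card U) * P (insert a U) = (real (card B) - real (card U)) * P U"
      unfolding P_def by (simp add: mean_cmult)
    have P0: "P U \<ge> 0" unfolding P_def by (intro mean_nonneg) auto
    have "P (insert a U) = (real (card B) - real (card U)) / real (n - card U) * P U"
      using eq n by (simp add: field_simps)
    also have "... \<le> real (card B) / real n * P U"
    proof (intro mult_right_mono P0)
      have "real (card B) * real (card U) \<le> real n * real (card U)" using cB by (intro mult_right_mono) auto
      then show "(real (card B) - real (card U)) / real (n - card U) \<le> real (card B) / real n"
        using n by (simp add: of_nat_diff divide_simps algebra_simps)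
    qed
    also have "... \<le> real (card B) / real n * (real (card B) / real n) ^ card U"
      unfolding P_def using n by (intro mult_left_mono insert.IH) auto
    finally show ?case using insert by (simp add: P_def)
  qed
qed

text \<open>By symmetry \<open>\<rho> a'\<close> is uniform over the n - 1 points other than
  \<open>\<rho> a\<close>, and at most \<open>c\<close> points are related to
  \<open>\<rho> a\<close>. The factor 2 absorbs n \<le> 2 (n - 1).\<close>

lemma mean_perms_related_pair:
  assumes aa: "a < n" "a' < n" "a \<noteq> a'"
    and c: "\<And>i. i < n \<Longrightarrow> card {j\<in>{..<n}. R i j} \<le> c"
  shows "avg_perm n (\<lambda>\<rho>. of_bool (R (\<rho> a) (\<rho> a'))) \<le> 2 * real c / real n"
proof -
  define P where "P = (\<lambda>a'. avg_perm n (\<lambda>\<rho>. of_bool (R (\<rho> a) (\<rho> a'))))"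
  have sym: "P b = P a'" if "b \<in> {..<n} - {a}" for b
  proof -
    have tr: "Transposition.transpose a' b permutes {..<n}" using that aa by (intro permutes_swap_id) auto
    have "P b = avg_perm n (\<lambda>\<rho>. of_bool (R ((\<rho> \<circ> Transposition.transpose a' b) a) ((\<rho> \<circ> Transposition.transpose a' b) a')))"
      unfolding P_def using that aa by (intro mean_cong) (auto simp: Transposition.transpose_def)
    then show ?thesis unfolding P_def
      using mean_perms_comp[OF tr, of "\<lambda>\<rho>. of_bool (R (\<rho> a) (\<rho> a'))"] by simp
  qed
  have "real (n - 1) * P a' = (\<Sum>b\<in>{..<n} - {a}. P b)"
    using sum.cong[OF refl sym, of "{..<n} - {a}" "\<lambda>b. b"] aa by (simp add: card_Diff_subset)
  also have "... = avg_perm n (\<lambda>\<rho>. \<Sum>b\<in>{..<n} - {a}. of_bool (R (\<rho> a) (\<rho> b)))"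
    unfolding P_def by (rule mean_sum[symmetric])
  also have "... \<le> real c"
  proof (rule mean_le_const)
    fix \<rho> assume "\<rho> \<in> perms {..<n}"
    then have \<rho>: "\<rho> permutes {..<n}" by simp
    have "(\<Sum>b\<in>{..<n} - {a}. of_bool (R (\<rho> a) (\<rho> b)) :: real) \<le> (\<Sum>b\<in>{..<n}. of_bool (R (\<rho> a) (\<rho> b)))"
      by (intro sum_mono2) auto
    also have "... = (\<Sum>j\<in>{..<n}. of_bool (R (\<rho> a) j))"
      by (rule sum.reindex_bij_betw[OF permutes_imp_bij[OF \<rho>]])
    also have "... = real (card {j\<in>{..<n}. R (\<rho> a) j})"
      by (simp add: of_bool_def sum.If_cases Int_def)
    also have "... \<le> real c" using c permutes_in_image[OF \<rho>] aa by auto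
    finally show "(\<Sum>b\<in>{..<n} - {a}. of_bool (R (\<rho> a) (\<rho> b)) :: real) \<le> real c" .
  qed auto
  finally have "real (n - 1) * P a' \<le> real c" .
  moreover have "P a' \<ge> 0" unfolding P_def by (intro mean_nonneg) auto
  moreover have "real n \<le> 2 * real (n - 1)" using aa by linarith
  ultimately have "real n * P a' \<le> 2 * real c"
    using mult_right_mono[of "real n" "2 * real (n - 1)" "P a'"] by linarith
  then show ?thesis using aa unfolding P_def by (simp add: field_simps)
qed

section \<open>A second moment\<close>

lemma mean_flip:
  assumes "i < n"
  shows "avg n (\<lambda>x. \<phi> (x(i := \<not> x i))) = avg n \<phi>"
  by (rule mean_reindex, rule bij_betwI[where g = "\<lambda>x. x(i := \<not> x i)"])
     (use assms in \<open>auto simp: cube_def fun_eq_iff\<close>)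

text \<open>Centred bits have variance 1/4 and are orthogonal: flipping bit \<open>i\<close> negates
  its product with another one.\<close>

lemma mean_rademacher_square:
  "avg n (\<lambda>u. (\<Sum>i<n. a i * (of_bool (u i) - 1/2))\<^sup>2) = (\<Sum>i<n. (a i)\<^sup>2) / 4"
proof -
  define e where "e = (\<lambda>i (u :: nat \<Rightarrow> bool). of_bool (u i) - (1/2 :: real))"
  have orth: "avg n (\<lambda>u. e i u * e j u) = (if i = j then 1/4 else 0)" if "i < n" "j < n" for i j
  proof (cases "i = j")
    case True
    have "avg n (\<lambda>u. e i u * e j u) = avg n (\<lambda>u. 1/4)"
      using True by (intro mean_cong) (auto simp: e_def)
    then show ?thesis using True by (simp add: mean_const)
  next
    case False
    have "avg n (\<lambda>u. e i u * e j u) = avg n (\<lambda>u. e i (u(i := \<not> u i)) * e j (u(i := \<not> u i)))"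
      using mean_flip[OF that(1), of "\<lambda>u. e i u * e j u"] by simp
    also have "... = avg n (\<lambda>u. (-1) * (e i u * e j u))"
      using False by (intro mean_cong) (auto simp: e_def)
    finally show ?thesis using False by (simp only: mean_cmult) simp
  qed
  have "avg n (\<lambda>u. (\<Sum>i<n. a i * e i u)\<^sup>2)
      = avg n (\<lambda>u. \<Sum>i<n. \<Sum>j<n. (a i * a j) * (e i u * e j u))"
    by (intro mean_cong) (simp add: power2_eq_square sum_product algebra_simps)
  also have "... = (\<Sum>i<n. \<Sum>j<n. (a i * a j) * avg n (\<lambda>u. e i u * e j u))"
    by (simp add: mean_sum mean_cmult)
  also have "... = (\<Sum>i<n. \<Sum>j<n. if i = j then (a i)\<^sup>2 / 4 else 0)"
    by (intro sum.cong) (auto simp: orth power2_eq_square)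
  also have "... = (\<Sum>i<n. (a i)\<^sup>2) / 4"
    by (simp add: sum_divide_distrib)
  finally show ?thesis unfolding e_def .
qed

section \<open>Commuting swaps\<close>

text \<open>For an involution \<open>\<theta>\<close> this applies just those of its 2-cycles that
  meet \<open>A\<close>.\<close>

definition swp :: "(nat \<Rightarrow> nat) \<Rightarrow> nat set \<Rightarrow> nat \<Rightarrow> nat" where
  "swp \<theta> A = (\<lambda>i. if i \<in> A \<or> \<theta> i \<in> A then \<theta> i else i)"

text \<open>No 2-cycle lies inside \<open>V\<close>, so distinct subsets of \<open>V\<close> select
  distinct sets of transpositions.\<close>

definition pairing :: "nat \<Rightarrow> nat set \<Rightarrow> (nat \<Rightarrow> nat) \<Rightarrow> bool" where
  "pairing n V \<theta> \<longleftrightarrow> V \<subseteq> {..<n} \<and> \<theta> permutes {..<n} \<and> (\<forall>i. \<theta> (\<theta> i) = i) \<and> (\<forall>i\<in>V. \<theta> i \<notin> V)"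

lemma pairing_exists:
  assumes "A \<subseteq> {..<n}" "B \<subseteq> {..<n}" "A \<inter> B = {}" "card A \<le> card B"
  shows "\<exists>\<theta>. pairing n A \<theta> \<and> \<theta> ` A \<subseteq> B"
proof -
  have fin: "finite A" "finite B" using assms finite_subset by blast+
  obtain Q where Q: "inj_on Q A" "Q ` A \<subseteq> B"
    using inj_on_iff_card_le[OF fin] assms(4) by blast
  define \<theta> where "\<theta> = (\<lambda>i. if i \<in> A then Q i else if i \<in> Q ` A then inv_into A Q i else i)"
  have inv: "\<theta> (\<theta> i) = i" for i
    using Q assms(3) inv_into_into[of i Q A] by (auto simp: \<theta>_def f_inv_into_f)
  have "\<theta> permutes {..<n}"
  proof (rule bij_imp_permutes)
    have in_n: "\<theta> i \<in> {..<n}" if "i \<in> {..<n}" for i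
      using that Q assms inv_into_into[of i Q A] unfolding \<theta>_def by auto
    show "bij_betw \<theta> {..<n} {..<n}"
      by (rule bij_betwI[where g = \<theta>]) (use in_n inv in auto)
    show "\<theta> i = i" if "i \<notin> {..<n}" for i
      using that Q assms by (auto simp: \<theta>_def)
  qed
  moreover have "\<theta> ` A \<subseteq> B" using Q by (auto simp: \<theta>_def)
  ultimately show ?thesis
    using inv assms unfolding pairing_def by (intro exI[of _ \<theta>]) blast
qed

lemma swp_swp: "(\<And>i. \<theta> (\<theta> i) = i) \<Longrightarrow> swp \<theta> A (swp \<theta> A i) = i"
  by (auto simp: swp_def)

lemma swp_permutes:
  assumes \<theta>: "\<theta> permutes S" "\<And>i. \<theta> (\<theta> i) = i"
  shows "swp \<theta> A permutes S"
proof (rule bij_imp_permutes)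
  show "bij_betw (swp \<theta> A) S S"
    by (rule bij_betwI[where g = "swp \<theta> A"])
       (auto simp: \<theta>(2) swp_def permutes_in_image[OF \<theta>(1)])
  show "swp \<theta> A i = i" if "i \<notin> S" for i
    using permutes_not_in[OF \<theta>(1) that] by (simp add: swp_def)
qed

lemma inv_swp: "(\<And>i. \<theta> (\<theta> i) = i) \<Longrightarrow> inv (swp \<theta> A) = swp \<theta> A"
  by (rule inv_unique_comp) (auto simp: fun_eq_iff swp_swp)

lemma perm_vec_swp: "(\<And>i. \<theta> (\<theta> i) = i) \<Longrightarrow> perm_vec (swp \<theta> A) x i = x (swp \<theta> A i)"
  by (simp add: perm_vec_def inv_swp)

text \<open>Equal transpositions cancel and different ones are disjoint. Hence the swaps form a copy
  of the group of subsets of \<open>V\<close> under symmetric difference.\<close>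

lemma swp_comp:
  assumes "pairing n V \<theta>" "A \<subseteq> V" "B \<subseteq> V"
  shows "swp \<theta> A \<circ> swp \<theta> B = swp \<theta> (sym_diff A B)"
proof
  fix i
  have inv: "\<theta> (\<theta> i) = i" and d: "i \<in> V \<Longrightarrow> \<theta> i \<notin> V" "\<theta> i \<in> V \<Longrightarrow> i \<notin> V"
    using assms(1) unfolding pairing_def by metis+
  show "(swp \<theta> A \<circ> swp \<theta> B) i = swp \<theta> (sym_diff A B) i"
    using inv d assms(2,3) by (auto simp: swp_def)
qed

abbreviation swap_dist :: "nat \<Rightarrow> ((nat \<Rightarrow> bool) \<Rightarrow> bool) \<Rightarrow> (nat \<Rightarrow> nat) \<Rightarrow> nat set \<Rightarrow> real" where
  "swap_dist n G \<theta> A \<equiv> avg n (\<lambda>x. of_bool (G x \<noteq> G (perm_vec (swp \<theta> A) x)))"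

section \<open>Fourier weights of the swap group\<close>

text \<open>For \<open>S\<close> and \<open>A\<close> inside \<open>V\<close> this is (-1)^|S
  \<inter> A|, a character of the group of subsets of \<open>V\<close>. The product form makes
  symmetry and multiplicativity evident.\<close>

definition chr :: "nat set \<Rightarrow> nat set \<Rightarrow> nat set \<Rightarrow> real" where
  "chr V S A = (\<Prod>i\<in>V. if i \<in> S \<and> i \<in> A then -1 else 1)"

lemma chr_commute: "chr V S A = chr V A S"
  unfolding chr_def by (intro prod.cong) auto

lemma chr_mult: "chr V S A * chr V S B = chr V S (sym_diff A B)"
  unfolding chr_def prod.distrib[symmetric] by (intro prod.cong) auto

lemma abs_chr: "\<bar>chr V S A\<bar> = 1"
  unfolding chr_def abs_prod by (intro prod.neutral) auto

lemma chr_empty [simp]: "chr V S {} = 1"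
  unfolding chr_def by simp

lemma chr_disjoint: "S \<inter> A = {} \<Longrightarrow> chr V S A = 1"
  unfolding chr_def by (intro prod.neutral) auto

text \<open>The sum factors over \<open>B\<close> into terms 1 + 1 and 1 - 1, and vanishes as soon
  as \<open>S\<close> meets \<open>B\<close>.\<close>

lemma sum_chr:
  assumes "finite V" "B \<subseteq> V"
  shows "(\<Sum>A\<in>Pow B. chr V S A) = (if S \<inter> B = {} then 2 ^ card B else 0)"
proof -
  have fB: "finite B" using assms finite_subset by auto
  have "(\<Sum>A\<in>Pow B. chr V S A) = (\<Sum>A\<in>Pow B. (\<Prod>i\<in>A. if i \<in> S then -1 else 1) * (\<Prod>i\<in>B - A. 1))"
  proof (intro sum.cong refl)
    fix A assume "A \<in> Pow B"
    then have "chr V S A = (\<Prod>i\<in>A. if i \<in> S \<and> i \<in> A then -1 else 1)"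
      unfolding chr_def using assms by (intro prod.mono_neutral_right) auto
    also have "... = (\<Prod>i\<in>A. if i \<in> S then -1 else 1)" by (intro prod.cong) auto
    finally show "chr V S A = (\<Prod>i\<in>A. if i \<in> S then -1 else 1) * (\<Prod>i\<in>B - A. 1)" by simp
  qed
  also have "... = (\<Prod>i\<in>B. (if i \<in> S then -1 else 1) + 1)"
    by (rule prod_add[OF fB, symmetric])
  also have "... = (if S \<inter> B = {} then 2 ^ card B else 0)"
  proof (cases "S \<inter> B = {}")
    case True
    then have "(\<Prod>i\<in>B. (if i \<in> S then -1 else 1) + 1) = (\<Prod>i\<in>B. 2 :: real)" by (intro prod.cong) auto
    then show ?thesis using True by simp
  next
    case False
    then show ?thesis using fB by (auto simp: prod_zero_iff)
  qed
  finally show ?thesis .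
qed

lemma sum_Pow_sym_diff:
  assumes "A \<subseteq> V"
  shows "(\<Sum>B\<in>Pow V. f (sym_diff A B)) = (\<Sum>B\<in>Pow V. f B)"
  by (rule sum.reindex_bij_witness[of _ "\<lambda>B. sym_diff A B" "\<lambda>B. sym_diff A B"])
     (use assms in \<open>auto intro: arg_cong[of _ _ f]\<close>)

text \<open>The measure is the Fourier transform of the autocorrelation \<open>C\<close> of the sign
  of \<open>G\<close> under the swap group. It is nonnegative because \<open>C\<close> is positive
  definite, and has mass \<open>C {} = 1\<close>. The last two clauses translate between small swap
  distances and the sets that carry the mass.\<close>

lemma swap_measure:
  fixes G :: "(nat \<Rightarrow> bool) \<Rightarrow> bool"
  defines "D \<equiv> \<lambda>\<theta> n A. swap_dist n G \<theta> A"
  assumes \<theta>: "pairing n V \<theta>"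
  shows "\<exists>\<mu>. (\<forall>S. 0 \<le> \<mu> S) \<and> (\<Sum>S\<in>Pow V. \<mu> S) = 1 \<and>
    (\<forall>B\<subseteq>V. \<forall>d. (\<forall>A\<subseteq>B. D \<theta> n A \<le> d) \<longrightarrow> 1 - 2 * d \<le> (\<Sum>S\<in>{S\<in>Pow V. S \<inter> B = {}}. \<mu> S)) \<and>
    (\<forall>A\<subseteq>V. D \<theta> n A \<le> (\<Sum>S\<in>{S\<in>Pow V. S \<inter> A \<noteq> {}}. \<mu> S))"
proof -
  have finV: "finite V" and inv: "\<And>i. \<theta> (\<theta> i) = i" and perm: "\<theta> permutes {..<n}"
    using \<theta> finite_subset[of V "{..<n}"] unfolding pairing_def by auto
  define act where "act = (\<lambda>A. perm_vec (swp \<theta> A))"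
  define \<gamma> :: "(nat \<Rightarrow> bool) \<Rightarrow> real" where "\<gamma> = (\<lambda>x. if G x then 1 else -1)"
  define C where "C = (\<lambda>A. avg n (\<lambda>x. \<gamma> x * \<gamma> (act A x)))"
  define \<mu> where "\<mu> = (\<lambda>S. (\<Sum>A\<in>Pow V. chr V S A * C A) / 2 ^ card V)"
  have swpp: "swp \<theta> A permutes {..<n}" for A by (rule swp_permutes[OF perm inv])
  have C_D: "C A = 1 - 2 * D \<theta> n A" for A
  proof -
    have "C A = avg n (\<lambda>x. 1 - 2 * of_bool (G x \<noteq> G (act A x)))"
      unfolding C_def by (intro mean_cong) (auto simp: \<gamma>_def)
    then show ?thesis by (simp add: mean_diff mean_cmult mean_const D_def act_def)
  qed
  have act2: "avg n (\<lambda>x. \<gamma> (act A x) * \<gamma> (act B x)) = C (sym_diff A B)"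
    if "A \<subseteq> V" "B \<subseteq> V" for A B
  proof -
    have "C (sym_diff A B) = avg n (\<lambda>x. \<gamma> x * \<gamma> (act (sym_diff B A) x))"
      unfolding C_def by (simp add: Un_commute)
    also have "... = avg n (\<lambda>x. \<gamma> (act A x) * \<gamma> (act (sym_diff B A) (act A x)))"
      unfolding act_def by (rule mean_cube_perm[OF swpp, symmetric])
    also have "... = avg n (\<lambda>x. \<gamma> (act A x) * \<gamma> (act B x))"
    proof (intro mean_cong)
      fix x
      have "act (sym_diff B A) (act A x) = perm_vec (swp \<theta> (sym_diff B A) \<circ> swp \<theta> A) x"
        unfolding act_def by (intro perm_vec_comp permutes_bij[OF swpp])
      also have "swp \<theta> (sym_diff B A) \<circ> swp \<theta> A = swp \<theta> (sym_diff (sym_diff B A) A)"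
        using that by (intro swp_comp[OF \<theta>]) auto
      also have "sym_diff (sym_diff B A) A = B" by auto
      finally show "\<gamma> (act A x) * \<gamma> (act (sym_diff B A) (act A x)) = \<gamma> (act A x) * \<gamma> (act B x)"
        by (simp add: act_def)
    qed
    finally show ?thesis by simp
  qed
  have nonneg: "0 \<le> \<mu> S" for S
  proof -
    \<comment> \<open>Expanding the square gives \<open>C\<close> of symmetric differences. Each
      \<open>E\<close> then arises once for every \<open>A\<close>, so the average is a positive
      multiple of \<open>\<mu> S\<close>.\<close>
    have "(0::real) \<le> avg n (\<lambda>x. (\<Sum>A\<in>Pow V. chr V S A * \<gamma> (act A x))\<^sup>2)"
      by (intro mean_nonneg) auto
    also have "... = avg n (\<lambda>x. \<Sum>A\<in>Pow V. \<Sum>B\<in>Pow V.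
        (chr V S A * chr V S B) * (\<gamma> (act A x) * \<gamma> (act B x)))"
      by (intro mean_cong) (simp add: power2_eq_square sum_product algebra_simps)
    also have "... = (\<Sum>A\<in>Pow V. \<Sum>B\<in>Pow V. (chr V S A * chr V S B) *
        avg n (\<lambda>x. \<gamma> (act A x) * \<gamma> (act B x)))"
      by (simp only: mean_sum mean_cmult)
    also have "... = (\<Sum>A\<in>Pow V. \<Sum>B\<in>Pow V. chr V S (sym_diff A B) * C (sym_diff A B))"
      by (intro sum.cong) (auto simp: act2 chr_mult)
    also have "... = (\<Sum>A\<in>Pow V. \<Sum>E\<in>Pow V. chr V S E * C E)"
      by (intro sum.cong refl sum_Pow_sym_diff) auto
    also have "... = 2 ^ card V * (\<Sum>E\<in>Pow V. chr V S E * C E)"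
      using finV by (simp add: card_Pow)
    finally have "2 ^ card V * 0 \<le> 2 ^ card V * (\<Sum>E\<in>Pow V. chr V S E * C E)" by simp
    then have "0 \<le> (\<Sum>E\<in>Pow V. chr V S E * C E)"
      by (rule mult_left_le_imp_le) simp
    then show ?thesis unfolding \<mu>_def by simp
  qed
  have inversion: "(\<Sum>S\<in>Pow V. \<mu> S * chr V S A) = C A" if A: "A \<subseteq> V" for A
  proof -
    have "(\<Sum>S\<in>Pow V. \<mu> S * chr V S A) = (\<Sum>S\<in>Pow V. \<Sum>B\<in>Pow V. chr V S (sym_diff A B) * C B / 2 ^ card V)"
      unfolding \<mu>_def by (intro sum.cong refl) (simp add: sum_divide_distrib sum_distrib_right sum_distrib_left chr_mult[symmetric] algebra_simps)
    also have "... = (\<Sum>B\<in>Pow V. (\<Sum>S\<in>Pow V. chr V S (sym_diff A B)) * (C B / 2 ^ card V))"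
      by (subst sum.swap) (simp add: sum_distrib_right sum_divide_distrib)
    also have "... = (\<Sum>B\<in>Pow V. if B = A then C B else 0)"
    proof (intro sum.cong refl)
      fix B assume B: "B \<in> Pow V"
      have "(\<Sum>S\<in>Pow V. chr V S (sym_diff A B)) = (\<Sum>S\<in>Pow V. chr V (sym_diff A B) S)"
        by (intro sum.cong refl chr_commute)
      also have "... = (if sym_diff A B \<inter> V = {} then 2 ^ card V else 0)"
        by (rule sum_chr[OF finV order_refl])
      also have "sym_diff A B \<inter> V = {} \<longleftrightarrow> B = A" using A B by auto
      finally show "(\<Sum>S\<in>Pow V. chr V S (sym_diff A B)) * (C B / 2 ^ card V) = (if B = A then C B else 0)"
        by simp
    qed
    also have "... = C A" using A finV by simp
    finally show ?thesis .
  qed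
  have C_empty: "C {} = 1"
  proof -
    have "act {} x = x" for x by (simp add: act_def swp_def perm_vec_id[unfolded id_def])
    then have "C {} = avg n (\<lambda>x. 1)" unfolding C_def by (intro mean_cong) (auto simp: \<gamma>_def)
    then show ?thesis by (simp add: mean_const)
  qed
  have total: "(\<Sum>S\<in>Pow V. \<mu> S) = 1"
    using inversion[of "{}"] C_empty by simp
  show ?thesis
  proof (intro exI[of _ \<mu>] conjI allI impI nonneg total)
    fix B d assume B: "B \<subseteq> V" and d: "\<forall>A\<subseteq>B. D \<theta> n A \<le> d"
    have finB: "finite B" using B finV finite_subset by auto
    \<comment> \<open>Averaging the inversion formula over the subsets of \<open>B\<close> leaves
      exactly the mass of the sets disjoint from \<open>B\<close>.\<close>
    have "(\<Sum>A\<in>Pow B. 1 - 2 * d) \<le> (\<Sum>A\<in>Pow B. C A)"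
      using d by (intro sum_mono) (auto simp: C_D)
    also have "... = (\<Sum>A\<in>Pow B. \<Sum>S\<in>Pow V. \<mu> S * chr V S A)"
      using B by (intro sum.cong refl inversion[symmetric]) auto
    also have "... = (\<Sum>S\<in>Pow V. \<mu> S * (\<Sum>A\<in>Pow B. chr V S A))"
      by (subst sum.swap) (simp add: sum_distrib_left)
    also have "... = (\<Sum>S\<in>Pow V. if S \<inter> B = {} then 2 ^ card B * \<mu> S else 0)"
      using sum_chr[OF finV B] by (intro sum.cong) auto
    also have "... = (\<Sum>S\<in>{S\<in>Pow V. S \<inter> B = {}}. 2 ^ card B * \<mu> S)"
      by (rule sum.inter_filter[symmetric]) (use finV in auto)
    finally have "2 ^ card B * (1 - 2 * d) \<le> 2 ^ card B * (\<Sum>S\<in>{S\<in>Pow V. S \<inter> B = {}}. \<mu> S)"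
      using finB by (simp add: card_Pow sum_distrib_left)
    then show "1 - 2 * d \<le> (\<Sum>S\<in>{S\<in>Pow V. S \<inter> B = {}}. \<mu> S)"
      by simp
  next
    fix A assume A: "A \<subseteq> V"
    have "1 - 2 * D \<theta> n A = (\<Sum>S\<in>Pow V. \<mu> S * chr V S A)"
      using inversion[OF A] C_D by simp
    \<comment> \<open>A set disjoint from \<open>A\<close> has character 1; any other one costs at
      most \<open>2 * \<mu> S\<close>.\<close>
    also have "... \<ge> (\<Sum>S\<in>Pow V. \<mu> S - 2 * (if S \<inter> A \<noteq> {} then \<mu> S else 0))"
    proof (intro sum_mono)
      fix S
      have "- \<mu> S \<le> \<mu> S * chr V S A"
        using abs_chr[of V S A] nonneg[of S] by (simp add: abs_if split: if_splits)
      then show "\<mu> S - 2 * (if S \<inter> A \<noteq> {} then \<mu> S else 0) \<le> \<mu> S * chr V S A"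
        by (auto simp: chr_disjoint)
    qed
    also have "(\<Sum>S\<in>Pow V. \<mu> S - 2 * (if S \<inter> A \<noteq> {} then \<mu> S else 0))
        = 1 - 2 * (\<Sum>S\<in>{S\<in>Pow V. S \<inter> A \<noteq> {}}. \<mu> S)"
    proof -
      have "(\<Sum>S\<in>Pow V. if S \<inter> A \<noteq> {} then \<mu> S else 0) = (\<Sum>S\<in>{S\<in>Pow V. S \<inter> A \<noteq> {}}. \<mu> S)"
        by (rule sum.inter_filter[symmetric]) (use finV in auto)
      then show ?thesis by (simp only: sum_subtractf total sum_distrib_left[symmetric])
    qed
    finally show "D \<theta> n A \<le> (\<Sum>S\<in>{S\<in>Pow V. S \<inter> A \<noteq> {}}. \<mu> S)" by simp
  qed
qed

section \<open>Small sets carrying most of a measure\<close>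

primrec union_exp :: "'a set \<Rightarrow> ('a set \<Rightarrow> real) \<Rightarrow> nat \<Rightarrow> ('a set \<Rightarrow> real) \<Rightarrow> 'a set \<Rightarrow> real" where
  "union_exp V \<mu> 0 \<phi> U = \<phi> U"
| "union_exp V \<mu> (Suc r) \<phi> U = (\<Sum>S\<in>Pow V. \<mu> S * union_exp V \<mu> r \<phi> (U \<union> S))"

text \<open>\<open>union_exp V \<mu> r \<phi> U\<close> is the expectation of \<open>\<phi> (U \<union> S\<^sub>1 \<union> ... \<union> S\<^sub>r)\<close> for independent \<open>\<mu>\<close>-random sets.\<close>

lemma union_exp_mono:
  assumes "\<And>S. 0 \<le> \<mu> S" "\<And>U. U \<subseteq> V \<Longrightarrow> \<phi> U \<le> \<psi> U" "U \<subseteq> V"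
  shows "union_exp V \<mu> r \<phi> U \<le> union_exp V \<mu> r \<psi> U"
  using assms(3) by (induction r arbitrary: U) (auto intro!: assms sum_mono mult_left_mono)

lemma union_exp_add:
  "union_exp V \<mu> r (\<lambda>U. \<phi> U + \<psi> U) U = union_exp V \<mu> r \<phi> U + union_exp V \<mu> r \<psi> U"
  by (induction r arbitrary: U) (auto simp: sum.distrib distrib_left)

lemma union_exp_cmult: "union_exp V \<mu> r (\<lambda>U. c * \<phi> U) U = c * union_exp V \<mu> r \<phi> U"
  by (induction r arbitrary: U) (auto simp: sum_distrib_left algebra_simps)

lemma union_exp_const: "sum \<mu> (Pow V) = 1 \<Longrightarrow> union_exp V \<mu> r (\<lambda>_. c) U = c"
  by (induction r arbitrary: U) (auto simp: sum_distrib_right[symmetric])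

lemma union_exp_mean:
  "union_exp V \<mu> r (\<lambda>U. mean P (\<lambda>\<rho>. \<phi> \<rho> U)) U = mean P (\<lambda>\<rho>. union_exp V \<mu> r (\<phi> \<rho>) U)"
proof (induction r arbitrary: U)
  case (Suc r)
  show ?case by (simp add: Suc mean_cmult[symmetric] mean_sum)
qed simp

text \<open>A union lies in \<open>X\<close> iff all its members do, and the random sets are
  independent.\<close>

lemma union_exp_subset:
  assumes "finite V"
  shows "union_exp V \<mu> r (\<lambda>U. of_bool (U \<subseteq> X)) U = of_bool (U \<subseteq> X) * (\<Sum>S\<in>{S\<in>Pow V. S \<subseteq> X}. \<mu> S) ^ r"
proof (induction r arbitrary: U)
  case (Suc r)
  have "(\<Sum>S\<in>Pow V. \<mu> S * (of_bool (U \<union> S \<subseteq> X) * c)) = of_bool (U \<subseteq> X) * ((\<Sum>S\<in>{S\<in>Pow V. S \<subseteq> X}. \<mu> S) * c)" for c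
  proof -
    have "(\<Sum>S\<in>Pow V. \<mu> S * (of_bool (U \<union> S \<subseteq> X) * c)) = (\<Sum>S\<in>Pow V. if S \<subseteq> X then \<mu> S * (of_bool (U \<subseteq> X) * c) else 0)"
      by (intro sum.cong) auto
    then show ?thesis
      using assms by (simp add: sum.inter_filter[symmetric] sum_distrib_right[symmetric])
  qed
  then show ?case by (simp add: Suc)
qed simp

text \<open>The potential (1/2)^|U|, cut off at size \<open>D\<close>, at least halves whenever the
  next random set is not inside \<open>U\<close>. As this has probability at least
  \<open>\<Delta>\<close>, each round multiplies the expected potential by at most 1 -
  \<Delta>/2.\<close>

lemma union_exp_growth:
  fixes \<mu> :: "'a set \<Rightarrow> real"
  assumes V: "finite V" and \<mu>: "\<And>S. 0 \<le> \<mu> S" "sum \<mu> (Pow V) = 1" and \<Delta>: "\<Delta> \<le> 1"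
    and far: "\<And>U. U \<subseteq> V \<Longrightarrow> card U < D \<Longrightarrow> \<Delta> \<le> (\<Sum>S\<in>{S\<in>Pow V. \<not> S \<subseteq> U}. \<mu> S)"
    and U: "U \<subseteq> V"
  shows "union_exp V \<mu> r (\<lambda>U. (1/2) ^ card U * of_bool (card U < D)) U
       \<le> (1 - \<Delta>/2) ^ r * ((1/2) ^ card U * of_bool (card U < D))"
  using U
proof (induction r arbitrary: U)
  case (Suc r)
  let ?\<psi> = "\<lambda>U. (1/2 :: real) ^ card U * of_bool (card U < D)"
  have "union_exp V \<mu> (Suc r) ?\<psi> U \<le> (\<Sum>S\<in>Pow V. \<mu> S * ((1 - \<Delta>/2) ^ r * ?\<psi> (U \<union> S)))"
    unfolding union_exp.simps using Suc by (intro sum_mono mult_left_mono \<mu>) auto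
  also have "... = (1 - \<Delta>/2) ^ r * (\<Sum>S\<in>Pow V. \<mu> S * ?\<psi> (U \<union> S))"
    by (simp add: sum_distrib_left algebra_simps)
  also have "(\<Sum>S\<in>Pow V. \<mu> S * ?\<psi> (U \<union> S)) \<le> (1 - \<Delta>/2) * ?\<psi> U"
  proof (cases "card U < D")
    case True
    have "(\<Sum>S\<in>Pow V. \<mu> S * ?\<psi> (U \<union> S)) \<le> (\<Sum>S\<in>Pow V. \<mu> S * ?\<psi> U - (if \<not> S \<subseteq> U then \<mu> S else 0) * (?\<psi> U / 2))"
    proof (intro sum_mono)
      fix S assume S: "S \<in> Pow V"
      show "\<mu> S * ?\<psi> (U \<union> S) \<le> \<mu> S * ?\<psi> U - (if \<not> S \<subseteq> U then \<mu> S else 0) * (?\<psi> U / 2)"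
      proof (cases "S \<subseteq> U")
        case True
        then have "U \<union> S = U" by blast
        then show ?thesis using True by simp
      next
        case False
        have "finite (U \<union> S)" using S Suc.prems V finite_subset[of "U \<union> S" V] by auto
        then have "card U < card (U \<union> S)" using False by (intro psubset_card_mono) auto
        then have "(1/2::real) ^ card (U \<union> S) \<le> (1/2) ^ Suc (card U)" by (intro power_decreasing) auto
        then have "?\<psi> (U \<union> S) \<le> ?\<psi> U / 2" using True by auto
        then have "\<mu> S * ?\<psi> (U \<union> S) \<le> \<mu> S * (?\<psi> U / 2)" by (intro mult_left_mono \<mu>)
        then show ?thesis using False by (simp add: algebra_simps)
      qed
    qed
    also have "... = ?\<psi> U - (\<Sum>S\<in>{S\<in>Pow V. \<not> S \<subseteq> U}. \<mu> S) * (?\<psi> U / 2)"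
    proof -
      have "(\<Sum>S\<in>Pow V. if \<not> S \<subseteq> U then \<mu> S else 0) = (\<Sum>S\<in>{S\<in>Pow V. \<not> S \<subseteq> U}. \<mu> S)"
        by (rule sum.inter_filter[symmetric]) (use V in auto)
      then show ?thesis by (simp only: sum_subtractf sum_distrib_right[symmetric] \<mu>(2))
    qed
    also have "... \<le> ?\<psi> U - \<Delta> * (?\<psi> U / 2)"
      using far[OF Suc.prems True] by (intro diff_left_mono mult_right_mono) auto
    finally show ?thesis by (simp add: algebra_simps)
  next
    case False
    have "\<not> card (U \<union> S) < D" if "S \<in> Pow V" for S
      using that False Suc.prems V finite_subset[of "U \<union> S" V] card_mono[of "U \<union> S" U] by auto
    then show ?thesis using False by (auto intro!: sum_nonpos)
  qed
  then have "(1 - \<Delta>/2) ^ r * (\<Sum>S\<in>Pow V. \<mu> S * ?\<psi> (U \<union> S)) \<le> (1 - \<Delta>/2) ^ r * ((1 - \<Delta>/2) * ?\<psi> U)"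
    using \<Delta> by (intro mult_left_mono) auto
  finally show ?case by (simp add: algebra_simps)
qed simp

text \<open>The value 600 is what \<open>small_core\<close> needs for 4/600 \<le> 1/100.\<close>

lemma exp_7_ge: "600 \<le> exp (7::real)"
proof -
  have "(5/2) ^ 7 \<le> exp (1::real) ^ 7"
    using exp_lower_Taylor_quadratic[of 1] by (intro power_mono) auto
  also have "exp (1::real) ^ 7 = exp 7" by (simp add: exp_of_nat_mult[symmetric])
  finally show ?thesis by (simp add: power_numeral_reduce)
qed

text \<open>Two estimates of the probability that \<open>\<rho>\<close> is good and the union of
  \<open>r * k\<close> independent \<open>\<mu>\<close>-random sets lies in \<open>W \<rho>\<close>.
  Each good \<open>\<rho>\<close> contains the union with probability at least (1/2)^k; if no
  suitable \<open>U\<close> existed, the total would be at most 2 (1/100)^k.\<close>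

lemma small_core:
  fixes \<mu> :: "'a set \<Rightarrow> real" and W :: "'b \<Rightarrow> 'a set"
  assumes V: "finite V" and \<mu>: "\<And>S. 0 \<le> \<mu> S" "sum \<mu> (Pow V) = 1"
    and P: "finite P" "3/10 \<le> mean P (\<lambda>\<rho>. of_bool (good \<rho>))"
    and good: "\<And>\<rho>. \<rho> \<in> P \<Longrightarrow> good \<rho> \<Longrightarrow> 1 - 8 * \<delta> \<le> (\<Sum>S\<in>{S\<in>Pow V. S \<subseteq> W \<rho>}. \<mu> S)"
    and rare: "\<And>U. U \<subseteq> V \<Longrightarrow> 2 * k \<le> card U \<Longrightarrow> mean P (\<lambda>\<rho>. of_bool (good \<rho> \<and> U \<subseteq> W \<rho>)) \<le> (1/100) ^ k"
    and k: "1 \<le> k" and \<delta>: "0 < \<delta>" "400 * \<delta> \<le> 1"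
  shows "\<exists>U\<subseteq>V. card U < 2 * k \<and> (\<Sum>S\<in>{S\<in>Pow V. \<not> S \<subseteq> U}. \<mu> S) \<le> 400 * \<delta>"
proof (rule ccontr)
  assume "\<not> ?thesis"
  then have far: "400 * \<delta> \<le> (\<Sum>S\<in>{S\<in>Pow V. \<not> S \<subseteq> U}. \<mu> S)" if "U \<subseteq> V" "card U < 2 * k" for U
    using that by force
  \<comment> \<open>This \<open>r\<close> keeps \<open>8 * \<delta> * r\<close> at most 1/2, while
    \<open>200 * \<delta> * r\<close> is at least 7.\<close>
  define r where "r = nat \<lceil>14 / (400 * \<delta>)\<rceil>"
  have r: "14 / (400 * \<delta>) \<le> real r" "real r \<le> 14 / (400 * \<delta>) + 1"
    unfolding r_def using \<delta> by (auto simp: real_nat_ceiling_ge intro: of_nat_ceiling order_trans[OF _ less_imp_le[OF ceiling_correct[THEN conjunct1]]])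
  let ?\<phi> = "\<lambda>U. mean P (\<lambda>\<rho>. of_bool (good \<rho>) * of_bool (U \<subseteq> W \<rho>))"
  let ?\<psi> = "\<lambda>U :: 'a set. (1/2 :: real) ^ card U * of_bool (card U < 2 * k)"
  have lower: "3/10 * (1/2) ^ k \<le> union_exp V \<mu> (r * k) ?\<phi> {}"
  proof -
    have "1/2 \<le> 1 + real r * (- (8 * \<delta>))"
    proof -
      have "real r * (8 * \<delta>) \<le> (14 / (400 * \<delta>) + 1) * (8 * \<delta>)" using r \<delta> by (intro mult_right_mono) auto
      also have "... = 28/100 + 8 * \<delta>" using \<delta> by (simp add: field_simps)
      finally show ?thesis using \<delta> by simp
    qed
    also have "... \<le> (1 + (- (8 * \<delta>))) ^ r" using \<delta> by (intro Bernoulli_inequality) auto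
    finally have half: "(1/2) ^ k \<le> (1 - 8 * \<delta>) ^ (r * k)"
      using power_mono[of "1/2 :: real" "(1 - 8 * \<delta>) ^ r" k] by (simp add: power_mult)
    have "3/10 * (1/2) ^ k \<le> mean P (\<lambda>\<rho>. of_bool (good \<rho>)) * (1/2) ^ k"
      using P by (intro mult_right_mono) auto
    also have "... = mean P (\<lambda>\<rho>. (1/2) ^ k * of_bool (good \<rho>))" by (simp add: mean_cmult)
    also have "... \<le> mean P (\<lambda>\<rho>. of_bool (good \<rho>) * (\<Sum>S\<in>{S\<in>Pow V. S \<subseteq> W \<rho>}. \<mu> S) ^ (r * k))"
    proof (intro mean_mono)
      fix \<rho> assume \<rho>: "\<rho> \<in> P"
      show "(1/2) ^ k * of_bool (good \<rho>) \<le> of_bool (good \<rho>) * (\<Sum>S\<in>{S\<in>Pow V. S \<subseteq> W \<rho>}. \<mu> S) ^ (r * k)"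
        using half good[OF \<rho>] power_mono[of "1 - 8 * \<delta>" "\<Sum>S\<in>{S\<in>Pow V. S \<subseteq> W \<rho>}. \<mu> S" "r * k"] \<delta>
        by auto
    qed
    also have "... = union_exp V \<mu> (r * k) ?\<phi> {}"
      by (simp add: union_exp_mean union_exp_cmult union_exp_subset[OF V])
    finally show ?thesis .
  qed
  \<comment> \<open>Unions of size at least \<open>2 * k\<close> fall under \<open>rare\<close>; on
    smaller ones \<open>4 ^ k\<close> times the potential is at least 1.\<close>
  have "union_exp V \<mu> (r * k) ?\<phi> {} \<le> union_exp V \<mu> (r * k) (\<lambda>U. (1/100) ^ k + 4 ^ k * ?\<psi> U) {}"
  proof (rule union_exp_mono)
    fix U assume U: "U \<subseteq> V"
    have le1: "?\<phi> U \<le> 1"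
      using mean_of_bool_le_1[of P "\<lambda>\<rho>. good \<rho> \<and> U \<subseteq> W \<rho>"] by (simp only: of_bool_conj)
    show "?\<phi> U \<le> (1/100) ^ k + 4 ^ k * ?\<psi> U"
    proof (cases "card U < 2 * k")
      case True
      have "(1::real) = 4 ^ k * (1/2) ^ (2 * k)" by (simp add: power_mult power_mult_distrib[symmetric] power2_eq_square)
      also have "... \<le> 4 ^ k * (1/2) ^ card U"
        using True by (intro mult_left_mono power_decreasing) auto
      finally have "1 \<le> 4 ^ k * ?\<psi> U" using True by simp
      moreover have "0 \<le> (1/100 :: real) ^ k" by simp
      ultimately show ?thesis using le1 by linarith
    next
      case False
      then show ?thesis using rare[OF U] by (simp add: of_bool_conj)
    qed
  qed (auto simp: \<mu>)
  also have "... = (1/100) ^ k + 4 ^ k * union_exp V \<mu> (r * k) ?\<psi> {}"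
    by (simp only: union_exp_add union_exp_cmult union_exp_const[OF \<mu>(2)])
  also have "... \<le> (1/100) ^ k + 4 ^ k * ((1 - 400 * \<delta> / 2) ^ (r * k) * ?\<psi> {})"
    by (intro add_left_mono mult_left_mono union_exp_growth[OF V \<mu> \<delta>(2) far]) auto
  also have "... \<le> (1/100) ^ k + (1/100) ^ k"
  proof -
    have "(1 - 400 * \<delta> / 2) ^ r \<le> exp (- (400 * \<delta> / 2)) ^ r"
      using \<delta> exp_ge_add_one_self[of "- (400 * \<delta> / 2)"] by (intro power_mono) auto
    also have "... = exp (- (real r * (400 * \<delta> / 2)))" by (simp add: exp_of_nat_mult[symmetric])
    also have "... \<le> exp (- 7)"
    proof -
      have "14 / (400 * \<delta>) * (400 * \<delta> / 2) \<le> real r * (400 * \<delta> / 2)"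
        using r \<delta> by (intro mult_right_mono) auto
      then show ?thesis using \<delta> by simp
    qed
    also have "... \<le> 1 / 600" using exp_7_ge by (simp add: exp_minus field_simps)
    finally have "(1 - 400 * \<delta> / 2) ^ r \<le> 1 / 600" .
    then have "((1 - 400 * \<delta> / 2) ^ r) ^ k \<le> (1 / 600) ^ k"
      using \<delta> by (intro power_mono) auto
    then have "4 ^ k * ((1 - 400 * \<delta> / 2) ^ (r * k) * ?\<psi> {}) \<le> 4 ^ k * (1 / 600) ^ k"
      using k by (simp add: power_mult)
    also have "... = (4 / 600) ^ k" by (simp add: power_mult_distrib[symmetric])
    also have "... \<le> (1 / 100) ^ k" by (intro power_mono) auto
    finally show ?thesis by simp
  qed
  finally have "3/10 * (1/2) ^ k \<le> 2 * (1/100 :: real) ^ k" using lower by simp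
  moreover have "(1/2 :: real) ^ k = 50 ^ k * (1/100) ^ k" by (simp add: power_mult_distrib[symmetric])
  ultimately have "3/10 * 50 ^ k * (1/100 :: real) ^ k \<le> 2 * (1/100 :: real) ^ k" by simp
  then have "3/10 * 50 ^ k \<le> (2::real)" by simp
  moreover have "(50::real) ^ 1 \<le> 50 ^ k" using k by (intro power_increasing) auto
  ultimately show False by simp
qed

section \<open>Shifts of the binomial distribution\<close>

text \<open>Summation by parts moves the differences onto the binomial coefficients. These do not
  decrease before the middle, so only the second half can contribute positively, and there the
  differences telescope to the central coefficient.\<close>

lemma binomial_shift_one:
  fixes h :: "int \<Rightarrow> real"
  assumes h: "\<And>j. 0 \<le> h j" "\<And>j. h j \<le> 1"
  shows "(\<Sum>j\<le>N. real (N choose j) * (h (int j + 1) - h (int j))) \<le> real (N choose (N div 2))"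
proof -
  define c where "c = (\<lambda>j. real (N choose j))"
  define M where "M = N div 2"
  have "(\<Sum>j\<le>N. c j * h (int j)) = (\<Sum>j\<le>Suc N. c j * h (int j))"
    by (simp add: c_def)
  also have "... = c 0 * h 0 + (\<Sum>j\<le>N. c (Suc j) * h (int j + 1))"
    by (subst sum.atMost_Suc_shift) (simp add: add.commute)
  finally have "(\<Sum>j\<le>N. c j * (h (int j + 1) - h (int j)))
      = (\<Sum>j\<le>N. (c j - c (Suc j)) * h (int j + 1)) - c 0 * h 0"
    by (simp add: right_diff_distrib left_diff_distrib sum_subtractf)
  also have "... \<le> (\<Sum>j\<le>N. (c j - c (Suc j)) * h (int j + 1))"
    using h by (simp add: c_def)
  also have "... \<le> (\<Sum>j\<le>N. if M \<le> j then c j - c (Suc j) else 0)"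
  proof (intro sum_mono)
    fix j assume "j \<in> {..N}"
    show "(c j - c (Suc j)) * h (int j + 1) \<le> (if M \<le> j then c j - c (Suc j) else 0)"
    proof (cases "M \<le> j")
      case True
      then have "c (Suc j) \<le> c j"
        unfolding c_def M_def using binomial_antimono[of j "Suc j" N]
        by (cases "Suc j \<le> N") (auto simp: binomial_eq_0)
      then show ?thesis using True h mult_left_mono[of "h (int j + 1)" 1 "c j - c (Suc j)"] by simp
    next
      case False
      then have "c j \<le> c (Suc j)"
        unfolding c_def M_def using binomial_mono[of j "Suc j" N] by auto
      then show ?thesis using False h by (simp add: mult_nonpos_nonneg)
    qed
  qed
  also have "... = (\<Sum>j\<in>{j\<in>{..N}. M \<le> j}. c j - c (Suc j))"
    by (rule sum.inter_filter[symmetric]) simp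
  also have "{j\<in>{..N}. M \<le> j} = {M..N}" by auto
  also have "(\<Sum>j\<in>{M..N}. c j - c (Suc j)) = c M"
    using sum_natinterval_diff[of c M N] by (simp add: M_def c_def)
  finally show ?thesis by (simp add: c_def M_def)
qed

lemma binomial_shift_nat:
  fixes h :: "int \<Rightarrow> real"
  assumes h: "\<And>j. 0 \<le> h j" "\<And>j. h j \<le> 1"
  shows "\<bar>\<Sum>j\<le>N. real (N choose j) * (h (int j + int d) - h (int j))\<bar> \<le> real d * real (N choose (N div 2))"
proof (induction d)
  case (Suc d)
  let ?h = "\<lambda>j. h (j + int d)"
  let ?s = "\<Sum>j\<le>N. real (N choose j) * (?h (int j + 1) - ?h (int j))"
  have "?s \<le> real (N choose (N div 2))"
    by (rule binomial_shift_one[of ?h]) (auto simp: h)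
  \<comment> \<open>The one-sided bound for \<open>1 - h\<close> is the other side of the bound for
    \<open>h\<close>.\<close>
  moreover have "- ?s = (\<Sum>j\<le>N. real (N choose j) * ((1 - ?h (int j + 1)) - (1 - ?h (int j))))"
    by (simp add: sum_negf[symmetric] algebra_simps)
  moreover have "... \<le> real (N choose (N div 2))"
    by (rule binomial_shift_one[of "\<lambda>j. 1 - ?h j"]) (auto simp: h)
  ultimately have "\<bar>?s\<bar> \<le> real (N choose (N div 2))" by linarith
  moreover have "(\<Sum>j\<le>N. real (N choose j) * (h (int j + int (Suc d)) - h (int j)))
      = ?s + (\<Sum>j\<le>N. real (N choose j) * (h (int j + int d) - h (int j)))"
    by (simp add: sum.distrib[symmetric] algebra_simps)
  ultimately show ?case using Suc by (simp add: algebra_simps)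
qed simp

text \<open>The reflection j -> N - j preserves the coefficients and turns a negative shift into a
  positive one.\<close>

lemma binomial_shift:
  fixes h :: "int \<Rightarrow> real"
  assumes h: "\<And>j. 0 \<le> h j" "\<And>j. h j \<le> 1"
  shows "(\<Sum>j\<le>N. real (N choose j) * (h (int j + d) - h (int j))) \<le> real_of_int \<bar>d\<bar> * real (N choose (N div 2))"
proof (cases "0 \<le> d")
  case True
  then show ?thesis using binomial_shift_nat[of h N "nat d"] h by simp
next
  case False
  let ?h = "\<lambda>j. h (- j)"
  have refl: "(\<Sum>j\<le>N. real (N choose j) * f (int j)) = (\<Sum>j\<le>N. real (N choose j) * f (int N - int j))" for f :: "int \<Rightarrow> real"
    by (rule sum.reindex_bij_witness[of _ "\<lambda>j. N - j" "\<lambda>j. N - j"])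
       (auto simp: binomial_symmetric[symmetric] of_nat_diff)
  define h' where "h' = (\<lambda>j. h (int N - j))"
  have "(\<Sum>j\<le>N. real (N choose j) * (h (int j + d) - h (int j)))
      = (\<Sum>j\<le>N. real (N choose j) * (h' (int j + int (nat (- d))) - h' (int j)))"
    using False refl[of "\<lambda>j. h (j + d) - h j"] by (simp add: h'_def algebra_simps)
  also have "... \<le> real (nat (- d)) * real (N choose (N div 2))"
    using binomial_shift_nat[of h' N "nat (- d)"] h by (simp add: h'_def)
  finally show ?thesis using False by simp
qed

text \<open>Consecutive central coefficients have ratio 2 (2m + 1) / (m + 1), so the induction step
  amounts to (2m + 1)(2m + 3) \<le> 4 (m + 1)^2.\<close>

lemma central_binomial_even: "(real ((2 * m) choose m))\<^sup>2 * real (2 * m + 1) \<le> (4 ^ m)\<^sup>2"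
proof (induction m)
  case (Suc m)
  define a where "a = real ((2 * m) choose m)"
  define b where "b = real ((2 * Suc m) choose Suc m)"
  have "Suc m * (Suc (Suc (2 * m)) choose Suc m) = Suc (Suc (2 * m)) * (Suc (2 * m) choose m)"
    by (rule Suc_times_binomial)
  moreover have "Suc m * (Suc (2 * m) choose Suc m) = Suc (2 * m) * ((2 * m) choose m)"
    by (rule Suc_times_binomial)
  moreover have "Suc (2 * m) choose m = Suc (2 * m) choose Suc m"
    using binomial_symmetric[of m "Suc (2 * m)"] by (simp add: Suc_diff_le mult_2)
  ultimately have "Suc m * Suc m * (Suc (Suc (2 * m)) choose Suc m) = Suc (Suc (2 * m)) * (Suc (2 * m) * ((2 * m) choose m))"
    by (metis mult.assoc mult.left_commute)
  then have "real (Suc m * Suc m * (Suc (Suc (2 * m)) choose Suc m)) = real (Suc (Suc (2 * m)) * (Suc (2 * m) * ((2 * m) choose m)))"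
    by presburger
  then have "(real m + 1) * ((real m + 1) * b) = (real m + 1) * (2 * (2 * real m + 1) * a)"
    by (simp add: a_def b_def algebra_simps)
  then have ab: "(real m + 1) * b = 2 * (2 * real m + 1) * a" by simp
  have "((real m + 1) * b)\<^sup>2 * (2 * real m + 3) = 4 * (a\<^sup>2 * (2 * real m + 1)) * ((2 * real m + 1) * (2 * real m + 3))"
    unfolding ab by (simp add: power2_eq_square algebra_simps)
  also have "... \<le> 4 * (4 ^ m)\<^sup>2 * ((2 * real m + 1) * (2 * real m + 3))"
    using Suc by (intro mult_right_mono mult_left_mono) (auto simp: a_def algebra_simps)
  also have "... \<le> 4 * (4 ^ m)\<^sup>2 * (4 * (real m + 1)\<^sup>2)"
    by (intro mult_left_mono) (auto simp: power2_eq_square algebra_simps)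
  also have "... = (real m + 1)\<^sup>2 * (4 ^ Suc m)\<^sup>2" by (simp add: power2_eq_square)
  finally have "(real m + 1)\<^sup>2 * (b\<^sup>2 * (2 * real m + 3)) \<le> (real m + 1)\<^sup>2 * (4 ^ Suc m)\<^sup>2"
    by (simp add: power_mult_distrib mult.assoc)
  then have "b\<^sup>2 * (2 * real m + 3) \<le> (4 ^ Suc m)\<^sup>2"
    by (rule mult_left_le_imp_le) (simp add: add_nonneg_pos)
  then show ?case by (simp add: b_def algebra_simps)
qed simp

text \<open>For odd \<open>N\<close> the central coefficient of N + 1 is twice that of
  \<open>N\<close>, which reduces to the even case.\<close>

lemma central_binomial_le:
  assumes "0 < N"
  shows "real (N choose (N div 2)) / 2 ^ N \<le> 1 / sqrt (real N)"
proof -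
  have "(real (N choose (N div 2)))\<^sup>2 * real N \<le> (2 ^ N)\<^sup>2"
  proof (cases "even N")
    case True
    then obtain m where m: "N = 2 * m" by blast
    have "(real (N choose (N div 2)))\<^sup>2 * real N \<le> (real ((2 * m) choose m))\<^sup>2 * real (2 * m + 1)"
      unfolding m by (intro mult_mono) auto
    also have "... \<le> (2 ^ N)\<^sup>2" using central_binomial_even[of m] by (simp add: m power_mult)
    finally show ?thesis .
  next
    case False
    then obtain m where m: "N = 2 * m + 1" using oddE by blast
    have "Suc m * (Suc (Suc (2 * m)) choose Suc m) = Suc (Suc (2 * m)) * (Suc (2 * m) choose m)"
      by (rule Suc_times_binomial)
    then have "Suc m * (Suc (Suc (2 * m)) choose Suc m) = Suc m * (2 * (Suc (2 * m) choose m))" by simp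
    then have "Suc (Suc (2 * m)) choose Suc m = 2 * (Suc (2 * m) choose m)"
      by (simp only: mult_cancel1) simp
    then have "(2 * real (N choose (N div 2)))\<^sup>2 * real (2 * Suc m + 1) \<le> (4 ^ Suc m)\<^sup>2"
      using central_binomial_even[of "Suc m"] by (simp add: m)
    moreover have "(4 ^ Suc m)\<^sup>2 = 4 * ((2::real) ^ N)\<^sup>2"
      by (simp add: m power_mult power2_eq_square power_mult_distrib[symmetric])
    ultimately have "(real (N choose (N div 2)))\<^sup>2 * real (2 * Suc m + 1) \<le> (2 ^ N)\<^sup>2"
      by (simp add: power_mult_distrib mult.commute)
    moreover have "(real (N choose (N div 2)))\<^sup>2 * real N \<le> (real (N choose (N div 2)))\<^sup>2 * real (2 * Suc m + 1)"
      by (intro mult_left_mono) (auto simp: m)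
    ultimately show ?thesis by linarith
  qed
  then have "sqrt ((real (N choose (N div 2)))\<^sup>2 * real N) \<le> sqrt ((2 ^ N)\<^sup>2)"
    by (rule real_sqrt_le_mono)
  then have "real (N choose (N div 2)) * sqrt (real N) \<le> 2 ^ N"
    by (simp add: real_sqrt_mult)
  then show ?thesis using assms by (simp add: field_simps)
qed

section \<open>The weight of a uniform point, conditioned on part of its coordinates\<close>

lemma sum_Pow_card:
  fixes f :: "nat \<Rightarrow> real"
  assumes "finite R"
  shows "(\<Sum>B\<in>Pow R. f (card B)) = (\<Sum>j\<le>card R. real (card R choose j) * f j)"
proof -
  have "(\<Sum>B\<in>Pow R. f (card B)) = (\<Sum>j\<in>{..card R}. \<Sum>B\<in>{B\<in>Pow R. card B = j}. f (card B))"
    using assms by (intro sum.group[symmetric]) (auto intro: card_mono)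
  also have "... = (\<Sum>j\<le>card R. real (card R choose j) * f j)"
    using n_subsets[OF assms] by (intro sum.cong) auto
  finally show ?thesis .
qed

lemma sum_cube_split:
  fixes f :: "(nat \<Rightarrow> bool) \<Rightarrow> real"
  assumes "R \<subseteq> {..<n}"
  shows "(\<Sum>x\<in>cube n. f x) = (\<Sum>A\<in>Pow ({..<n} - R). \<Sum>B\<in>Pow R. f (\<lambda>i. i \<in> A \<union> B))"
proof -
  have "(\<Sum>x\<in>cube n. f x) = (\<Sum>(A, B)\<in>Pow ({..<n} - R) \<times> Pow R. f (\<lambda>i. i \<in> A \<union> B))"
  proof (rule sum.reindex_bij_witness[of _ "\<lambda>(A, B) i. i \<in> A \<union> B" "\<lambda>x. ({i. x i} - R, {i. x i} \<inter> R)"])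
    fix x assume x: "x \<in> cube n"
    have *: "(\<lambda>i. i \<in> ({i. x i} - R) \<union> ({i. x i} \<inter> R)) = x" by auto
    show "(case ({i. x i} - R, {i. x i} \<inter> R) of (A, B) \<Rightarrow> \<lambda>i. i \<in> A \<union> B) = x"
      using * by simp
    show "(case ({i. x i} - R, {i. x i} \<inter> R) of (A, B) \<Rightarrow> f (\<lambda>i. i \<in> A \<union> B)) = f x"
      using * by simp
    show "({i. x i} - R, {i. x i} \<inter> R) \<in> Pow ({..<n} - R) \<times> Pow R"
      using cube_support[OF x] by auto
  next
    fix AB assume "AB \<in> Pow ({..<n} - R) \<times> Pow R"
    then obtain A B where AB: "AB = (A, B)" "A \<subseteq> {..<n} - R" "B \<subseteq> R" by auto
    have "{i. i \<in> A \<union> B} - R = A" "{i. i \<in> A \<union> B} \<inter> R = B" using AB by auto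
    then show "({i. (case AB of (A, B) \<Rightarrow> \<lambda>i. i \<in> A \<union> B) i} - R,
        {i. (case AB of (A, B) \<Rightarrow> \<lambda>i. i \<in> A \<union> B) i} \<inter> R) = AB"
      using AB by simp
    have "A \<union> B \<subseteq> {..<n}" using AB assms by blast
    then have "i \<notin> A \<union> B" if "n \<le> i" for i using that by auto
    then show "(case AB of (A, B) \<Rightarrow> \<lambda>i. i \<in> A \<union> B) \<in> cube n"
      unfolding AB(1) cube_def by simp
  qed
  then show ?thesis by (simp add: sum.cartesian_product)
qed

text \<open>Fix the coordinates outside \<open>R\<close>; they determine \<open>\<phi>\<close> and
  \<open>d\<close>. The weight is then a constant plus a binomial variable with |R| trials, and a
  shift by \<open>d\<close> costs at most |d| times its largest point probability.\<close>

lemma mean_weight_shift: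
  fixes \<phi> :: "(nat \<Rightarrow> bool) \<Rightarrow> int \<Rightarrow> real" and d :: "(nat \<Rightarrow> bool) \<Rightarrow> int"
  assumes R: "R \<subseteq> {..<n}" "R \<noteq> {}"
    and \<phi>: "\<And>x w. 0 \<le> \<phi> x w" "\<And>x w. \<phi> x w \<le> 1"
    and dep: "\<And>x y. (\<And>i. i \<notin> R \<Longrightarrow> x i = y i) \<Longrightarrow> \<phi> x = \<phi> y \<and> d x = d y"
  shows "avg n (\<lambda>x. \<phi> x (int (wt x) + d x))
       \<le> avg n (\<lambda>x. \<phi> x (int (wt x))) + avg n (\<lambda>x. real_of_int \<bar>d x\<bar>) / sqrt (real (card R))"
proof -
  have finR: "finite R" using R finite_subset by auto
  define b where "b = real (card R choose (card R div 2))"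
  have b: "b \<le> 2 ^ card R / sqrt (real (card R))"
    using central_binomial_le[of "card R"] finR R by (simp add: b_def card_gt_0_iff field_simps)
  have "(\<Sum>x\<in>cube n. \<phi> x (int (wt x) + d x) - \<phi> x (int (wt x)))
      \<le> (\<Sum>x\<in>cube n. real_of_int \<bar>d x\<bar> / sqrt (real (card R)))"
    unfolding sum_cube_split[OF R(1)]
  proof (rule sum_mono)
    fix A assume A: "A \<in> Pow ({..<n} - R)"
    define x0 where "x0 = (\<lambda>i. i \<in> A)"
    have x0: "\<phi> (\<lambda>i. i \<in> A \<union> B) = \<phi> x0 \<and> d (\<lambda>i. i \<in> A \<union> B) = d x0" if "B \<in> Pow R" for B
      using that by (intro dep) (auto simp: x0_def)
    have w: "wt (\<lambda>i. i \<in> A \<union> B) = card A + card B" if "B \<in> Pow R" for B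
    proof -
      have "finite A" "finite B" "A \<inter> B = {}"
        using that A finR finite_subset[of A "{..<n}"] finite_subset[of B R] by auto
      moreover have "{i. i \<in> A \<union> B} = A \<union> B" by blast
      ultimately show ?thesis unfolding wt_def by (simp only: card_Un_disjoint)
    qed
    have "(\<Sum>B\<in>Pow R. \<phi> (\<lambda>i. i \<in> A \<union> B) (int (wt (\<lambda>i. i \<in> A \<union> B)) + d (\<lambda>i. i \<in> A \<union> B))
          - \<phi> (\<lambda>i. i \<in> A \<union> B) (int (wt (\<lambda>i. i \<in> A \<union> B))))
        = (\<Sum>B\<in>Pow R. (\<lambda>j. \<phi> x0 (int (card A) + (int j + d x0)) - \<phi> x0 (int (card A) + int j)) (card B))"
      using x0 w by (intro sum.cong refl) (simp add: add.assoc)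
    also have "... = (\<Sum>j\<le>card R. real (card R choose j) *
        (\<phi> x0 (int (card A) + (int j + d x0)) - \<phi> x0 (int (card A) + int j)))"
      by (rule sum_Pow_card[OF finR])
    also have "... \<le> real_of_int \<bar>d x0\<bar> * b"
      unfolding b_def by (rule binomial_shift[of "\<lambda>j. \<phi> x0 (int (card A) + j)"]) (auto simp: \<phi>)
    also have "... \<le> real_of_int \<bar>d x0\<bar> * (2 ^ card R / sqrt (real (card R)))"
      using b by (intro mult_left_mono) auto
    also have "... = (\<Sum>B\<in>Pow R. real_of_int \<bar>d x0\<bar> / sqrt (real (card R)))"
      using finR by (simp add: card_Pow)
    also have "... = (\<Sum>B\<in>Pow R. real_of_int \<bar>d (\<lambda>i. i \<in> A \<union> B)\<bar> / sqrt (real (card R)))"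
      using x0 by (intro sum.cong refl) simp
    finally show "(\<Sum>B\<in>Pow R. \<phi> (\<lambda>i. i \<in> A \<union> B) (int (wt (\<lambda>i. i \<in> A \<union> B)) + d (\<lambda>i. i \<in> A \<union> B))
          - \<phi> (\<lambda>i. i \<in> A \<union> B) (int (wt (\<lambda>i. i \<in> A \<union> B))))
        \<le> (\<Sum>B\<in>Pow R. real_of_int \<bar>d (\<lambda>i. i \<in> A \<union> B)\<bar> / sqrt (real (card R)))" .
  qed
  then have "avg n (\<lambda>x. \<phi> x (int (wt x) + d x) - \<phi> x (int (wt x)))
      \<le> avg n (\<lambda>x. (1 / sqrt (real (card R))) * real_of_int \<bar>d x\<bar>)"
    unfolding mean_def by (intro divide_right_mono) auto
  then show ?thesis by (simp only: mean_diff mean_cmult) simp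
qed

section \<open>Cores of almost symmetric functions\<close>

text \<open>Each count has variance |B| / 4. The inequality |t| \<le> t^2 / (2s) + s / 2, with s the
  square root of |B|, passes from second moments to the mean absolute difference.\<close>

lemma mean_count_diff_le:
  assumes B: "B \<subseteq> {..<n}"
  shows "avg n (\<lambda>z. avg n (\<lambda>x.
      real_of_int \<bar>(\<Sum>i\<in>B. of_bool (z i)) - (\<Sum>i\<in>B. of_bool (x i))\<bar>)) \<le> sqrt (real (card B))"
proof (cases "card B = 0")
  case True
  then have "B = {}" using B finite_subset[of B] by auto
  then show ?thesis by (simp add: mean_const)
next
  case False
  define s where "s = sqrt (real (card B))"
  have s: "s > 0" "s * s = real (card B)" using False by (auto simp: s_def)
  define Z where "Z = (\<lambda>x :: nat \<Rightarrow> bool. \<Sum>i<n. of_bool (i \<in> B) * (of_bool (x i) - 1/2 :: real))"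
  have Z: "(\<Sum>i\<in>B. of_bool (x i)) = Z x + real (card B) / 2" for x :: "nat \<Rightarrow> bool"
  proof -
    have "Z x = (\<Sum>i\<in>B. of_bool (x i) - 1/2)"
      unfolding Z_def using B by (intro sum.mono_neutral_cong_right) auto
    then show ?thesis by (simp add: sum_subtractf)
  qed
  have Z2: "avg n (\<lambda>x. (Z x)\<^sup>2) = real (card B) / 4"
  proof -
    have "{i \<in> {..<n}. i \<in> B} = B" using B by auto
    then have "(\<Sum>i<n. (of_bool (i \<in> B) :: real)\<^sup>2) = real (card B)"
      by (simp add: of_bool_def if_distrib[of "\<lambda>x. x\<^sup>2"] sum.If_cases Int_def cong: if_cong)
    then show ?thesis unfolding Z_def mean_rademacher_square by simp
  qed
  have pt: "real_of_int \<bar>(\<Sum>i\<in>B. of_bool (z i)) - (\<Sum>i\<in>B. of_bool (x i))\<bar>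
      \<le> (1/s) * (Z z)\<^sup>2 + ((1/s) * (Z x)\<^sup>2 + s / 2)" for x z :: "nat \<Rightarrow> bool"
  proof -
    have "real_of_int \<bar>(\<Sum>i\<in>B. of_bool (z i)) - (\<Sum>i\<in>B. of_bool (x i))\<bar> = \<bar>Z z - Z x\<bar>"
      using Z[of z] Z[of x] by simp
    also have "... * s \<le> ((Z z - Z x)\<^sup>2 + s\<^sup>2) / 2"
      using sum_squares_ge_zero[of "\<bar>Z z - Z x\<bar> - s" 0] by (simp add: power2_eq_square algebra_simps)
    also have "... \<le> (Z z)\<^sup>2 + (Z x)\<^sup>2 + s\<^sup>2 / 2"
      using sum_squares_ge_zero[of "Z z + Z x" 0] by (simp add: power2_eq_square algebra_simps)
    finally show ?thesis using s(1) by (simp add: field_simps power2_eq_square)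
  qed
  have "avg n (\<lambda>z. avg n (\<lambda>x.
      real_of_int \<bar>(\<Sum>i\<in>B. of_bool (z i)) - (\<Sum>i\<in>B. of_bool (x i))\<bar>))
    \<le> avg n (\<lambda>z. avg n (\<lambda>x. (1/s) * (Z z)\<^sup>2 + ((1/s) * (Z x)\<^sup>2 + s / 2)))"
    by (intro mean_mono pt)
  also have "... = (1/s) * (real (card B) / 4) + ((1/s) * (real (card B) / 4) + s / 2)"
    by (simp only: mean_add mean_cmult mean_const[OF finite_cube cube_nonempty] Z2)
  also have "... = s" using s by (simp add: field_simps)
  finally show ?thesis by (simp add: s_def)
qed

text \<open>Swapping the coordinates in \<open>V - U\<close> with fresh ones hardly changes \<open>G\<close>; as the weight is nearly
  independent of those fresh coordinates, they can be replaced by constants.\<close>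

lemma core_from_swap:
  fixes G :: "(nat \<Rightarrow> bool) \<Rightarrow> bool"
  assumes \<theta>: "pairing n V \<theta>" and U: "U \<subseteq> V" and G: "core_dep n V G" and n: "4 * card V \<le> n" "0 < n"
    and D: "swap_dist n G \<theta> (V - U) \<le> \<Delta>"
  shows "\<exists>\<Gamma>. core_dep n U \<Gamma> \<and> bdist n G \<Gamma> \<le> \<Delta> + sqrt (2 * real (card V) / real n)"
proof -
  have V: "V \<subseteq> {..<n}" "finite V" and perm: "\<theta> permutes {..<n}" and inv: "\<And>i. \<theta> (\<theta> i) = i"
    and d: "\<And>i. i \<in> V \<Longrightarrow> \<theta> i \<notin> V"
    using \<theta> finite_subset[of V "{..<n}"] unfolding pairing_def by auto
  define A where "A = V - U"
  define B where "B = \<theta> ` A"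
  define R where "R = {..<n} - (V \<union> B)"
  have B: "B \<subseteq> {..<n}" "B \<inter> V = {}" "finite B"
    using V d permutes_in_image[OF perm] finite_subset[of A V] by (auto simp: B_def A_def)
  have cB: "card B \<le> card V"
    unfolding B_def A_def using V by (meson card_image_le card_mono Diff_subset finite_Diff order_trans)
  have "card (V \<union> B) \<le> 2 * card V" using card_Un_le[of V B] cB by simp
  moreover have "card R = n - card (V \<union> B)"
    unfolding R_def using V B by (subst card_Diff_subset) auto
  ultimately have cR: "real n \<le> 2 * real (card R)" using n by linarith
  have R: "R \<subseteq> {..<n}" by (auto simp: R_def)
  have R': "R \<noteq> {}" using cR n by auto
  \<comment> \<open>\<open>Gh\<close> is \<open>G\<close> as a function of the values on
    \<open>V\<close> and the weight. The weight is an integer because shifted weights may leave the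
    possible range; the value is arbitrary there, but \<open>\<phi>\<close> stays between 0 and
    1.\<close>
  define Gh where "Gh = (\<lambda>(v :: nat \<Rightarrow> bool) w. G (SOME t. t \<in> cube n \<and> (\<forall>i\<in>V. t i = v i) \<and> int (wt t) = w))"
  have Gh: "G x = Gh v (int (wt x))" if "x \<in> cube n" "\<And>i. i \<in> V \<Longrightarrow> x i = v i" for x v
  proof -
    have "\<exists>t. t \<in> cube n \<and> (\<forall>i\<in>V. t i = v i) \<and> int (wt t) = int (wt x)" using that by blast
    from someI_ex[OF this] show ?thesis
      unfolding Gh_def using that by (intro core_depD[OF G]) auto
  qed
  have Gh_cong: "Gh v = Gh v'" if "\<And>i. i \<in> V \<Longrightarrow> v i = v' i" for v v'
    unfolding Gh_def using that by simp
  define mix where "mix = (\<lambda>(x :: nat \<Rightarrow> bool) z i. if i \<in> A then z (\<theta> i) else x i)"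
  define \<phi> :: "(nat \<Rightarrow> bool) \<Rightarrow> int \<Rightarrow> real" where "\<phi> = (\<lambda>x w. of_bool (Gh x w \<noteq> Gh (mix x x) w))"
  define dd :: "(nat \<Rightarrow> bool) \<Rightarrow> (nat \<Rightarrow> bool) \<Rightarrow> int"
    where "dd = (\<lambda>z x. (\<Sum>i\<in>B. of_bool (z i)) - (\<Sum>i\<in>B. of_bool (x i)))"
  have base: "avg n (\<lambda>x. \<phi> x (int (wt x))) \<le> \<Delta>"
  proof -
    have "avg n (\<lambda>x. \<phi> x (int (wt x)))
        = swap_dist n G \<theta> (V - U)"
    proof (intro mean_cong)
      fix x assume x: "x \<in> cube n"
      have sp: "swp \<theta> A permutes {..<n}" by (rule swp_permutes[OF perm inv])
      have "G (perm_vec (swp \<theta> A) x) = Gh (mix x x) (int (wt (perm_vec (swp \<theta> A) x)))"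
      proof (rule Gh)
        show "perm_vec (swp \<theta> A) x \<in> cube n" using x sp by (simp add: perm_vec_in_cube)
        show "perm_vec (swp \<theta> A) x i = mix x x i" if "i \<in> V" for i
          using that d[OF that] unfolding perm_vec_swp[OF inv] by (auto simp: swp_def mix_def A_def)
      qed
      then show "\<phi> x (int (wt x)) = of_bool (G x \<noteq> G (perm_vec (swp \<theta> (V - U)) x))"
        using Gh[OF x, of x] by (simp add: \<phi>_def A_def[symmetric] wt_perm_vec permutes_bij[OF sp])
    qed
    then show ?thesis using D by simp
  qed
  have shift: "avg n (\<lambda>x. \<phi> x (int (wt x) + dd z x))
      \<le> avg n (\<lambda>x. \<phi> x (int (wt x))) + avg n (\<lambda>x. real_of_int \<bar>dd z x\<bar>) / sqrt (real (card R))" for z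
  proof (rule mean_weight_shift[OF R R'])
    fix x y :: "nat \<Rightarrow> bool" assume xy: "\<And>i. i \<notin> R \<Longrightarrow> x i = y i"
    then have VB: "x i = y i" if "i \<in> V \<union> B" for i using that by (auto simp: R_def)
    have "Gh x = Gh y" using VB by (intro Gh_cong) auto
    moreover have "Gh (mix x x) = Gh (mix y y)" using VB by (intro Gh_cong) (auto simp: mix_def B_def)
    moreover have "dd z x = dd z y" using VB by (auto simp: dd_def)
    ultimately show "\<phi> x = \<phi> y \<and> dd z x = dd z y" by (simp add: \<phi>_def)
  qed (auto simp: \<phi>_def)
  \<comment> \<open>Exchanging the \<open>B\<close>-coordinates of two independent points preserves
    their joint distribution. It turns the replacement of \<open>A\<close> by values of a second
    point into the genuine swap, with the weight shifted by \<open>dd z x\<close>.\<close>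
  define ex where "ex = (\<lambda>(x :: nat \<Rightarrow> bool, z :: nat \<Rightarrow> bool).
      (\<lambda>i. if i \<in> B then z i else x i, \<lambda>i. if i \<in> B then x i else z i))"
  have ex: "bij_betw ex (cube n \<times> cube n) (cube n \<times> cube n)"
    by (rule bij_betwI[where g = ex]) (auto simp: ex_def cube_def fun_eq_iff)
  let ?h = "\<lambda>x z. of_bool (Gh x (int (wt x)) \<noteq> Gh (mix x z) (int (wt x))) :: real"
  have "avg n (\<lambda>z. avg n (\<lambda>x. ?h x z)) = mean (cube n \<times> cube n) (\<lambda>(x, z). ?h x z)"
    unfolding mean_prod[symmetric] by (rule mean_swap)
  also have "... = mean (cube n \<times> cube n) (\<lambda>p. case ex p of (x, z) \<Rightarrow> ?h x z)"
    by (rule mean_reindex[OF ex, symmetric])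
  also have "... = mean (cube n \<times> cube n) (\<lambda>(x, z). \<phi> x (int (wt x) + dd z x))"
  proof (intro mean_cong)
    fix p assume "p \<in> cube n \<times> cube n"
    then obtain x z where p: "p = (x, z)" "x \<in> cube n" "z \<in> cube n" by auto
    define x' z' where "x' = (\<lambda>i. if i \<in> B then z i else x i)" and "z' = (\<lambda>i. if i \<in> B then x i else z i)"
    have x'c: "x' \<in> cube n" using p by (auto simp: x'_def cube_def)
    have "int (wt x') = (\<Sum>i<n. of_bool (x i) + (if i \<in> B then of_bool (z i) - of_bool (x i) else 0))"
      unfolding wt_eq_sum[OF x'c] by (intro sum.cong) (auto simp: x'_def)
    also have "... = int (wt x) + (\<Sum>i<n. if i \<in> B then of_bool (z i) - of_bool (x i) else 0)"
      by (simp add: sum.distrib wt_eq_sum[OF p(2)])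
    also have "(\<Sum>i<n. if i \<in> B then of_bool (z i) - of_bool (x i) else 0) = (\<Sum>i\<in>B. of_bool (z i) - of_bool (x i) :: int)"
      using B by (intro sum.mono_neutral_cong_right) auto
    finally have w: "int (wt x') = int (wt x) + dd z x" by (simp add: dd_def sum_subtractf)
    have "Gh x' = Gh x" using B by (intro Gh_cong) (auto simp: x'_def)
    moreover have "Gh (mix x' z') = Gh (mix x x)"
      using B by (intro Gh_cong) (auto simp: x'_def z'_def mix_def B_def)
    ultimately have "?h x' z' = \<phi> x (int (wt x) + dd z x)" by (simp only: \<phi>_def w)
    then show "(case ex p of (x, z) \<Rightarrow> ?h x z) = (case p of (x, z) \<Rightarrow> \<phi> x (int (wt x) + dd z x))"
      by (simp add: p ex_def x'_def z'_def)
  qed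
  also have "... = avg n (\<lambda>z. avg n (\<lambda>x. \<phi> x (int (wt x) + dd z x)))"
    unfolding mean_prod[symmetric] by (rule mean_swap)
  also have "... \<le> avg n (\<lambda>z. \<Delta> + (1 / sqrt (real (card R))) * avg n (\<lambda>x. real_of_int \<bar>dd z x\<bar>))"
    by (rule mean_mono) (use shift base in \<open>auto intro!: order_trans[OF shift] add_mono\<close>)
  also have "... = \<Delta> + (1 / sqrt (real (card R))) * avg n (\<lambda>z. avg n (\<lambda>x. real_of_int \<bar>dd z x\<bar>))"
    by (simp only: mean_add mean_cmult mean_const[OF finite_cube cube_nonempty])
  also have "... \<le> \<Delta> + (1 / sqrt (real (card R))) * sqrt (real (card B))"
    unfolding dd_def by (intro add_left_mono mult_left_mono mean_count_diff_le B) auto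
  also have "... \<le> \<Delta> + sqrt (2 * real (card V) / real n)"
  proof -
    have "real (card B) / real (card R) \<le> real (card V) / (real n / 2)"
      using cB cR n by (intro frac_le) auto
    then have "sqrt (real (card B) / real (card R)) \<le> sqrt (2 * real (card V) / real n)"
      by (intro real_sqrt_le_mono) (simp add: field_simps)
    then show ?thesis by (simp add: real_sqrt_divide)
  qed
  finally have avg: "avg n (\<lambda>z. avg n (\<lambda>x. ?h x z)) \<le> \<Delta> + sqrt (2 * real (card V) / real n)" .
  \<comment> \<open>Some \<open>z\<close> does no worse than the average; fixing it removes the
    dependence on \<open>V - U\<close>.\<close>
  obtain z where "avg n (\<lambda>x. ?h x z) \<le> avg n (\<lambda>z. avg n (\<lambda>x. ?h x z))"
    using mean_exists_le[OF finite_cube cube_nonempty, where \<phi> = "\<lambda>z. avg n (\<lambda>x. ?h x z)"] by blast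
  then have z: "avg n (\<lambda>x. ?h x z) \<le> \<Delta> + sqrt (2 * real (card V) / real n)"
    using avg by (rule order_trans)
  define \<Gamma> where "\<Gamma> = (\<lambda>x. Gh (mix x z) (int (wt x)))"
  have "core_dep n U \<Gamma>"
    unfolding core_dep_def
  proof (intro ballI impI)
    fix x y assume "\<forall>i\<in>U. x i = y i" "wt x = wt y"
    then have "Gh (mix x z) = Gh (mix y z)" by (intro Gh_cong) (auto simp: mix_def A_def)
    then show "\<Gamma> x = \<Gamma> y" using \<open>wt x = wt y\<close> by (simp only: \<Gamma>_def)
  qed
  moreover have "bdist n G \<Gamma> = avg n (\<lambda>x. ?h x z)"
    unfolding bdist_mean \<Gamma>_def using Gh by (intro mean_cong) auto
  ultimately show ?thesis using z by auto
qed

section \<open>Points that are constant on residue classes\<close>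

definition count :: "nat \<Rightarrow> (nat \<Rightarrow> bool) \<Rightarrow> nat" where
  "count m u = card {j. j < m \<and> u j}"

text \<open>The classes receive weight \<open>l * count m u\<close>; the rest of \<open>wt u\<close>
  must fit into the reservoir of \<open>n - m * l\<close> coordinates.\<close>

definition feasible :: "nat \<Rightarrow> nat \<Rightarrow> nat \<Rightarrow> (nat \<Rightarrow> bool) \<Rightarrow> bool" where
  "feasible n m l u \<longleftrightarrow> l * count m u \<le> wt u \<and> wt u \<le> l * count m u + (n - m * l)"

text \<open>The coordinates below \<open>m * l\<close> form \<open>m\<close> residue classes of size \<open>l\<close>, on which \<open>spread\<close> copies
  the first \<open>m\<close> bits of \<open>u\<close>; the remaining coordinates are used to restore the weight of \<open>u\<close>.\<close>

definition spread :: "nat \<Rightarrow> nat \<Rightarrow> (nat \<Rightarrow> bool) \<Rightarrow> nat \<Rightarrow> bool" where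
  "spread m l u = (\<lambda>i. if i < m * l then u (i mod m) else i < m * l + (wt u - l * count m u))"

lemma card_residue_classes:
  assumes "T \<subseteq> {..<m}"
  shows "card {i. i < m * l \<and> i mod m \<in> T} = l * card T"
proof (cases "m = 0")
  case True
  then show ?thesis using assms by simp
next
  case False
  have "bij_betw (\<lambda>(j, a). a * m + j) (T \<times> {..<l}) {i. i < m * l \<and> i mod m \<in> T}"
  proof (rule bij_betwI[where g = "\<lambda>i. (i mod m, i div m)"])
    show "(\<lambda>(j, a). a * m + j) \<in> T \<times> {..<l} \<rightarrow> {i. i < m * l \<and> i mod m \<in> T}"
    proof (safe, goal_cases)
      case (1 j a)
      then have "j < m" using assms by auto
      then have "a * m + j < (a + 1) * m" by simp
      also have "... \<le> l * m" using 1 by (intro mult_right_mono) auto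
      finally show ?case by (simp add: mult.commute)
    next
      case (2 j a)
      then show ?case using assms by (auto simp: subset_eq)
    qed
    show "(\<lambda>i. (i mod m, i div m)) \<in> {i. i < m * l \<and> i mod m \<in> T} \<rightarrow> T \<times> {..<l}"
      using False by (auto simp: less_mult_imp_div_less mult.commute)
    show "(case (case x of (j, a) \<Rightarrow> a * m + j) of i \<Rightarrow> (i mod m, i div m)) = x" if "x \<in> T \<times> {..<l}" for x
      using that assms False by (auto simp: subset_eq)
    show "(case (y mod m, y div m) of (j, a) \<Rightarrow> a * m + j) = y" for y by simp
  qed
  from bij_betw_same_card[OF this] show ?thesis by (simp add: card_cartesian_product mult.commute)
qed

lemma spread_cube_wt:
  assumes u: "feasible n m l u" and mn: "m * l \<le> n"
  shows "spread m l u \<in> cube n" "wt (spread m l u) = wt u"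
proof -
  define w where "w = wt u - l * count m u"
  have w: "m * l + w \<le> n" "wt u = l * count m u + w" using u mn by (auto simp: feasible_def w_def)
  show "spread m l u \<in> cube n" using w mn by (auto simp: cube_def spread_def w_def[symmetric])
  have "i mod m < m" if "i < m * l" for i using that by (cases m) auto
  then have "{i. spread m l u i} = {i. i < m * l \<and> i mod m \<in> {j. j < m \<and> u j}} \<union> {m * l..<m * l + w}"
    by (auto simp: spread_def w_def[symmetric] split: if_splits)
  also have "card ... = card {i. i < m * l \<and> i mod m \<in> {j. j < m \<and> u j}} + w"
    by (subst card_Un_disjoint) auto
  also have "... = wt u"
    using w by (subst card_residue_classes) (auto simp: count_def)
  finally show "wt (spread m l u) = wt u" by (simp only: wt_def)
qed

text \<open>Each residue class holds at most one point of \<open>E\<close>, and exchanging that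
  point \<open>e\<close> with \<open>e mod m\<close> stays inside the class.\<close>

lemma residue_permutation:
  fixes m l :: nat
  assumes "E \<subseteq> {..<m * l}" "inj_on (\<lambda>i. i mod m) E" "0 < l"
  shows "\<exists>\<tau>. \<tau> permutes {..<m * l} \<and> (\<forall>i\<in>E. \<tau> i = i mod m) \<and> (\<forall>i. \<tau> i mod m = i mod m)"
proof -
  have "finite E" using finite_subset[OF assms(1)] by simp
  \<comment> \<open>The induction also records that classes without a point of \<open>E\<close> are
    untouched, so the next transposition meets a class on which \<open>\<tau>\<close> is the
    identity.\<close>
  then have "\<exists>\<tau>. \<tau> permutes {..<m * l} \<and> (\<forall>i\<in>E. \<tau> i = i mod m) \<and> (\<forall>i. \<tau> i mod m = i mod m)
      \<and> (\<forall>i. i mod m \<notin> (\<lambda>i. i mod m) ` E \<longrightarrow> \<tau> i = i)"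
    using assms
  proof (induction E rule: finite_induct)
    case empty
    then show ?case by (intro exI[of _ id]) (auto simp: permutes_id[unfolded id_def])
  next
    case (insert e E)
    then obtain \<tau> where \<tau>: "\<tau> permutes {..<m * l}" "\<forall>i\<in>E. \<tau> i = i mod m" "\<forall>i. \<tau> i mod m = i mod m"
      "\<forall>i. i mod m \<notin> (\<lambda>i. i mod m) ` E \<longrightarrow> \<tau> i = i"
      by auto
    have e: "e < m * l" "e mod m \<notin> (\<lambda>i. i mod m) ` E" using insert by auto
    then have "0 < m" by (cases m) auto
    then have "e mod m < m" by simp
    moreover have "m \<le> m * l" using insert.prems(3) by simp
    ultimately have "e mod m < m * l" by linarith
    then have tr: "Transposition.transpose e (e mod m) permutes {..<m * l}"
      using e by (intro permutes_swap_id) auto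
    define \<tau>' where "\<tau>' = Transposition.transpose e (e mod m) \<circ> \<tau>"
    have "\<tau>' permutes {..<m * l}" unfolding \<tau>'_def using \<tau>(1) tr by (rule permutes_compose)
    moreover have "\<tau>' i = i mod m" if "i \<in> insert e E" for i
    proof (cases "i = e")
      case True
      then show ?thesis using \<tau>(4) e by (simp add: \<tau>'_def Transposition.transpose_def)
    next
      case False
      then have i: "i \<in> E" using that by simp
      then have ne: "i mod m \<noteq> e mod m" using e by (metis imageI)
      then have "i mod m \<noteq> e" by (metis mod_mod_trivial)
      then show ?thesis using \<tau>(2) i ne by (simp add: \<tau>'_def Transposition.transpose_def)
    qed
    moreover have "\<tau>' i mod m = i mod m" for i
      using \<tau>(3) by (auto simp: \<tau>'_def Transposition.transpose_def) (metis mod_mod_trivial)+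
    moreover have "\<tau>' i = i" if "i mod m \<notin> (\<lambda>i. i mod m) ` insert e E" for i
    proof -
      have "\<tau> i = i" using \<tau>(4) that by auto
      moreover have "i \<noteq> e" "i \<noteq> e mod m" using that by auto
      ultimately show ?thesis by (simp add: \<tau>'_def Transposition.transpose_def)
    qed
    ultimately show ?case by blast
  qed
  then show ?thesis by blast
qed

text \<open>The permutation \<open>\<rho>\<close> carries the fixed residue classes to the random
  partition, so coordinate \<open>c\<close> belongs to class \<open>inv \<rho> c mod m\<close>, or
  to the reservoir if \<open>inv \<rho> c \<ge> m * l\<close>.\<close>

definition separates :: "nat \<Rightarrow> nat \<Rightarrow> nat set \<Rightarrow> (nat \<Rightarrow> nat) \<Rightarrow> bool" where
  "separates m l C \<rho> \<longleftrightarrow> inv \<rho> ` C \<subseteq> {..<m * l} \<and> inj_on (\<lambda>i. i mod m) (inv \<rho> ` C)"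

definition class_union :: "nat \<Rightarrow> nat \<Rightarrow> (nat \<Rightarrow> nat) \<Rightarrow> nat set \<Rightarrow> nat set" where
  "class_union m l \<rho> T = \<rho> ` {i. i < m * l \<and> i mod m \<in> T}"

lemma class_union_mono: "T \<subseteq> T' \<Longrightarrow> class_union m l \<rho> T \<subseteq> class_union m l \<rho> T'"
  by (auto simp: class_union_def)

lemma class_union_subset: "\<rho> permutes {..<n} \<Longrightarrow> m * l \<le> n \<Longrightarrow> class_union m l \<rho> T \<subseteq> {..<n}"
  unfolding class_union_def
  by (rule order_trans[OF image_mono[of _ "{..<n}"]]) (auto simp: permutes_image)

lemma card_class_union:
  assumes "\<rho> permutes S" "T \<subseteq> {..<m}"
  shows "card (class_union m l \<rho> T) = l * card T"
  unfolding class_union_def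
  using card_image[OF inj_on_subset[OF permutes_inj[OF assms(1)] subset_UNIV]] card_residue_classes[OF assms(2)]
  by simp

text \<open>On query points a function with separated core behaves like a copy of itself at the
  uniform point \<open>u\<close>. Moving each core position within its class to the class index
  makes the query point agree with \<open>u\<close> on the core, and the weights are equal. The
  permutation \<open>\<zeta>\<close> does not depend on \<open>u\<close>.\<close>

lemma unscramble:
  assumes h: "core_dep n C h" and \<rho>: "\<rho> permutes {..<n}" and sep: "separates m l C \<rho>"
    and mn: "m * l \<le> n" and l: "0 < l"
  shows "\<exists>\<zeta>. \<zeta> permutes {..<n} \<and> inv \<zeta> ` C \<subseteq> {..<m} \<and>
    (\<forall>u\<in>cube n. feasible n m l u \<longrightarrow> h (perm_vec \<rho> (spread m l u)) = h (perm_vec \<zeta> u)) \<and>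
    (\<forall>T\<subseteq>{..<m}. \<zeta> ` T \<subseteq> class_union m l \<rho> T)"
proof (cases "m = 0")
  case True
  \<comment> \<open>Without classes a separated core is empty, and only the weight matters.\<close>
  then have "C = {}" using sep by (auto simp: separates_def)
  show ?thesis
  proof (intro exI[of _ \<rho>] conjI ballI allI impI \<rho>)
    fix u assume u: "u \<in> cube n" "feasible n m l u"
    show "h (perm_vec \<rho> (spread m l u)) = h (perm_vec \<rho> u)"
      using spread_cube_wt[OF u(2) mn] u \<rho> \<open>C = {}\<close>
      by (intro core_depD[OF h]) (simp_all add: perm_vec_in_cube wt_perm_vec permutes_bij)
  qed (use True \<open>C = {}\<close> in auto)
next
  case False
  define E where "E = inv \<rho> ` C"
  obtain \<tau> where \<tau>: "\<tau> permutes {..<m * l}" "\<And>i. i \<in> E \<Longrightarrow> \<tau> i = i mod m" "\<And>i. \<tau> i mod m = i mod m"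
    using residue_permutation[of E m l] sep l by (auto simp: separates_def E_def)
  have \<tau>n: "\<tau> permutes {..<n}" using \<tau>(1) mn by (auto intro: permutes_subset)
  define \<zeta> where "\<zeta> = \<rho> \<circ> inv \<tau>"
  have \<zeta>: "\<zeta> permutes {..<n}"
    unfolding \<zeta>_def by (intro permutes_compose permutes_inv \<tau>n \<rho>)
  have "inv \<zeta> = \<tau> \<circ> inv \<rho>"
    unfolding \<zeta>_def using \<tau>n \<rho> by (simp add: o_inv_distrib permutes_bij bij_imp_bij_inv inv_inv_eq)
  then have inv\<zeta>: "inv \<zeta> ` C = \<tau> ` E" by (simp add: E_def image_comp)
  moreover have "\<tau> ` E \<subseteq> {..<m}" using \<tau>(2) False by auto
  moreover have "h (perm_vec \<rho> (spread m l u)) = h (perm_vec \<zeta> u)"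
    if u: "u \<in> cube n" "feasible n m l u" for u
  proof -
    have "\<zeta> \<circ> \<tau> = \<rho>" unfolding \<zeta>_def using permutes_inv_o(2)[OF \<tau>n] by (simp add: o_assoc[symmetric])
    then have "h (perm_vec \<rho> (spread m l u)) = h (perm_vec \<zeta> (perm_vec \<tau> (spread m l u)))"
      using \<zeta> \<tau>n by (simp add: perm_vec_comp permutes_bij)
    also have "... = h (perm_vec \<zeta> u)"
    proof (rule core_depD[OF core_dep_perm_vec[OF h \<zeta>]])
      fix i assume "i \<in> inv \<zeta> ` C"
      then obtain e where e: "e \<in> E" "i = \<tau> e" using inv\<zeta> by auto
      have "e < m * l" using e sep by (auto simp: separates_def E_def)
      moreover have "perm_vec \<tau> (spread m l u) i = spread m l u e"
        unfolding e(2) by (rule perm_vec_apply[OF permutes_bij[OF \<tau>n]])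
      ultimately show "perm_vec \<tau> (spread m l u) i = u i"
        using e \<tau>(2) by (simp add: spread_def)
    qed (use u spread_cube_wt[OF u(2) mn] \<tau>n in \<open>auto simp: perm_vec_in_cube wt_perm_vec permutes_bij\<close>)
    finally show ?thesis .
  qed
  moreover have "\<zeta> ` T \<subseteq> class_union m l \<rho> T" if T: "T \<subseteq> {..<m}" for T
  proof
    fix v assume "v \<in> \<zeta> ` T"
    then obtain c where c: "c \<in> T" "v = \<rho> (inv \<tau> c)" by (auto simp: \<zeta>_def)
    have "c < m" using c T by auto
    moreover have "m \<le> m * l" using l by simp
    ultimately have "c < m * l" by linarith
    then have "inv \<tau> c < m * l" using permutes_in_image[OF permutes_inv[OF \<tau>(1)], of c] by simp
    moreover have "inv \<tau> c mod m = c"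
      using \<tau>(3)[of "inv \<tau> c"] \<open>c < m\<close> by (simp add: permutes_inverses[OF \<tau>(1)])
    ultimately show "v \<in> class_union m l \<rho> T" using c by (auto simp: class_union_def)
  qed
  ultimately show ?thesis using \<zeta> by blast
qed

text \<open>Union bound over the elements of \<open>C\<close> that fall into the reservoir and the
  pairs that share a class.\<close>

lemma mean_not_separates:
  assumes C: "C \<subseteq> {..<n}" and mn: "m * l \<le> n" and m: "0 < m"
  shows "avg_perm n (\<lambda>\<rho>. of_bool (\<not> separates m l C \<rho>))
       \<le> real (card C) * (real (n - m * l) / real n) + (real (card C))\<^sup>2 * (2 * real l / real n)"
proof -
  have finC: "finite C" using C finite_subset by auto
  define R where "R = (\<lambda>i j. j < m * l \<and> j mod m = i mod m)"
  have "avg_perm n (\<lambda>\<rho>. of_bool (\<not> separates m l C \<rho>))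
      = avg_perm n (\<lambda>\<rho>. of_bool (\<not> (\<rho> ` C \<subseteq> {..<m * l} \<and> inj_on (\<lambda>i. i mod m) (\<rho> ` C))))"
    unfolding separates_def
    by (rule mean_perms_inv[of _ "\<lambda>\<rho>. of_bool (\<not> (\<rho> ` C \<subseteq> {..<m * l} \<and> inj_on (\<lambda>i. i mod m) (\<rho> ` C)))"])
  also have "... \<le> avg_perm n (\<lambda>\<rho>. (\<Sum>a\<in>C. of_bool (\<rho> ` {a} \<subseteq> {m * l..<n}))
      + (\<Sum>a\<in>C. \<Sum>a'\<in>C - {a}. of_bool (R (\<rho> a) (\<rho> a'))))"
  proof (intro mean_mono)
    fix \<rho> assume "\<rho> \<in> perms {..<n}"
    then have \<rho>: "\<rho> permutes {..<n}" by simp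
    have nonneg: "0 \<le> (\<Sum>a\<in>C. of_bool (\<rho> ` {a} \<subseteq> {m * l..<n}) :: real)"
      "0 \<le> (\<Sum>a\<in>C. \<Sum>a'\<in>C - {a}. of_bool (R (\<rho> a) (\<rho> a')) :: real)"
      by (intro sum_nonneg; simp)+
    have le_one: "of_bool b \<le> (1 :: real)" for b by simp
    show "of_bool (\<not> (\<rho> ` C \<subseteq> {..<m * l} \<and> inj_on (\<lambda>i. i mod m) (\<rho> ` C))) \<le>
      (\<Sum>a\<in>C. of_bool (\<rho> ` {a} \<subseteq> {m * l..<n})) + (\<Sum>a\<in>C. \<Sum>a'\<in>C - {a}. of_bool (R (\<rho> a) (\<rho> a')) :: real)"
    proof (cases "\<rho> ` C \<subseteq> {..<m * l}")
      case False
      then obtain a where a: "a \<in> C" "\<rho> a \<ge> m * l" by (auto simp: subset_eq not_less)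
      then have "\<rho> ` {a} \<subseteq> {m * l..<n}" using permutes_in_image[OF \<rho>, of a] C by auto
      then have "1 \<le> (\<Sum>a\<in>C. of_bool (\<rho> ` {a} \<subseteq> {m * l..<n}) :: real)"
        using member_le_sum[of a C "\<lambda>a. of_bool (\<rho> ` {a} \<subseteq> {m * l..<n}) :: real"] a finC by simp
      then show ?thesis using nonneg by (intro order_trans[OF le_one]) linarith
    next
      case True
      show ?thesis
      proof (cases "inj_on (\<lambda>i. i mod m) (\<rho> ` C)")
        case False
        then obtain a a' where a: "a \<in> C" "a' \<in> C" "\<rho> a \<noteq> \<rho> a'" "\<rho> a mod m = \<rho> a' mod m"
          by (auto simp: inj_on_def)
        then have "R (\<rho> a) (\<rho> a')" "a' \<in> C - {a}" using True by (auto simp: R_def)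
        then have "1 \<le> (\<Sum>a'\<in>C - {a}. of_bool (R (\<rho> a) (\<rho> a')) :: real)"
          using member_le_sum[of a' "C - {a}" "\<lambda>a'. of_bool (R (\<rho> a) (\<rho> a')) :: real"] finC by simp
        also have "... \<le> (\<Sum>a\<in>C. \<Sum>a'\<in>C - {a}. of_bool (R (\<rho> a) (\<rho> a')))"
          using member_le_sum[of a C "\<lambda>a. \<Sum>a'\<in>C - {a}. of_bool (R (\<rho> a) (\<rho> a')) :: real"] a finC
          by (simp add: sum_nonneg)
        finally show ?thesis using nonneg by (intro order_trans[OF le_one]) linarith
      qed (use True add_nonneg_nonneg[OF nonneg] in simp)
    qed
  qed
  also have "... = (\<Sum>a\<in>C. avg_perm n (\<lambda>\<rho>. of_bool (\<rho> ` {a} \<subseteq> {m * l..<n})))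
      + (\<Sum>a\<in>C. \<Sum>a'\<in>C - {a}. avg_perm n (\<lambda>\<rho>. of_bool (R (\<rho> a) (\<rho> a'))))"
    by (simp only: mean_add mean_sum)
  also have "... \<le> (\<Sum>a\<in>C. real (n - m * l) / real n) + (\<Sum>a\<in>C. \<Sum>a'\<in>C - {a}. 2 * real l / real n)"
  proof (intro add_mono sum_mono)
    fix a assume "a \<in> C"
    then show "avg_perm n (\<lambda>\<rho>. of_bool (\<rho> ` {a} \<subseteq> {m * l..<n})) \<le> real (n - m * l) / real n"
      using mean_perms_image_subset[of "{a}" n "{m * l..<n}"] C ivl_subset[of "m * l" n 0 n]
      by (auto simp: atLeast0LessThan)
  next
    fix a a' assume a: "a \<in> C" "a' \<in> C - {a}"
    show "avg_perm n (\<lambda>\<rho>. of_bool (R (\<rho> a) (\<rho> a'))) \<le> 2 * real l / real n"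
    proof (rule mean_perms_related_pair)
      fix i
      have "{j \<in> {..<n}. R i j} = {j. j < m * l \<and> j mod m \<in> {i mod m}}" using mn by (auto simp: R_def)
      then show "card {j \<in> {..<n}. R i j} \<le> l"
        using card_residue_classes[of "{i mod m}" m l] m by simp
    qed (use a C in auto)
  qed
  also have "... \<le> real (card C) * (real (n - m * l) / real n) + (\<Sum>a\<in>C. real (card C) * (2 * real l / real n))"
  proof (intro add_mono sum_mono)
    fix a
    have "real (card (C - {a})) * (2 * real l / real n) \<le> real (card C) * (2 * real l / real n)"
      using finC by (intro mult_right_mono) (auto intro: card_mono)
    then show "(\<Sum>a'\<in>C - {a}. 2 * real l / real n) \<le> real (card C) * (2 * real l / real n)"
      by (simp only: sum_constant)
  qed (simp only: sum_constant order_refl)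
  also have "... = real (card C) * (real (n - m * l) / real n) + (real (card C))\<^sup>2 * (2 * real l / real n)"
    by (simp add: power2_eq_square)
  finally show ?thesis .
qed

text \<open>Chebyshev's inequality for \<open>wt u - l * count m u\<close>: its mean
  \<open>(n - m * l) / 2\<close> is the midpoint of the feasible range, and each of the first
  \<open>m\<close> bits enters with coefficient 1 - l.\<close>

lemma mean_not_feasible:
  assumes "m * l < n" "0 < l"
  shows "avg n (\<lambda>u. of_bool (\<not> feasible n m l u))
       \<le> (real m * (real l)\<^sup>2 + real n) / (real (n - m * l))\<^sup>2"
proof -
  have "m \<le> m * l" using assms by simp
  then have m: "m < n" using assms by linarith
  define a where "a = (\<lambda>i. if i < m then 1 - real l else 1)"
  define Z where "Z = (\<lambda>u :: nat \<Rightarrow> bool. \<Sum>i<n. a i * (of_bool (u i) - 1/2))"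
  define t where "t = (real (n - m * l) / 2)\<^sup>2"
  have "0 < real (n - m * l)" using assms(1) by (simp only: of_nat_0_less_iff zero_less_diff)
  then have t: "t > 0" unfolding t_def by (simp only: zero_less_power half_gt_zero)
  have split: "(\<Sum>i<n. f i) = (\<Sum>i<m. f i) + (\<Sum>i\<in>{m..<n}. f i)" for f :: "nat \<Rightarrow> real"
    using sum.atLeastLessThan_concat[of 0 m n f] m by (simp add: atLeast0LessThan)
  have Z: "Z u = real (wt u) - real l * real (count m u) - real (n - m * l) / 2" if u: "u \<in> cube n" for u
  proof -
    have w: "real (wt u) = (\<Sum>i<n. of_bool (u i))" by (rule wt_eq_sum[OF u])
    have "{j \<in> {..<m}. u j} = {j. j < m \<and> u j}" by auto
    then have c: "real (count m u) = (\<Sum>i<m. of_bool (u i))"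
      by (simp add: count_def of_bool_def sum.If_cases Int_def)
    have "Z u = (\<Sum>i<m. (1 - real l) * (of_bool (u i) - 1/2)) + (\<Sum>i\<in>{m..<n}. of_bool (u i) - 1/2)"
      unfolding Z_def split by (simp add: a_def)
    also have "... = (1 - real l) * (real (count m u) - real m / 2) + (real (wt u) - real (count m u) - real (n - m) / 2)"
      unfolding w c split[of "\<lambda>i. of_bool (u i)"] by (simp add: sum_distrib_left[symmetric] sum_subtractf)
    also have "... = real (wt u) - real l * real (count m u) - real (n - m * l) / 2"
      using m assms by (simp add: of_nat_diff field_simps)
    finally show ?thesis .
  qed
  have "avg n (\<lambda>u. of_bool (\<not> feasible n m l u)) \<le> avg n (\<lambda>u. of_bool (t \<le> (Z u)\<^sup>2))"
  proof (intro mean_mono)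
    fix u assume u: "u \<in> cube n"
    have "t \<le> (Z u)\<^sup>2" if "\<not> feasible n m l u"
    proof -
      have "\<bar>real (n - m * l) / 2\<bar> \<le> \<bar>Z u\<bar>"
      proof (cases "l * count m u \<le> wt u")
        case True
        then have "l * count m u + (n - m * l) \<le> wt u" using that by (simp add: feasible_def)
        then have "real (l * count m u + (n - m * l)) \<le> real (wt u)" by (simp only: of_nat_le_iff)
        then show ?thesis unfolding Z[OF u] by simp
      next
        case False
        then have "wt u \<le> l * count m u" by simp
        then have "real (wt u) \<le> real (l * count m u)" by (simp only: of_nat_le_iff)
        then show ?thesis unfolding Z[OF u] by simp
      qed
      then show ?thesis unfolding t_def by (simp only: abs_le_square_iff)
    qed
    then show "of_bool (\<not> feasible n m l u) \<le> (of_bool (t \<le> (Z u)\<^sup>2) :: real)" by auto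
  qed
  also have "... \<le> avg n (\<lambda>u. (Z u)\<^sup>2) / t" using t by (intro mean_markov) auto
  also have "avg n (\<lambda>u. (Z u)\<^sup>2) = (\<Sum>i<n. (a i)\<^sup>2) / 4"
    unfolding Z_def by (rule mean_rademacher_square)
  also have "... \<le> (real m * (real l)\<^sup>2 + real n) / 4"
  proof -
    have "(\<Sum>i<n. (a i)\<^sup>2) = real m * (1 - real l)\<^sup>2 + real (n - m)"
      unfolding split by (simp add: a_def)
    also have "... \<le> real m * (real l)\<^sup>2 + real n"
      using assms by (intro add_mono mult_left_mono) (auto simp: power2_eq_square algebra_simps)
    finally show ?thesis by simp
  qed
  finally have "avg n (\<lambda>u. of_bool (\<not> feasible n m l u)) \<le> (real m * (real l)\<^sup>2 + real n) / 4 / t"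
    using t by (auto simp: divide_right_mono)
  moreover have "a / 4 / (w / 2)\<^sup>2 = a / w\<^sup>2" for a w :: real by (simp add: power_divide)
  ultimately show ?thesis by (simp only: t_def)
qed

section \<open>Existence of a small core\<close>

text \<open>A permutation outside \<open>V\<close> carries one choice of partners to the other
  without changing \<open>G\<close>, which sees only \<open>V\<close> and the weight.\<close>

lemma swap_dist_independent:
  assumes \<theta>: "pairing n V \<theta>" and \<theta>': "pairing n V' \<theta>'" and A: "A \<subseteq> V" "A \<subseteq> V'" "\<theta>' ` A \<inter> V = {}"
    and G: "core_dep n V G"
  shows "swap_dist n G \<theta> A
       = swap_dist n G \<theta>' A"
proof -
  have p: "\<theta> permutes {..<n}" "\<And>i. \<theta> (\<theta> i) = i" "\<And>i. i \<in> V \<Longrightarrow> \<theta> i \<notin> V" "V \<subseteq> {..<n}"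
    using \<theta> unfolding pairing_def by auto
  have p': "\<theta>' permutes {..<n}" "\<And>i. \<theta>' (\<theta>' i) = i"
    using \<theta>' unfolding pairing_def by auto
  have "\<exists>\<kappa>. \<kappa> permutes ({..<n} - V) \<and> (\<forall>j\<in>\<theta> ` A. \<kappa> j = \<theta>' (\<theta> j))"
  proof (rule permutes_extend)
    have lt: "\<theta> a < n" "\<theta>' a < n" if "a \<in> A" for a
      using that A p permutes_in_image[OF p(1), of a] permutes_in_image[OF p'(1), of a] by auto
    show "\<theta> ` A \<subseteq> {..<n} - V" using lt p(3) A by auto
    show "(\<lambda>j. \<theta>' (\<theta> j)) ` \<theta> ` A \<subseteq> {..<n} - V"
      using lt A(3) by (auto simp: p(2))
    show "inj_on (\<lambda>j. \<theta>' (\<theta> j)) (\<theta> ` A)"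
      by (rule inj_onI) (metis p(2) p'(2))
  qed auto
  then obtain \<kappa> where \<kappa>: "\<kappa> permutes ({..<n} - V)" "\<And>a. a \<in> A \<Longrightarrow> \<kappa> (\<theta> a) = \<theta>' a"
    using p(2) by auto
  have \<kappa>n: "\<kappa> permutes {..<n}" by (rule perms_diff_permutes[OF \<kappa>(1)])
  have sp: "swp \<theta> A permutes {..<n}" "swp \<theta>' A permutes {..<n}"
    using swp_permutes p p' by auto
  have "swap_dist n G \<theta>' A
      = avg n (\<lambda>x. of_bool (G (perm_vec \<kappa> x) \<noteq> G (perm_vec (swp \<theta>' A) (perm_vec \<kappa> x))))"
    by (rule mean_cube_perm[OF \<kappa>n, symmetric])
  also have "... = swap_dist n G \<theta> A"
  proof (intro mean_cong)
    fix x assume x: "x \<in> cube n"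
    have "G (perm_vec \<kappa> x) = G x" using G \<kappa>(1) x by (simp add: core_dep_iff_perm)
    moreover have "G (perm_vec (swp \<theta>' A) (perm_vec \<kappa> x)) = G (perm_vec (swp \<theta> A) x)"
    proof (rule core_depD[OF G])
      fix i assume i: "i \<in> V"
      have fix_V: "perm_vec \<kappa> x j = x j" if "j \<in> V" for j
        using permutes_not_in[OF permutes_inv[OF \<kappa>(1)], of j] that by (simp add: perm_vec_def)
      have "\<theta> i \<notin> A" using p(3)[OF i] A(1) by auto
      have "\<theta>' i \<notin> A" using A(3) i p'(2)[of i] by (metis IntI empty_iff imageI)
      show "perm_vec (swp \<theta>' A) (perm_vec \<kappa> x) i = perm_vec (swp \<theta> A) x i"
      proof (cases "i \<in> A")
        case True
        then show ?thesis
          using perm_vec_apply[OF permutes_bij[OF \<kappa>n], of x "\<theta> i"] \<kappa>(2)[OF True]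
          unfolding perm_vec_swp[OF p(2)] perm_vec_swp[OF p'(2)] by (simp add: swp_def)
      next
        case False
        then show ?thesis using \<open>\<theta> i \<notin> A\<close> \<open>\<theta>' i \<notin> A\<close> fix_V[OF i]
          unfolding perm_vec_swp[OF p(2)] perm_vec_swp[OF p'(2)] by (simp add: swp_def)
      qed
    qed (use x sp \<kappa>n in \<open>simp_all add: perm_vec_in_cube wt_perm_vec permutes_bij\<close>)
    ultimately show "of_bool (G (perm_vec \<kappa> x) \<noteq> G (perm_vec (swp \<theta>' A) (perm_vec \<kappa> x)))
        = (of_bool (G x \<noteq> G (perm_vec (swp \<theta> A) x)) :: real)" by simp
  qed
  finally show ?thesis by simp
qed

text \<open>The swap moves no coordinate of \<open>W\<close> and so leaves \<open>H\<close>
  unchanged. Passing from \<open>G\<close> through \<open>g\<close> to \<open>H\<close> costs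
  \<open>2 * \<delta>\<close> at each of the two points.\<close>

lemma swap_dist_le:
  assumes \<theta>: "pairing n V \<theta>" and A: "A \<subseteq> V" and fix_W: "A \<inter> W = {}" "\<theta> ` A \<inter> W = {}"
    and H: "core_dep n W H" and d: "bdist n g G \<le> \<delta>" "bdist n g H \<le> \<delta>"
  shows "swap_dist n G \<theta> A \<le> 4 * \<delta>"
proof -
  have p: "\<theta> permutes {..<n}" "\<And>i. \<theta> (\<theta> i) = i"
    using \<theta> unfolding pairing_def by auto
  define s where "s = perm_vec (swp \<theta> A)"
  have sp: "swp \<theta> A permutes {..<n}" using swp_permutes p by auto
  have H_s: "H (s x) = H x" if x: "x \<in> cube n" for x
  proof (rule core_depD[OF H])
    fix i assume i: "i \<in> W"
    then have "i \<notin> A" "\<theta> i \<notin> A" using fix_W p(2)[of i] by (auto simp: disjoint_iff image_iff)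
    then show "s x i = x i" unfolding s_def perm_vec_swp[OF p(2)] by (simp add: swp_def)
  qed (use x sp in \<open>simp_all add: s_def perm_vec_in_cube wt_perm_vec permutes_bij\<close>)
  have "avg n (\<lambda>x. of_bool (G x \<noteq> G (s x)))
      \<le> avg n (\<lambda>x. (of_bool (g x \<noteq> G x) + of_bool (g x \<noteq> H x))
          + (of_bool (g (s x) \<noteq> H (s x)) + of_bool (g (s x) \<noteq> G (s x))))"
    using H_s by (intro mean_mono) auto
  also have "... = (bdist n g G + bdist n g H) + (bdist n g H + bdist n g G)"
    using mean_cube_perm[OF sp, of "\<lambda>x. of_bool (g x \<noteq> H x)"] mean_cube_perm[OF sp, of "\<lambda>x. of_bool (g x \<noteq> G x)"]
    by (simp only: mean_add bdist_mean s_def)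
  finally show ?thesis using d by (simp add: s_def)
qed

text \<open>One good partition supplies \<open>V\<close>, \<open>G\<close> and the measure
  \<open>\<mu>\<close>. Every other good one traps most of \<open>\<mu>\<close> inside its own
  classes; \<open>small_core\<close> then yields \<open>U\<close>, and \<open>core_from_swap\<close>
  removes the coordinates in \<open>V - U\<close>.\<close>

lemma core_exists:
  assumes k: "1 \<le> k" and l: "0 < l" and mn: "m * l \<le> n" and km: "100 * k\<^sup>2 \<le> m"
    and \<delta>: "0 < \<delta>" "400 * \<delta> \<le> 1"
    and good: "3/10 \<le> avg_perm n
      (\<lambda>\<rho>. of_bool (\<exists>T\<subseteq>{..<m}. card T \<le> k \<and> sym_inf n (class_union m l \<rho> T) g \<le> \<delta>))"
  shows "\<exists>U \<Gamma>. U \<subseteq> {..<n} \<and> card U < 2 * k \<and> core_dep n U \<Gamma> \<and>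
    bdist n g \<Gamma> \<le> 401 * \<delta> + sqrt (2 * real k / real m)"
proof -
  define gd where "gd = (\<lambda>\<rho>. \<exists>T\<subseteq>{..<m}. card T \<le> k \<and> sym_inf n (class_union m l \<rho> T) g \<le> \<delta>)"
  define T where "T = (\<lambda>\<rho>. SOME T. T \<subseteq> {..<m} \<and> card T \<le> k \<and> sym_inf n (class_union m l \<rho> T) g \<le> \<delta>)"
  define W where "W = (\<lambda>\<rho>. class_union m l \<rho> (T \<rho>))"
  have T: "T \<rho> \<subseteq> {..<m}" "card (T \<rho>) \<le> k" "sym_inf n (W \<rho>) g \<le> \<delta>" if "gd \<rho>" for \<rho>
  proof -
    have "\<exists>T. T \<subseteq> {..<m} \<and> card T \<le> k \<and> sym_inf n (class_union m l \<rho> T) g \<le> \<delta>"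
      using that unfolding gd_def by blast
    from someI_ex[OF this] show "T \<rho> \<subseteq> {..<m}" "card (T \<rho>) \<le> k" "sym_inf n (W \<rho>) g \<le> \<delta>"
      unfolding T_def W_def by auto
  qed
  have "k * 1 \<le> k * k" using k by (intro mult_le_mono2) auto
  then have "100 * k \<le> m" using km unfolding power2_eq_square by linarith
  then have "100 * k * l \<le> m * l" by (intro mult_right_mono) auto
  then have kl: "100 * (k * l) \<le> n" using mn by linarith
  have n: "0 < n" using kl k l by (cases n) auto
  have m: "0 < m" using km k by (cases m) auto
  have W: "W \<rho> \<subseteq> {..<n}" "card (W \<rho>) \<le> k * l" if "gd \<rho>" "\<rho> permutes {..<n}" for \<rho>
    using class_union_subset[OF that(2) mn] card_class_union[OF that(2) T(1)[OF that(1)]] T(2)[OF that(1)]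
    by (auto simp: W_def mult.commute)
  have "\<exists>\<rho>0\<in>perms {..<n}. gd \<rho>0"
  proof (rule ccontr)
    assume "\<not> ?thesis"
    then have "avg_perm n (\<lambda>\<rho>. of_bool (gd \<rho>)) = avg_perm n (\<lambda>\<rho>. 0)"
      by (intro mean_cong) auto
    then show False using good by (simp add: gd_def mean_const)
  qed
  then obtain \<rho>0 where \<rho>0: "\<rho>0 permutes {..<n}" "gd \<rho>0" by auto
  define V where "V = W \<rho>0"
  have V: "V \<subseteq> {..<n}" "card V \<le> k * l" "finite V"
    using W[OF \<rho>0(2,1)] finite_subset[of V "{..<n}"] by (auto simp: V_def)
  obtain G where G: "core_dep n V G" "bdist n g G \<le> \<delta>"
    using sym_inf_close[of n V g] T(3)[OF \<rho>0(2)] by (auto simp: V_def intro: order_trans)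
  have cV: "card ({..<n} - V) = n - card V" using V by (subst card_Diff_subset) auto
  have "card V \<le> card ({..<n} - V)" using V kl cV by linarith
  then obtain \<theta> where \<theta>: "pairing n V \<theta>"
    using pairing_exists[of V n "{..<n} - V"] V by auto
  define D where "D = (\<lambda>A. swap_dist n G \<theta> A :: real)"
  obtain \<mu> where \<mu>: "\<forall>S. 0 \<le> \<mu> S" "(\<Sum>S\<in>Pow V. \<mu> S) = 1"
    "\<forall>B\<subseteq>V. \<forall>d. (\<forall>A\<subseteq>B. D A \<le> d) \<longrightarrow> 1 - 2 * d \<le> (\<Sum>S\<in>{S\<in>Pow V. S \<inter> B = {}}. \<mu> S)"
    "\<forall>A\<subseteq>V. D A \<le> (\<Sum>S\<in>{S\<in>Pow V. S \<inter> A \<noteq> {}}. \<mu> S)"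
    using swap_measure[OF \<theta>, of G] unfolding D_def by blast
  have "\<exists>U\<subseteq>V. card U < 2 * k \<and> (\<Sum>S\<in>{S\<in>Pow V. \<not> S \<subseteq> U}. \<mu> S) \<le> 400 * \<delta>"
  proof (rule small_core[OF V(3) \<mu>(1)[rule_format] \<mu>(2) _ _ _ _ k \<delta>])
    show "finite (perms {..<n})" by simp
    show "3/10 \<le> avg_perm n (\<lambda>\<rho>. of_bool (gd \<rho>))" using good by (simp add: gd_def)
  next
    fix \<rho> assume "\<rho> \<in> perms {..<n}" and gd: "gd \<rho>"
    then have \<rho>: "\<rho> permutes {..<n}" by simp
    note W = W[OF gd \<rho>]
    obtain H where H: "core_dep n (W \<rho>) H" "bdist n g H \<le> \<delta>"
      using sym_inf_close[of n "W \<rho>" g] T(3)[OF gd] by (auto intro: order_trans)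
    have "card (V \<union> W \<rho>) \<le> 2 * (k * l)" using card_Un_le[of V "W \<rho>"] V W by linarith
    moreover have "card ({..<n} - (V \<union> W \<rho>)) = n - card (V \<union> W \<rho>)"
      using V W finite_subset[OF W(1)] by (subst card_Diff_subset) auto
    moreover have "card (V - W \<rho>) \<le> card V" using V by (intro card_mono) auto
    ultimately have "card (V - W \<rho>) \<le> card ({..<n} - (V \<union> W \<rho>))" using kl V by linarith
    \<comment> \<open>With partners outside both sets, swaps in \<open>V - W \<rho>\<close> leave
      \<open>W \<rho>\<close> alone, so \<open>H\<close> does not notice them.\<close>
    then obtain \<theta>' where \<theta>': "pairing n (V - W \<rho>) \<theta>'" "\<theta>' ` (V - W \<rho>) \<subseteq> {..<n} - (V \<union> W \<rho>)"
      using pairing_exists[of "V - W \<rho>" n "{..<n} - (V \<union> W \<rho>)"] V by auto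
    have "1 - 2 * (4 * \<delta>) \<le> (\<Sum>S\<in>{S\<in>Pow V. S \<inter> (V - W \<rho>) = {}}. \<mu> S)"
    proof (rule \<mu>(3)[rule_format])
      fix A assume A: "A \<subseteq> V - W \<rho>"
      have "D A = swap_dist n G \<theta>' A"
        unfolding D_def using A \<theta>'(2) by (intro swap_dist_independent[OF \<theta> \<theta>'(1) _ _ _ G(1)]) auto
      also have "... \<le> 4 * \<delta>"
        using A \<theta>'(2) by (intro swap_dist_le[OF \<theta>'(1) _ _ _ H(1) G(2) H(2)]) auto
      finally show "D A \<le> 4 * \<delta>" .
    qed auto
    also have "{S\<in>Pow V. S \<inter> (V - W \<rho>) = {}} = {S\<in>Pow V. S \<subseteq> W \<rho>}" by auto
    finally show "1 - 8 * \<delta> \<le> (\<Sum>S\<in>{S\<in>Pow V. S \<subseteq> W \<rho>}. \<mu> S)" by simp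
  next
    fix U assume U: "U \<subseteq> V" "2 * k \<le> card U"
    \<comment> \<open>Union bound over the at most m^k sets of \<open>k\<close> classes. Each one
      contains \<open>U\<close> with probability at most (k/m)^(2k), so the total is at most
      (k^2/m)^k.\<close>
    define \<T> where "\<T> = {T. T \<subseteq> {..<m} \<and> card T = k}"
    define X where "X = (\<lambda>T. {i. i < m * l \<and> i mod m \<in> T})"
    have fin: "finite \<T>" unfolding \<T>_def by simp
    have X: "X T \<subseteq> {..<n}" "T \<subseteq> {..<m} \<Longrightarrow> card (X T) = l * card T" for T
      using mn card_residue_classes[of T m l] by (auto simp: X_def)
    have "avg_perm n (\<lambda>\<rho>. of_bool (gd \<rho> \<and> U \<subseteq> W \<rho>))
        \<le> avg_perm n (\<lambda>\<rho>. \<Sum>T\<in>\<T>. of_bool (inv \<rho> ` U \<subseteq> X T))"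
    proof (intro mean_mono)
      fix \<rho> assume "\<rho> \<in> perms {..<n}"
      then have \<rho>: "\<rho> permutes {..<n}" by simp
      show "of_bool (gd \<rho> \<and> U \<subseteq> W \<rho>) \<le> (\<Sum>T\<in>\<T>. of_bool (inv \<rho> ` U \<subseteq> X T) :: real)"
      proof (cases "gd \<rho> \<and> U \<subseteq> W \<rho>")
        case True
        have "k \<le> card {..<m}" using \<open>100 * k \<le> m\<close> by simp
        then obtain T' where T': "T \<rho> \<subseteq> T'" "T' \<subseteq> {..<m}" "card T' = k"
          using exists_subset_between[of "T \<rho>" k "{..<m}"] T(1,2) True by auto
        have "U \<subseteq> \<rho> ` X T'"
          using True class_union_mono[OF T'(1)] unfolding W_def class_union_def X_def by blast
        then have "inv \<rho> ` U \<subseteq> X T'" by (auto simp: permutes_inverses[OF \<rho>])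
        then have "1 \<le> (\<Sum>T\<in>\<T>. of_bool (inv \<rho> ` U \<subseteq> X T) :: real)"
          using member_le_sum[of T' \<T> "\<lambda>T. of_bool (inv \<rho> ` U \<subseteq> X T) :: real"] fin T' by (simp add: \<T>_def)
        then show ?thesis using True by simp
      qed (auto intro: sum_nonneg)
    qed
    also have "... = (\<Sum>T\<in>\<T>. avg_perm n (\<lambda>\<rho>. of_bool (inv \<rho> ` U \<subseteq> X T)))"
      by (rule mean_sum)
    also have "... \<le> (\<Sum>T\<in>\<T>. (real k / real m) ^ (2 * k))"
    proof (intro sum_mono)
      fix T assume "T \<in> \<T>"
      then have T: "T \<subseteq> {..<m}" "card T = k" by (auto simp: \<T>_def)
      have "avg_perm n (\<lambda>\<rho>. of_bool (inv \<rho> ` U \<subseteq> X T)) = avg_perm n (\<lambda>\<rho>. of_bool (\<rho> ` U \<subseteq> X T))"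
        by (rule mean_perms_inv[of _ "\<lambda>\<rho>. of_bool (\<rho> ` U \<subseteq> X T)"])
      also have "... \<le> (real (card (X T)) / real n) ^ card U"
        using U V X(1) by (intro mean_perms_image_subset) auto
      also have "... \<le> (real k / real m) ^ card U"
      proof (intro power_mono)
        have "real l * real m \<le> real n" using mn by (metis mult.commute of_nat_le_iff of_nat_mult)
        then have "real k * (real l * real m) \<le> real k * real n" by (intro mult_left_mono) auto
        then show "real (card (X T)) / real n \<le> real k / real m"
          using T X(2)[OF T(1)] n m by (simp add: field_simps)
      qed auto
      also have "... \<le> (real k / real m) ^ (2 * k)"
        using U(2) \<open>100 * k \<le> m\<close> m by (intro power_decreasing) auto
      finally show "avg_perm n (\<lambda>\<rho>. of_bool (inv \<rho> ` U \<subseteq> X T)) \<le> (real k / real m) ^ (2 * k)" .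
    qed
    also have "... = real (m choose k) * (real k / real m) ^ (2 * k)"
      using n_subsets[of "{..<m}" k] by (simp add: \<T>_def)
    also have "... \<le> real m ^ k * (real k / real m) ^ (2 * k)"
    proof (intro mult_right_mono)
      have "m choose k \<le> m ^ k" using binomial_le_pow[of k m] \<open>100 * k \<le> m\<close> by simp
      then show "real (m choose k) \<le> real m ^ k" by (metis of_nat_le_iff of_nat_power)
    qed auto
    also have "... = (real m * (real k / real m)\<^sup>2) ^ k"
      by (simp add: power_mult power_mult_distrib)
    also have "... \<le> (1/100) ^ k"
    proof (intro power_mono)
      have "100 * (real k)\<^sup>2 \<le> real m" using km by (metis of_nat_le_iff of_nat_mult of_nat_numeral of_nat_power)
      then show "real m * (real k / real m)\<^sup>2 \<le> 1/100"
        using m by (simp add: field_simps power2_eq_square)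
    qed auto
    finally show "avg_perm n (\<lambda>\<rho>. of_bool (gd \<rho> \<and> U \<subseteq> W \<rho>)) \<le> (1/100) ^ k" .
  qed
  then obtain U where U: "U \<subseteq> V" "card U < 2 * k" "(\<Sum>S\<in>{S\<in>Pow V. \<not> S \<subseteq> U}. \<mu> S) \<le> 400 * \<delta>"
    by blast
  have "swap_dist n G \<theta> (V - U) \<le> 400 * \<delta>"
  proof -
    have "{S\<in>Pow V. S \<inter> (V - U) \<noteq> {}} = {S\<in>Pow V. \<not> S \<subseteq> U}" by auto
    then show ?thesis using \<mu>(4)[rule_format, of "V - U"] U(3) unfolding D_def by auto
  qed
  moreover have "4 * card V \<le> n" using V kl by linarith
  ultimately obtain \<Gamma> where \<Gamma>: "core_dep n U \<Gamma>"
    "bdist n G \<Gamma> \<le> 400 * \<delta> + sqrt (2 * real (card V) / real n)"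
    using core_from_swap[OF \<theta> U(1) G(1) _ n] by blast
  have "sqrt (2 * real (card V) / real n) \<le> sqrt (2 * real k / real m)"
  proof -
    have "card V * m \<le> k * l * m" using V(2) by (intro mult_right_mono) auto
    also have "... = k * (m * l)" by (simp add: algebra_simps)
    also have "... \<le> k * n" using mn by (intro mult_left_mono) auto
    finally have "real (card V) * real m \<le> real k * real n" by (metis of_nat_le_iff of_nat_mult)
    then show ?thesis using n m by (simp add: field_simps)
  qed
  then have "bdist n g \<Gamma> \<le> 401 * \<delta> + sqrt (2 * real k / real m)"
    using bdist_triangle[of n g \<Gamma> G] \<Gamma>(2) G(2) by linarith
  then show ?thesis using U V \<Gamma>(1) by blast
qed

section \<open>The tester\<close>

text \<open>All points are queried and the list of answers is passed to \<open>c\<close>. The two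
  subtrees are drawn independently, but a run enters only one of them, so acceptance depends on the
  branch of the true answers alone.\<close>

primrec ask :: "(nat \<Rightarrow> bool) list \<Rightarrow> (bool list \<Rightarrow> qtree pmf) \<Rightarrow> qtree pmf" where
  "ask [] c = c []"
| "ask (x # xs) c = bind_pmf (ask xs (\<lambda>a. c (True # a))) (\<lambda>t1.
     bind_pmf (ask xs (\<lambda>a. c (False # a))) (\<lambda>t2. return_pmf (Query x t1 t2)))"

lemma map_run_ask: "map_pmf (\<lambda>t. run t g) (ask xs c) = map_pmf (\<lambda>t. run t g) (c (map g xs))"
proof (induction xs arbitrary: c)
  case (Cons x xs)
  show ?case
  proof (cases "g x")
    case True
    then have "map_pmf (\<lambda>t. run t g) (ask (x # xs) c) = map_pmf (\<lambda>t. run t g) (ask xs (\<lambda>a. c (True # a)))"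
      by (simp add: map_bind_pmf bind_return_pmf map_pmf_def bind_assoc_pmf)
    then show ?thesis using Cons True by simp
  next
    case False
    then have "map_pmf (\<lambda>t. run t g) (ask (x # xs) c) = map_pmf (\<lambda>t. run t g) (ask xs (\<lambda>a. c (False # a)))"
      by (simp add: map_bind_pmf bind_return_pmf map_pmf_def bind_assoc_pmf)
    then show ?thesis using Cons False by simp
  qed
qed simp

lemma acc_prob_pmf: "acc_prob T g = pmf (map_pmf (\<lambda>t. run t g) T) True"
  by (simp add: acc_prob_def pmf_map vimage_def)

lemma acc_prob_ask: "acc_prob (ask xs c) g = acc_prob (c (map g xs)) g"
  by (simp add: acc_prob_pmf map_run_ask)

lemma acc_prob_Leaf [simp]: "acc_prob (return_pmf (Leaf b)) g = of_bool b"
  by (simp add: acc_prob_pmf)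

lemma acc_prob_bind_set:
  assumes "finite S" "S \<noteq> {}"
  shows "acc_prob (bind_pmf (pmf_of_set S) c) g = mean S (\<lambda>s. acc_prob (c s) g)"
  using assms by (simp add: acc_prob_pmf map_bind_pmf pmf_bind integral_pmf_of_set mean_def)

definition costs :: "nat \<Rightarrow> nat \<Rightarrow> qtree pmf \<Rightarrow> bool" where
  "costs n d T \<longleftrightarrow> (\<forall>t\<in>set_pmf T. valid_qtree n t \<and> depth t \<le> d)"

lemma costs_ask:
  assumes "set xs \<subseteq> cube n" "\<And>a. length a = length xs \<Longrightarrow> costs n d (c a)"
  shows "costs n (length xs + d) (ask xs c)"
  using assms
proof (induction xs arbitrary: c)
  case (Cons x xs)
  have "costs n (length xs + d) (ask xs (\<lambda>a. c (True # a)))"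
    "costs n (length xs + d) (ask xs (\<lambda>a. c (False # a)))"
    using Cons.prems by (auto intro!: Cons.IH)
  then show ?case using Cons.prems(1) unfolding costs_def by (auto simp: set_bind_pmf)
qed simp

lemma costs_bind_set:
  assumes "finite S" "S \<noteq> {}" "\<And>s. s \<in> S \<Longrightarrow> costs n d (c s)"
  shows "costs n d (bind_pmf (pmf_of_set S) c)"
  using assms unfolding costs_def by (auto simp: set_bind_pmf)

lemma costs_Leaf: "costs n d (return_pmf (Leaf b))"
  by (simp add: costs_def)

section \<open>Checking symmetry outside a given set\<close>

primrec verify :: "nat \<Rightarrow> nat set \<Rightarrow> nat \<Rightarrow> qtree pmf" where
  "verify n V 0 = return_pmf (Leaf True)"
| "verify n V (Suc N) = bind_pmf (pmf_of_set (cube n \<times> perms ({..<n} - V))) (\<lambda>s.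
     ask [fst s, perm_vec (snd s) (fst s)]
       (\<lambda>a. if a ! 0 = a ! 1 then verify n V N else return_pmf (Leaf False)))"

text \<open>The rounds are independent, and each one rejects with probability
  \<open>sym_inf n V g\<close>.\<close>

lemma acc_prob_verify: "acc_prob (verify n V N) g = (1 - sym_inf n V g) ^ N"
proof (induction N)
  case (Suc N)
  have "acc_prob (verify n V (Suc N)) g = mean (cube n \<times> perms ({..<n} - V))
      (\<lambda>s. acc_prob (if g (fst s) = g (perm_vec (snd s) (fst s)) then verify n V N else return_pmf (Leaf False)) g)"
    unfolding verify.simps by (subst acc_prob_bind_set) (auto simp: acc_prob_ask simp del: ask.simps)
  also have "... = mean (cube n \<times> perms ({..<n} - V))
      (\<lambda>(x, \<pi>). acc_prob (verify n V N) g - acc_prob (verify n V N) g * of_bool (g x \<noteq> g (perm_vec \<pi> x)))"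
    by (intro mean_cong) auto
  also have "... = avg n (\<lambda>x. mean (perms ({..<n} - V))
      (\<lambda>\<pi>. acc_prob (verify n V N) g - acc_prob (verify n V N) g * of_bool (g x \<noteq> g (perm_vec \<pi> x))))"
    by (rule mean_prod[symmetric])
  also have "... = acc_prob (verify n V N) g - acc_prob (verify n V N) g *
      avg n (\<lambda>x. mean (perms ({..<n} - V)) (\<lambda>\<pi>. of_bool (g x \<noteq> g (perm_vec \<pi> x))))"
    by (simp add: mean_diff mean_cmult mean_const)
  also have "avg n (\<lambda>x. mean (perms ({..<n} - V)) (\<lambda>\<pi>. of_bool (g x \<noteq> g (perm_vec \<pi> x)))) = sym_inf n V g"
    unfolding sym_inf_def by (rule mean_swap)
  finally show ?case by (simp add: Suc algebra_simps)
qed simp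

lemma costs_verify: "costs n (2 * N) (verify n V N)"
proof (induction N)
  case (Suc N)
  show ?case unfolding verify.simps
  proof (rule costs_bind_set)
    fix s assume "s \<in> cube n \<times> perms ({..<n} - V)"
    then have "set [fst s, perm_vec (snd s) (fst s)] \<subseteq> cube n"
      using perm_vec_in_cube[OF perms_diff_permutes] by auto
    from costs_ask[OF this, of "2 * N"]
    show "costs n (2 * Suc N) (ask [fst s, perm_vec (snd s) (fst s)]
        (\<lambda>a. if a ! 0 = a ! 1 then verify n V N else return_pmf (Leaf False)))"
      using Suc by (simp add: costs_Leaf del: ask.simps)
  qed auto
qed (simp add: costs_Leaf)

section \<open>Random samples and candidate copies\<close>

definition samples :: "nat \<Rightarrow> nat \<Rightarrow> (nat \<Rightarrow> bool) list set" where
  "samples n q = {us. set us \<subseteq> cube n \<and> length us = q}"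

lemma finite_samples [simp]: "finite (samples n q)" and samples_nonempty [simp]: "samples n q \<noteq> {}"
proof -
  show "finite (samples n q)" unfolding samples_def by (rule finite_lists_length_eq) simp
  have "card (samples n q) = (2 ^ n) ^ q" unfolding samples_def by (simp add: card_lists_length_eq)
  then show "samples n q \<noteq> {}" by (metis card.empty power_not_zero zero_neq_numeral)
qed

lemma mean_samples_all:
  "mean (samples n q) (\<lambda>us. of_bool (\<forall>u\<in>set us. P u)) = avg n (\<lambda>u. of_bool (P u)) ^ q"
proof -
  have "{us \<in> samples n q. \<forall>u\<in>set us. P u} = {us. set us \<subseteq> {u\<in>cube n. P u} \<and> length us = q}"
    unfolding samples_def by auto
  then have "card {us \<in> samples n q. \<forall>u\<in>set us. P u} = card {u\<in>cube n. P u} ^ q"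
    by (simp add: card_lists_length_eq)
  moreover have "card (samples n q) = card (cube n) ^ q"
    unfolding samples_def by (simp add: card_lists_length_eq)
  ultimately show ?thesis by (simp add: mean_of_bool power_divide)
qed

text \<open>For an infeasible sample a dummy point is queried, so that the number of queries is
  fixed; \<open>consistent\<close> ignores the answer.\<close>

definition query_pt :: "nat \<Rightarrow> nat \<Rightarrow> nat \<Rightarrow> (nat \<Rightarrow> nat) \<Rightarrow> (nat \<Rightarrow> bool) \<Rightarrow> nat \<Rightarrow> bool" where
  "query_pt n m l \<rho> u = (if feasible n m l u then perm_vec \<rho> (spread m l u) else (\<lambda>_. False))"

text \<open>A candidate is evaluated at the sample itself and not at the query point. For a core
  placed on positions below \<open>m\<close> this is right, since those bits of \<open>u\<close> are
  the values on the classes and the weights are equal.\<close>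

definition consistent ::
  "nat \<Rightarrow> nat \<Rightarrow> nat \<Rightarrow> ((nat \<Rightarrow> bool) \<Rightarrow> bool) \<Rightarrow> (nat \<Rightarrow> nat) set \<Rightarrow> (nat \<Rightarrow> bool) list \<Rightarrow> bool list \<Rightarrow> (nat \<Rightarrow> nat) set" where
  "consistent n m l f H us a =
     {\<pi>\<in>H. \<forall>i<length us. feasible n m l (us ! i) \<longrightarrow> a ! i = f (perm_vec \<pi> (us ! i))}"

abbreviation survivors where
  "survivors n m l f H g \<rho> us \<equiv> consistent n m l f H us (map g (map (query_pt n m l \<rho>) us))"

text \<open>\<open>H\<close> lists candidate placements of \<open>K\<close> on the classes: the
  image of \<open>K\<close> under \<open>inv \<pi>\<close> consists of class indices, and the
  symmetry check fixes the union of these classes.\<close>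

definition tester :: "nat \<Rightarrow> nat \<Rightarrow> nat \<Rightarrow> ((nat \<Rightarrow> bool) \<Rightarrow> bool) \<Rightarrow> nat set \<Rightarrow> (nat \<Rightarrow> nat) set \<Rightarrow> nat \<Rightarrow> nat \<Rightarrow> qtree pmf" where
  "tester n m l f K H q N =
     bind_pmf (pmf_of_set (perms {..<n})) (\<lambda>\<rho>. bind_pmf (pmf_of_set (samples n q)) (\<lambda>us.
       ask (map (query_pt n m l \<rho>) us) (\<lambda>a.
         if consistent n m l f H us a = {} then return_pmf (Leaf False)
         else verify n (class_union m l \<rho> (inv (SOME \<pi>. \<pi> \<in> consistent n m l f H us a) ` K)) N)))"

text \<open>Infeasible samples count as agreement here; their probability is accounted for
  separately.\<close>

definition env_err :: "nat \<Rightarrow> nat \<Rightarrow> nat \<Rightarrow> ((nat \<Rightarrow> bool) \<Rightarrow> bool) \<Rightarrow> (nat \<Rightarrow> nat) \<Rightarrow> ((nat \<Rightarrow> bool) \<Rightarrow> bool) \<Rightarrow> real" where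
  "env_err n m l g \<rho> h =
     avg n (\<lambda>u. of_bool (feasible n m l u \<and> g (perm_vec \<rho> (spread m l u)) \<noteq> h u))"

abbreviation core_inf where
  "core_inf n m l K g \<rho> \<pi> \<equiv> sym_inf n (class_union m l \<rho> (inv \<pi> ` K)) g"

abbreviation hyp_err where
  "hyp_err n m l f g \<rho> \<pi> \<equiv> env_err n m l g \<rho> (\<lambda>u. f (perm_vec \<pi> u))"

abbreviation misled where
  "misled n m l f H g \<rho> e us \<equiv> \<exists>\<pi>\<in>survivors n m l f H g \<rho> us. e < hyp_err n m l f g \<rho> \<pi>"

lemma costs_tester:
  assumes mn: "m * l \<le> n"
  shows "costs n (q + 2 * N) (tester n m l f K H q N)"
  unfolding tester_def
proof (intro costs_bind_set)
  fix \<rho> us assume "\<rho> \<in> perms {..<n}" and us: "us \<in> samples n q"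
  then have "query_pt n m l \<rho> u \<in> cube n" for u
    using spread_cube_wt(1)[OF _ mn] by (auto simp: query_pt_def perm_vec_in_cube) (simp add: cube_def)
  then have "set (map (query_pt n m l \<rho>) us) \<subseteq> cube n" by auto
  from costs_ask[OF this, of "2 * N"]
  show "costs n (q + 2 * N) (ask (map (query_pt n m l \<rho>) us) (\<lambda>a.
         if consistent n m l f H us a = {} then return_pmf (Leaf False)
         else verify n (class_union m l \<rho> (inv (SOME \<pi>. \<pi> \<in> consistent n m l f H us a) ` K)) N))"
    using us by (simp add: samples_def costs_Leaf costs_verify)
qed auto

text \<open>A candidate with error above \<open>e\<close> survives one sample with probability at
  most 1 - e. The union bound runs over \<open>H\<close>.\<close>

lemma misleading_samples:
  assumes H: "finite H" and e: "e \<le> 1"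
  shows "mean (samples n q) (\<lambda>us. of_bool (misled n m l f H g \<rho> e us)) \<le> real (card H) * (1 - e) ^ q"
proof -
  define bad where "bad = {\<pi>\<in>H. e < hyp_err n m l f g \<rho> \<pi>}"
  define ok where "ok = (\<lambda>\<pi> u. \<not> (feasible n m l u \<and> g (perm_vec \<rho> (spread m l u)) \<noteq> f (perm_vec \<pi> u)))"
  have bad: "finite bad" "card bad \<le> card H" using H by (auto simp: bad_def intro: card_mono)
  have "mean (samples n q) (\<lambda>us. of_bool (misled n m l f H g \<rho> e us))
    \<le> mean (samples n q) (\<lambda>us. \<Sum>\<pi>\<in>bad. of_bool (\<forall>u\<in>set us. ok \<pi> u))"
  proof (intro mean_mono)
    fix us
    show "of_bool (misled n m l f H g \<rho> e us) \<le> (\<Sum>\<pi>\<in>bad. of_bool (\<forall>u\<in>set us. ok \<pi> u) :: real)"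
    proof (cases "misled n m l f H g \<rho> e us")
      case True
      then obtain \<pi> where \<pi>: "\<pi> \<in> bad" "\<pi> \<in> survivors n m l f H g \<rho> us"
        by (auto simp: bad_def consistent_def)
      then have "\<forall>u\<in>set us. ok \<pi> u"
        by (auto simp: consistent_def ok_def query_pt_def in_set_conv_nth)
      then show ?thesis
        using member_le_sum[of \<pi> bad "\<lambda>\<pi>. of_bool (\<forall>u\<in>set us. ok \<pi> u) :: real"] \<pi>(1) bad(1) True by simp
    qed (auto intro: sum_nonneg)
  qed
  also have "... = (\<Sum>\<pi>\<in>bad. avg n (\<lambda>u. of_bool (ok \<pi> u)) ^ q)"
    by (simp only: mean_sum mean_samples_all)
  also have "... \<le> (\<Sum>\<pi>\<in>bad. (1 - e) ^ q)"
  proof (intro sum_mono power_mono)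
    fix \<pi> assume "\<pi> \<in> bad"
    then have "e < hyp_err n m l f g \<rho> \<pi>" by (simp add: bad_def)
    then show "avg n (\<lambda>u. of_bool (ok \<pi> u)) \<le> 1 - e"
      unfolding ok_def env_err_def by (subst mean_of_bool_not) auto
    show "0 \<le> avg n (\<lambda>u. of_bool (ok \<pi> u))" by (intro mean_nonneg) auto
  qed
  also have "... \<le> real (card H) * (1 - e) ^ q"
    using bad e by (simp add: mult_right_mono)
  finally show ?thesis .
qed

text \<open>The copy given by \<open>\<sigma>\<close> depends only on \<open>inv \<sigma>\<close>
  restricted to \<open>K\<close>, so one representative for each of the at most m^k maps from
  \<open>K\<close> to the class indices suffices.\<close>

lemma hypotheses_exist:
  assumes K: "K \<subseteq> {..<n}" "card K \<le> k" and m: "0 < m"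
  shows "\<exists>H. finite H \<and> card H \<le> m ^ k \<and> (\<forall>\<pi>\<in>H. \<pi> permutes {..<n} \<and> inv \<pi> ` K \<subseteq> {..<m}) \<and>
    (\<forall>\<sigma>. \<sigma> permutes {..<n} \<longrightarrow> inv \<sigma> ` K \<subseteq> {..<m} \<longrightarrow> (\<exists>\<pi>\<in>H. \<forall>i\<in>K. inv \<pi> i = inv \<sigma> i))"
proof -
  have finK: "finite K" using K finite_subset by auto
  define A where "A = {\<sigma>. \<sigma> permutes {..<n} \<and> inv \<sigma> ` K \<subseteq> {..<m}}"
  define r where "r = (\<lambda>\<sigma> :: nat \<Rightarrow> nat. restrict (inv \<sigma>) K)"
  define rep where "rep = (\<lambda>\<tau>. SOME \<sigma>. \<sigma> \<in> A \<and> r \<sigma> = \<tau>)"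
  define H where "H = rep ` (r ` A)"
  have sub: "r ` A \<subseteq> K \<rightarrow>\<^sub>E {..<m}" by (auto simp: r_def A_def)
  have fin: "finite (K \<rightarrow>\<^sub>E {..<m})" using finK by (intro finite_PiE) auto
  have rep: "rep \<tau> \<in> A \<and> r (rep \<tau>) = \<tau>" if "\<tau> \<in> r ` A" for \<tau>
  proof -
    have "\<exists>\<sigma>. \<sigma> \<in> A \<and> r \<sigma> = \<tau>" using that by auto
    then show ?thesis unfolding rep_def by (rule someI_ex)
  qed
  have "card H \<le> card (K \<rightarrow>\<^sub>E {..<m})"
    unfolding H_def using sub fin by (meson card_image_le card_mono finite_subset order_trans)
  also have "... = m ^ card K" using finK by (simp add: card_PiE)
  also have "... \<le> m ^ k" using K m by (intro power_increasing) auto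
  finally have "card H \<le> m ^ k" .
  moreover have "finite H" unfolding H_def using sub fin finite_subset by blast
  moreover have "\<pi> permutes {..<n} \<and> inv \<pi> ` K \<subseteq> {..<m}" if "\<pi> \<in> H" for \<pi>
    using that rep unfolding H_def A_def by blast
  moreover have "\<exists>\<pi>\<in>H. \<forall>i\<in>K. inv \<pi> i = inv \<sigma> i" if "\<sigma> permutes {..<n}" "inv \<sigma> ` K \<subseteq> {..<m}" for \<sigma>
  proof (intro bexI ballI)
    have \<sigma>: "r \<sigma> \<in> r ` A" using that by (auto simp: A_def)
    show "rep (r \<sigma>) \<in> H" using \<sigma> by (simp add: H_def)
    show "inv (rep (r \<sigma>)) i = inv \<sigma> i" if "i \<in> K" for i
      using rep[OF \<sigma>] that unfolding r_def by (metis restrict_apply')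
  qed
  ultimately show ?thesis by blast
qed

lemma core_dep_eq_perm_vec:
  assumes "core_dep n K f" "\<pi> permutes {..<n}" "\<sigma> permutes {..<n}" "\<And>i. i \<in> K \<Longrightarrow> inv \<pi> i = inv \<sigma> i" "x \<in> cube n"
  shows "f (perm_vec \<pi> x) = f (perm_vec \<sigma> x)"
  using assms by (intro core_depD[OF assms(1)])
    (simp_all add: perm_vec_in_cube wt_perm_vec permutes_bij, simp add: perm_vec_def)

lemma sym_inf_nonneg: "0 \<le> sym_inf n V g"
  unfolding sym_inf_def by (intro mean_nonneg) auto

lemma sym_inf_le_1: "sym_inf n V g \<le> 1"
  unfolding sym_inf_def by (intro mean_le_const mean_of_bool_le_1) auto

section \<open>Acceptance probability, soundness and completeness\<close>

definition pass_prob ::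
  "nat \<Rightarrow> nat \<Rightarrow> nat \<Rightarrow> ((nat \<Rightarrow> bool) \<Rightarrow> bool) \<Rightarrow> nat set \<Rightarrow> (nat \<Rightarrow> nat) set \<Rightarrow> nat \<Rightarrow>
    ((nat \<Rightarrow> bool) \<Rightarrow> bool) \<Rightarrow> (nat \<Rightarrow> nat) \<Rightarrow> (nat \<Rightarrow> bool) list \<Rightarrow> real" where
  "pass_prob n m l f K H N g \<rho> us =
     (let S = survivors n m l f H g \<rho> us in
      if S = {} then 0 else (1 - sym_inf n (class_union m l \<rho> (inv (SOME \<pi>. \<pi> \<in> S) ` K)) g) ^ N)"

lemma acc_prob_tester:
  "acc_prob (tester n m l f K H q N) g =
     avg_perm n (\<lambda>\<rho>. mean (samples n q) (pass_prob n m l f K H N g \<rho>))"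
  unfolding tester_def pass_prob_def Let_def
  by (simp add: acc_prob_bind_set acc_prob_ask if_distrib[of "\<lambda>T. acc_prob T g"] acc_prob_verify del: ask.simps cong: if_cong)

lemma pass_prob_bounds: "0 \<le> pass_prob n m l f K H N g \<rho> us" "pass_prob n m l f K H N g \<rho> us \<le> 1"
  using sym_inf_nonneg sym_inf_le_1 by (auto simp: pass_prob_def Let_def intro!: power_le_one)

text \<open>For a partition without a candidate that is both accurate and nearly symmetric,
  acceptance needs misleading samples or a lucky symmetry check, each of probability at most 1/100;
  and 1/3 - 2/100 exceeds 3/10. The alternative \<open>1 \<le> \<delta>\<close> serves testers
  without symmetry checks, as influences are at most 1.\<close>

lemma tester_sound:
  assumes H: "finite H" and e: "e \<le> 1" "real (card H) * (1 - e) ^ q \<le> 1/100"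
    and N: "1 \<le> \<delta> \<or> (\<delta> \<le> 1 \<and> (1 - \<delta>) ^ N \<le> 1/100)"
    and acc: "1/3 < acc_prob (tester n m l f K H q N) g"
  shows "3/10 \<le> avg_perm n (\<lambda>\<rho>. of_bool (\<exists>\<pi>\<in>H.
      hyp_err n m l f g \<rho> \<pi> \<le> e \<and> core_inf n m l K g \<rho> \<pi> \<le> \<delta>))"
proof -
  define good where "good = (\<lambda>\<rho>. \<exists>\<pi>\<in>H.
      hyp_err n m l f g \<rho> \<pi> \<le> e \<and> core_inf n m l K g \<rho> \<pi> \<le> \<delta>)"
  have "mean (samples n q) (pass_prob n m l f K H N g \<rho>) \<le> of_bool (good \<rho>) + 2/100" for \<rho>
  proof (cases "good \<rho>")
    case True
    have "mean (samples n q) (pass_prob n m l f K H N g \<rho>) \<le> 1"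
      by (intro mean_le_const pass_prob_bounds) auto
    then show ?thesis using True by simp
  next
    case False
    let ?bad = "misled n m l f H g \<rho> e"
    have "mean (samples n q) (pass_prob n m l f K H N g \<rho>) \<le> mean (samples n q) (\<lambda>us. of_bool (?bad us) + 1/100)"
    proof (intro mean_mono)
      fix us
      define S where "S = survivors n m l f H g \<rho> us"
      define \<pi> where "\<pi> = (SOME \<pi>. \<pi> \<in> S)"
      define s where "s = core_inf n m l K g \<rho> \<pi>"
      have pp: "pass_prob n m l f K H N g \<rho> us = (if S = {} then 0 else (1 - s) ^ N)"
        by (simp only: pass_prob_def Let_def S_def \<pi>_def s_def)
      show "pass_prob n m l f K H N g \<rho> us \<le> of_bool (?bad us) + 1/100"
      proof (cases "S = {} \<or> ?bad us")
        case True
        then show ?thesis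
        proof
          assume "S = {}"
          then show ?thesis by (simp add: pp)
        next
          assume "?bad us"
          then have "of_bool (?bad us) = (1 :: real)" by (simp only: of_bool_eq)
          then show ?thesis using pass_prob_bounds(2)[of n m l f K H N g \<rho> us] by linarith
        qed
      next
        case F: False
        then have \<pi>: "\<pi> \<in> S" unfolding \<pi>_def by (simp add: some_in_eq)
        then have "hyp_err n m l f g \<rho> \<pi> \<le> e" "\<pi> \<in> H"
          using F by (auto simp: S_def consistent_def not_less)
        then have s: "\<delta> < s" using False unfolding good_def s_def by force
        then have "\<delta> < 1" using sym_inf_le_1[of n "class_union m l \<rho> (inv \<pi> ` K)" g] by (simp add: s_def)
        then have "(1 - s) ^ N \<le> (1 - \<delta>) ^ N"
          using s sym_inf_le_1[of n "class_union m l \<rho> (inv \<pi> ` K)" g] by (intro power_mono) (auto simp: s_def)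
        then have "(1 - s) ^ N \<le> 1/100" using N \<open>\<delta> < 1\<close> by auto
        moreover have "0 \<le> (of_bool (?bad us) :: real)" by simp
        moreover have "pass_prob n m l f K H N g \<rho> us = (1 - s) ^ N" using F by (simp only: pp) simp
        ultimately show ?thesis by linarith
      qed
    qed
    also have "... \<le> 1/100 + 1/100"
      using misleading_samples[OF H e(1), of n q m l f g \<rho>] e(2) by (simp add: mean_add mean_const)
    finally show ?thesis using False by simp
  qed
  then have "acc_prob (tester n m l f K H q N) g \<le> avg_perm n (\<lambda>\<rho>. of_bool (good \<rho>) + 2/100)"
    unfolding acc_prob_tester by (intro mean_mono)
  then show ?thesis using acc unfolding good_def by (simp add: mean_add mean_const)
qed

lemma iso_core_dep:
  assumes f: "core_dep n K f" and \<sigma>: "\<sigma> permutes {..<n}" and g: "\<And>x. x \<in> cube n \<Longrightarrow> g x = f (perm_vec \<sigma> x)"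
  shows "core_dep n (inv \<sigma> ` K) g"
  unfolding core_dep_def
proof (intro ballI impI)
  fix x z assume xz: "x \<in> cube n" "z \<in> cube n" "\<forall>i\<in>inv \<sigma> ` K. x i = z i" "wt x = wt z"
  have "f (perm_vec \<sigma> x) = f (perm_vec \<sigma> z)"
    by (rule core_depD[OF core_dep_perm_vec[OF f \<sigma>]]) (use xz in blast)+
  then show "g x = g z" using g xz by simp
qed

text \<open>When the core of \<open>g\<close> is separated, the true placement survives every
  sample. An accurate survivor then gives a function close to \<open>g\<close> that is symmetric
  outside the chosen classes, so the symmetry check passes with high probability.\<close>

lemma tester_complete:
  assumes mn: "m * l \<le> n" and l: "0 < l" and f: "core_dep n K f" and K: "K \<subseteq> {..<n}"
    and H: "finite H" "\<And>\<pi>. \<pi> \<in> H \<Longrightarrow> \<pi> permutes {..<n} \<and> inv \<pi> ` K \<subseteq> {..<m}"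
      "\<And>\<sigma>. \<sigma> permutes {..<n} \<Longrightarrow> inv \<sigma> ` K \<subseteq> {..<m} \<Longrightarrow> \<exists>\<pi>\<in>H. \<forall>i\<in>K. inv \<pi> i = inv \<sigma> i"
    and e: "e \<le> 1" "real (card H) * (1 - e) ^ q \<le> 1/100"
    and \<eta>: "avg n (\<lambda>u. of_bool (\<not> feasible n m l u)) \<le> \<eta>"
    and N: "real N * (2 * (e + \<eta>)) \<le> 1/10"
    and sep: "\<And>C. C \<subseteq> {..<n} \<Longrightarrow> card C \<le> card K \<Longrightarrow> avg_perm n (\<lambda>\<rho>. of_bool (\<not> separates m l C \<rho>)) \<le> 1/10"
    and g: "isomorphic n g f"
  shows "2/3 \<le> acc_prob (tester n m l f K H q N) g"
proof -
  obtain \<sigma> where \<sigma>: "\<sigma> permutes {..<n}" "\<And>x. x \<in> cube n \<Longrightarrow> g x = f (perm_vec \<sigma> x)"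
    using g unfolding isomorphic_def by blast
  define C where "C = inv \<sigma> ` K"
  have gC: "core_dep n C g" unfolding C_def by (rule iso_core_dep[OF f \<sigma>])
  have finK: "finite K" using K finite_subset by auto
  have C: "C \<subseteq> {..<n}" "card C \<le> card K"
  proof -
    have "inv \<sigma> ` K \<subseteq> inv \<sigma> ` {..<n}" using K by (rule image_mono)
    then show "C \<subseteq> {..<n}" by (simp add: C_def permutes_image[OF permutes_inv[OF \<sigma>(1)]])
    show "card C \<le> card K" unfolding C_def using finK by (rule card_image_le)
  qed
  have lower: "8/10 * of_bool (separates m l C \<rho>) \<le> mean (samples n q) (pass_prob n m l f K H N g \<rho>)"
    if \<rho>: "\<rho> permutes {..<n}" for \<rho>
  proof (cases "separates m l C \<rho>")
    case False
    then show ?thesis by (auto intro!: mean_nonneg pass_prob_bounds)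
  next
    case True
    obtain \<zeta> where \<zeta>: "\<zeta> permutes {..<n}" "inv \<zeta> ` C \<subseteq> {..<m}"
      "\<And>u. u \<in> cube n \<Longrightarrow> feasible n m l u \<Longrightarrow> g (perm_vec \<rho> (spread m l u)) = g (perm_vec \<zeta> u)"
      "\<And>T. T \<subseteq> {..<m} \<Longrightarrow> \<zeta> ` T \<subseteq> class_union m l \<rho> T"
      using unscramble[OF gC \<rho> True mn l] by auto
    have \<sigma>\<zeta>: "\<sigma> \<circ> \<zeta> permutes {..<n}" using \<zeta>(1) \<sigma>(1) by (rule permutes_compose)
    have "inv (\<sigma> \<circ> \<zeta>) = inv \<zeta> \<circ> inv \<sigma>"
      using \<zeta>(1) \<sigma>(1) by (simp add: o_inv_distrib permutes_bij)
    then have "inv (\<sigma> \<circ> \<zeta>) ` K \<subseteq> {..<m}" using \<zeta>(2) by (simp add: C_def image_comp)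
    \<comment> \<open>The candidate with the true placement of the core.\<close>
    then obtain \<pi>0 where \<pi>0: "\<pi>0 \<in> H" "\<And>i. i \<in> K \<Longrightarrow> inv \<pi>0 i = inv (\<sigma> \<circ> \<zeta>) i"
      using H(3)[OF \<sigma>\<zeta>] by auto
    have true_hyp: "g (perm_vec \<zeta> u) = f (perm_vec \<pi>0 u)" if "u \<in> cube n" for u
    proof -
      have "g (perm_vec \<zeta> u) = f (perm_vec (\<sigma> \<circ> \<zeta>) u)"
        using that \<zeta>(1) \<sigma> by (simp add: perm_vec_in_cube perm_vec_comp permutes_bij)
      then show ?thesis
        using core_dep_eq_perm_vec[OF f _ \<sigma>\<zeta> \<pi>0(2) that] H(2)[OF \<pi>0(1)] by simp
    qed
    let ?bad = "misled n m l f H g \<rho> e"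
    have "mean (samples n q) (\<lambda>us. 9/10 - 9/10 * of_bool (?bad us)) \<le> mean (samples n q) (pass_prob n m l f K H N g \<rho>)"
    proof (intro mean_mono)
      fix us assume us: "us \<in> samples n q"
      define S where "S = survivors n m l f H g \<rho> us"
      define \<pi> where "\<pi> = (SOME \<pi>. \<pi> \<in> S)"
      have "\<pi>0 \<in> S"
      proof -
        have "us ! i \<in> cube n" if "i < length us" for i
          using us that by (auto simp: samples_def)
        then show ?thesis
          using \<pi>0(1) true_hyp \<zeta>(3) by (auto simp: S_def consistent_def query_pt_def)
      qed
      then have \<pi>: "\<pi> \<in> S" unfolding \<pi>_def by (auto simp: some_in_eq)
      show "9/10 - 9/10 * of_bool (?bad us) \<le> pass_prob n m l f K H N g \<rho> us"
      proof (cases "?bad us")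
        case True
        then show ?thesis using pass_prob_bounds(1) by simp
      next
        case False
        then have err: "hyp_err n m l f g \<rho> \<pi> \<le> e" and \<pi>H: "\<pi> \<in> H"
          using \<pi> by (auto simp: S_def consistent_def not_less)
        note \<pi>p = H(2)[OF \<pi>H]
        \<comment> \<open>Pulled back along \<open>\<zeta>\<close>, the survivor has its core inside
          the chosen classes and distance at most \<open>e + \<eta>\<close> from
          \<open>g\<close>.\<close>
        define h where "h = (\<lambda>x. f (perm_vec \<pi> (perm_vec (inv \<zeta>) x)))"
        have "core_dep n (inv \<pi> ` K) (\<lambda>x. f (perm_vec \<pi> x))"
          by (rule core_dep_perm_vec[OF f conjunct1[OF \<pi>p]])
        then have "core_dep n (inv (inv \<zeta>) ` inv \<pi> ` K) h"
          unfolding h_def by (rule core_dep_perm_vec[OF _ permutes_inv[OF \<zeta>(1)]])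
        then have "core_dep n (\<zeta> ` inv \<pi> ` K) h"
          unfolding permutes_inv_inv[OF \<zeta>(1)] .
        then have hV: "core_dep n (class_union m l \<rho> (inv \<pi> ` K)) h"
          by (rule core_dep_mono) (rule \<zeta>(4)[OF conjunct2[OF \<pi>p]])
        have "bdist n g h = avg n (\<lambda>u. of_bool (g (perm_vec \<zeta> u) \<noteq> f (perm_vec \<pi> u)))"
          unfolding h_def by (rule bdist_perm_vec[OF \<zeta>(1)])
        also have "... \<le> avg n (\<lambda>u. of_bool (\<not> feasible n m l u)
            + of_bool (feasible n m l u \<and> g (perm_vec \<rho> (spread m l u)) \<noteq> f (perm_vec \<pi> u)))"
          using \<zeta>(3) by (intro mean_mono) auto
        also have "... \<le> e + \<eta>" using err \<eta> by (simp add: mean_add env_err_def)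
        finally have "2 * bdist n g h \<le> 2 * (e + \<eta>)" by simp
        then have s: "core_inf n m l K g \<rho> \<pi> \<le> 2 * (e + \<eta>)"
          by (rule order_trans[OF sym_inf_le_bdist[OF hV, of g]])
        define s where "s = core_inf n m l K g \<rho> \<pi>"
        have "real N * s \<le> real N * (2 * (e + \<eta>))" using s unfolding s_def by (intro mult_left_mono) auto
        moreover have "1 + real N * (- s) \<le> (1 + (- s)) ^ N"
          using sym_inf_le_1 by (intro Bernoulli_inequality) (auto simp: s_def)
        ultimately have "9/10 \<le> (1 - s) ^ N" using N by simp
        moreover have "pass_prob n m l f K H N g \<rho> us = (1 - s) ^ N"
        proof -
          have "S \<noteq> {}" using \<pi> by blast
          then have "(if S = {} then 0 else (1 - s) ^ N) = (1 - s) ^ N" by (rule if_not_P)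
          then show ?thesis by (simp only: pass_prob_def Let_def S_def \<pi>_def s_def)
        qed
        moreover have "0 \<le> (of_bool (?bad us) :: real)" by simp
        ultimately show ?thesis by linarith
      qed
    qed
    \<comment> \<open>Here 9/10 * 99/100 is at least 8/10; the factor 9/10 for separation then
      leaves 72/100 > 2/3.\<close>
    moreover have "mean (samples n q) (\<lambda>us. 9/10 - 9/10 * of_bool (?bad us)) \<ge> 9/10 - 9/10 * (1/100)"
      using order_trans[OF misleading_samples[OF H(1) e(1), of n q m l f g \<rho>] e(2)]
      by (simp only: mean_diff mean_cmult mean_const[OF finite_samples samples_nonempty])
    ultimately show ?thesis using True by simp
  qed
  have "8/10 * (9/10) \<le> 8/10 * avg_perm n (\<lambda>\<rho>. of_bool (separates m l C \<rho>))"
    using sep[OF C] by (simp add: mean_of_bool_not)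
  also have "... = avg_perm n (\<lambda>\<rho>. 8/10 * of_bool (separates m l C \<rho>))" by (simp only: mean_cmult)
  also have "... \<le> acc_prob (tester n m l f K H q N) g"
    unfolding acc_prob_tester by (rule mean_mono) (use lower in auto)
  finally show ?thesis by simp
qed

text \<open>Apart from separation failure and a Markov bound, each of probability at most 1/10, a
  random partition separates \<open>U\<close> and keeps the error of \<open>\<Gamma>\<close> on
  query points below \<open>10 * D\<close>. Hence some partition with a good candidate does both.
  There the candidate and \<open>\<Gamma>\<close> both approximate \<open>g\<close>, so a copy of
  \<open>f\<close> is close to \<open>\<Gamma>\<close>, and \<open>\<Gamma>\<close> is close to
  \<open>g\<close>.\<close>

lemma close_to_isomorphic:
  assumes k: "1 \<le> k" and l: "0 < l" and mn: "m * l \<le> n" and km: "100 * k\<^sup>2 \<le> m"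
    and \<delta>: "0 < \<delta>" "400 * \<delta> \<le> 1" and K: "K \<subseteq> {..<n}" "card K \<le> k"
    and H: "\<And>\<pi>. \<pi> \<in> H \<Longrightarrow> \<pi> permutes {..<n} \<and> inv \<pi> ` K \<subseteq> {..<m}"
    and \<eta>: "avg n (\<lambda>u. of_bool (\<not> feasible n m l u)) \<le> \<eta>"
    and sep: "\<And>C. C \<subseteq> {..<n} \<Longrightarrow> card C \<le> 2 * k \<Longrightarrow> avg_perm n (\<lambda>\<rho>. of_bool (\<not> separates m l C \<rho>)) \<le> 1/10"
    and good: "3/10 \<le> avg_perm n (\<lambda>\<rho>. of_bool (\<exists>\<pi>\<in>H.
      hyp_err n m l f g \<rho> \<pi> \<le> e \<and> core_inf n m l K g \<rho> \<pi> \<le> \<delta>))"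
  shows "\<exists>h. isomorphic n h f \<and> bdist n g h \<le> 11 * (401 * \<delta> + sqrt (2 * real k / real m)) + e + \<eta>"
proof -
  define good where "good = (\<lambda>\<rho> \<pi>.
      hyp_err n m l f g \<rho> \<pi> \<le> e \<and> core_inf n m l K g \<rho> \<pi> \<le> \<delta>)"
  define D where "D = 401 * \<delta> + sqrt (2 * real k / real m)"
  have D: "0 < D" using \<delta> by (simp add: D_def add_pos_nonneg)
  have finK: "finite K" using K finite_subset by auto
  have "3/10 \<le> avg_perm n
      (\<lambda>\<rho>. of_bool (\<exists>T\<subseteq>{..<m}. card T \<le> k \<and> sym_inf n (class_union m l \<rho> T) g \<le> \<delta>))"
  proof (rule order_trans[OF good], rule mean_mono)
    fix \<rho>
    have "card (inv \<pi> ` K) \<le> k" for \<pi> :: "nat \<Rightarrow> nat" using card_image_le[OF finK, of "inv \<pi>"] K by simp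
    then show "of_bool (\<exists>\<pi>\<in>H. hyp_err n m l f g \<rho> \<pi> \<le> e \<and> core_inf n m l K g \<rho> \<pi> \<le> \<delta>)
        \<le> (of_bool (\<exists>T\<subseteq>{..<m}. card T \<le> k \<and> sym_inf n (class_union m l \<rho> T) g \<le> \<delta>) :: real)"
      using H by (auto simp: of_bool_def)
  qed
  then obtain U \<Gamma> where U: "U \<subseteq> {..<n}" "card U < 2 * k" "core_dep n U \<Gamma>" "bdist n g \<Gamma> \<le> D"
    using core_exists[OF k l mn km \<delta>] unfolding D_def by blast
  define E where "E = (\<lambda>\<rho>. avg n (\<lambda>u. of_bool (feasible n m l u \<and>
      g (perm_vec \<rho> (spread m l u)) \<noteq> \<Gamma> (perm_vec \<rho> (spread m l u)))))"
  have "avg_perm n E \<le> bdist n g \<Gamma>"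
    unfolding E_def bdist_mean
    by (rule mean_scrambled_le[of n "feasible n m l" "spread m l" "\<lambda>x. g x \<noteq> \<Gamma> x"]) (use spread_cube_wt[OF _ mn] in auto)
  then have "avg_perm n E / (10 * D) \<le> 1/10"
    using U(4) D by (simp add: field_simps)
  moreover have "avg_perm n (\<lambda>\<rho>. of_bool (10 * D \<le> E \<rho>)) \<le> avg_perm n E / (10 * D)"
    using D by (intro mean_markov) (auto simp: E_def intro: mean_nonneg)
  ultimately have markov: "avg_perm n (\<lambda>\<rho>. of_bool (10 * D \<le> E \<rho>)) \<le> 1/10" by linarith
  have "\<exists>\<rho>\<in>perms {..<n}. (\<exists>\<pi>\<in>H. good \<rho> \<pi>) \<and> separates m l U \<rho> \<and> E \<rho> < 10 * D"
  proof (rule ccontr)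
    assume none: "\<not> ?thesis"
    have "3/10 \<le> avg_perm n (\<lambda>\<rho>. of_bool (\<exists>\<pi>\<in>H. good \<rho> \<pi>))"
      using good unfolding good_def .
    also have "... \<le> avg_perm n (\<lambda>\<rho>. of_bool (\<not> separates m l U \<rho>) + of_bool (10 * D \<le> E \<rho>))"
    proof (rule mean_mono)
      fix \<rho> assume "\<rho> \<in> perms {..<n}"
      then consider "\<not> (\<exists>\<pi>\<in>H. good \<rho> \<pi>)" | "\<not> separates m l U \<rho>" | "10 * D \<le> E \<rho>"
        using none by (meson not_less)
      then show "of_bool (\<exists>\<pi>\<in>H. good \<rho> \<pi>) \<le> of_bool (\<not> separates m l U \<rho>) + (of_bool (10 * D \<le> E \<rho>) :: real)"
        by cases auto
    qed
    also have "... \<le> 1/10 + 1/10"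
      unfolding mean_add using markov sep[OF U(1)] U(2) by (intro add_mono) auto
    finally show False by simp
  qed
  then obtain \<rho> \<pi> where \<rho>: "\<rho> permutes {..<n}" "separates m l U \<rho>" "E \<rho> < 10 * D"
    and \<pi>: "\<pi> \<in> H" "hyp_err n m l f g \<rho> \<pi> \<le> e"
    unfolding good_def by blast
  have \<pi>p: "\<pi> permutes {..<n}" using H[OF \<pi>(1)] by blast
  obtain \<zeta> where \<zeta>: "\<zeta> permutes {..<n}"
    "\<And>u. u \<in> cube n \<Longrightarrow> feasible n m l u \<Longrightarrow> \<Gamma> (perm_vec \<rho> (spread m l u)) = \<Gamma> (perm_vec \<zeta> u)"
    using unscramble[OF U(3) \<rho>(1,2) mn l] by blast
  define h where "h = (\<lambda>x. f (perm_vec \<pi> (perm_vec (inv \<zeta>) x)))"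
  have "isomorphic n h f" unfolding h_def by (rule isomorphic_comp[OF \<pi>p \<zeta>(1)])
  moreover have "bdist n g h \<le> 11 * D + e + \<eta>"
  proof -
    have "bdist n \<Gamma> h = avg n (\<lambda>u. of_bool (\<Gamma> (perm_vec \<zeta> u) \<noteq> f (perm_vec \<pi> u)))"
      unfolding h_def by (rule bdist_perm_vec[OF \<zeta>(1)])
    also have "... \<le> avg n (\<lambda>u. of_bool (\<not> feasible n m l u)
        + (of_bool (feasible n m l u \<and> g (perm_vec \<rho> (spread m l u)) \<noteq> \<Gamma> (perm_vec \<rho> (spread m l u)))
        + of_bool (feasible n m l u \<and> g (perm_vec \<rho> (spread m l u)) \<noteq> f (perm_vec \<pi> u))))"
      using \<zeta>(2) by (intro mean_mono) auto
    also have "... \<le> \<eta> + (10 * D + e)"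
      unfolding mean_add using \<eta> \<rho>(3) \<pi>(2) unfolding E_def env_err_def by (intro add_mono) auto
    finally show ?thesis using bdist_triangle[of n g h \<Gamma>] U(4) by linarith
  qed
  ultimately show ?thesis unfolding D_def by blast
qed

section \<open>Choice of the parameters\<close>

lemma power_one_minus_le:
  assumes "0 \<le> e" "e \<le> 1" "1 \<le> M" "(real k * ln M + 7) / e \<le> real q" "0 < e"
  shows "M ^ k * (1 - e) ^ q \<le> 1/100"
proof -
  have "(1 - e) ^ q \<le> exp (- e) ^ q"
    using assms exp_ge_add_one_self[of "- e"] by (intro power_mono) auto
  also have "... = exp (- (e * real q))" by (simp add: exp_of_nat_mult[symmetric] mult.commute)
  also have "... \<le> exp (- (real k * ln M + 7))"
    using assms by (simp add: field_simps)
  finally have "M ^ k * (1 - e) ^ q \<le> M ^ k * exp (- (real k * ln M + 7))"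
    using assms by (intro mult_left_mono) auto
  also have "... = exp (- 7)"
  proof -
    have "M ^ k = exp (real k * ln M)" using assms by (simp add: exp_of_nat_mult)
    then show ?thesis by (simp add: exp_add[symmetric])
  qed
  also have "... \<le> 1/100" using exp_7_ge by (simp add: exp_minus field_simps)
  finally show ?thesis .
qed

text \<open>Every coordinate forms its own class and the reservoir is empty, so query points are
  uniform, every sample is feasible, and comparison with all candidates suffices without symmetry
  checks. The maximum with 1 covers n = 0.\<close>

lemma tester_small:
  assumes \<epsilon>: "0 < e" "e < \<epsilon>" "e \<le> 1" and K: "K \<subseteq> {..<n}" "card K \<le> k" and f: "core_dep n K f"
    and q: "(real k * ln (max 1 (real n)) + 7) / e \<le> real q"
  shows "\<exists>T. costs n q T \<and> iso_tester n \<epsilon> f T"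
proof -
  obtain H where H: "finite H" "card H \<le> max 1 n ^ k" "\<And>\<pi>. \<pi> \<in> H \<Longrightarrow> \<pi> permutes {..<n}"
    "\<And>\<sigma>. \<sigma> permutes {..<n} \<Longrightarrow> inv \<sigma> ` K \<subseteq> {..<max 1 n} \<Longrightarrow> \<exists>\<pi>\<in>H. \<forall>i\<in>K. inv \<pi> i = inv \<sigma> i"
  proof -
    have "0 < max 1 n" by simp
    from hypotheses_exist[OF K this] show ?thesis using that by blast
  qed
  have feas: "feasible n n 1 u" and spr: "spread n 1 u = u" if u: "u \<in> cube n" for u
  proof -
    have "{j. j < n \<and> u j} = {j. u j}" using cube_support[OF u] by auto
    then have c: "count n u = wt u" by (simp add: count_def wt_def)
    then show "feasible n n 1 u" by (simp add: feasible_def)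
    show "spread n 1 u = u" using u c by (auto simp: spread_def cube_def fun_eq_iff not_less)
  qed
  have "real (card H) \<le> real (max 1 n ^ k)" using H(2) by (simp only: of_nat_le_iff)
  then have "real (card H) * (1 - e) ^ q \<le> max 1 (real n) ^ k * (1 - e) ^ q"
    using \<epsilon> by (intro mult_right_mono) (auto simp: of_nat_max)
  also have "... \<le> 1/100" using \<epsilon> q by (intro power_one_minus_le) auto
  finally have small: "real (card H) * (1 - e) ^ q \<le> 1/100" .
  define T where "T = tester n n 1 f K H q 0"
  have "costs n (q + 2 * 0) T" unfolding T_def by (rule costs_tester) simp
  moreover have "2/3 \<le> acc_prob T g" if g: "isomorphic n g f" for g
  proof -
    obtain \<sigma> where \<sigma>: "\<sigma> permutes {..<n}" "\<And>x. x \<in> cube n \<Longrightarrow> g x = f (perm_vec \<sigma> x)"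
      using g unfolding isomorphic_def by blast
    have "pass_prob n n 1 f K H 0 g \<rho> us = 1" if \<rho>: "\<rho> permutes {..<n}" and us: "us \<in> samples n q" for \<rho> us
    proof -
      have \<sigma>\<rho>: "\<sigma> \<circ> \<rho> permutes {..<n}" using \<rho> \<sigma>(1) by (rule permutes_compose)
      have "inv (\<sigma> \<circ> \<rho>) ` K \<subseteq> inv (\<sigma> \<circ> \<rho>) ` {..<n}" using K by (intro image_mono)
      also have "... = {..<n}" by (rule permutes_image[OF permutes_inv[OF \<sigma>\<rho>]])
      finally have "inv (\<sigma> \<circ> \<rho>) ` K \<subseteq> {..<max 1 n}" by auto
      from H(4)[OF \<sigma>\<rho> this] obtain \<pi> where \<pi>: "\<pi> \<in> H" "\<And>i. i \<in> K \<Longrightarrow> inv \<pi> i = inv (\<sigma> \<circ> \<rho>) i"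
        by blast
      have "g (perm_vec \<rho> u) = f (perm_vec \<pi> u)" if u: "u \<in> cube n" for u
      proof -
        have "g (perm_vec \<rho> u) = f (perm_vec (\<sigma> \<circ> \<rho>) u)"
          using u \<rho> \<sigma> by (simp add: perm_vec_in_cube perm_vec_comp permutes_bij)
        then show ?thesis using core_dep_eq_perm_vec[OF f H(3)[OF \<pi>(1)] \<sigma>\<rho> \<pi>(2) u] by simp
      qed
      moreover have "us ! i \<in> cube n" if "i < length us" for i
        using us that by (auto simp: samples_def)
      ultimately have "\<pi> \<in> survivors n n 1 f H g \<rho> us"
        using \<pi>(1) feas spr by (auto simp: consistent_def query_pt_def)
      then have "survivors n n 1 f H g \<rho> us \<noteq> {}" by blast
      then show ?thesis by (simp only: pass_prob_def Let_def power_0 if_False)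
    qed
    then have "acc_prob T g = avg_perm n (\<lambda>\<rho>. mean (samples n q) (\<lambda>us. 1))"
      unfolding T_def acc_prob_tester by (intro mean_cong) auto
    then show ?thesis by (simp add: mean_const)
  qed
  moreover have "2/3 \<le> 1 - acc_prob T g" if far: "far_from_iso n \<epsilon> g f" for g
  proof (rule ccontr)
    assume "\<not> ?thesis"
    then have "1/3 < acc_prob T g" by simp
    then have good: "3/10 \<le> avg_perm n (\<lambda>\<rho>. of_bool (\<exists>\<pi>\<in>H.
        hyp_err n n 1 f g \<rho> \<pi> \<le> e \<and> core_inf n n 1 K g \<rho> \<pi> \<le> 1))"
      unfolding T_def using \<epsilon> by (intro tester_sound[OF H(1) _ small, where N = 0]) auto
    have "\<exists>\<rho>\<in>perms {..<n}. \<exists>\<pi>\<in>H. hyp_err n n 1 f g \<rho> \<pi> \<le> e"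
    proof (rule ccontr)
      assume "\<not> ?thesis"
      then have "avg_perm n (\<lambda>\<rho>. of_bool (\<exists>\<pi>\<in>H.
        hyp_err n n 1 f g \<rho> \<pi> \<le> e \<and> core_inf n n 1 K g \<rho> \<pi> \<le> 1))
        = avg_perm n (\<lambda>\<rho>. 0)"
        by (intro mean_cong) auto
      then show False using good by (simp add: mean_const)
    qed
    then obtain \<rho> \<pi> where \<rho>: "\<rho> permutes {..<n}" and \<pi>: "\<pi> \<in> H"
      and err: "hyp_err n n 1 f g \<rho> \<pi> \<le> e" by auto
    note \<pi>p = H(3)[OF \<pi>]
    define h where "h = (\<lambda>x. f (perm_vec \<pi> (perm_vec (inv \<rho>) x)))"
    have "isomorphic n h f" unfolding h_def by (rule isomorphic_comp[OF \<pi>p \<rho>])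
    moreover have "bdist n g h = hyp_err n n 1 f g \<rho> \<pi>"
    proof -
      have "bdist n g h = avg n (\<lambda>u. of_bool (g (perm_vec \<rho> u) \<noteq> f (perm_vec \<pi> u)))"
        unfolding h_def by (rule bdist_perm_vec[OF \<rho>])
      also have "... = hyp_err n n 1 f g \<rho> \<pi>"
        unfolding env_err_def using feas spr
        by (intro mean_cong) auto
      finally show ?thesis .
    qed
    ultimately show False using far err \<epsilon> unfolding far_from_iso_def by force
  qed
  ultimately show ?thesis unfolding iso_tester_def by auto
qed

text \<open>The largest lower bound on \<open>m\<close> is needed to make infeasible samples rarer than \<open>\<epsilon> / (6 * 10\<^sup>6)\<close>,
  a fraction of the reciprocal of the number \<open>N\<close> of symmetry checks.\<close>

lemma tester_large:
  fixes \<epsilon> :: real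
  defines "e \<equiv> \<epsilon> / 6000000" and "\<delta> \<equiv> \<epsilon> / 20000"
  assumes \<epsilon>: "0 < \<epsilon>" "\<epsilon> \<le> 1" and k: "1 \<le> k" and K: "K \<subseteq> {..<n}" "card K \<le> k" and f: "core_dep n K f"
    and m: "10 ^ 12 * (real k)\<^sup>2 / \<epsilon>\<^sup>2 \<le> real m" and n: "80 * k * m \<le> n"
    and q: "(real k * ln (real m) + 7) / e \<le> real q"
    and N: "140000 / \<epsilon> \<le> real N" "real N \<le> 140001 / \<epsilon>"
  shows "\<exists>T. costs n (q + 2 * N) T \<and> iso_tester n \<epsilon> f T"
proof -
  have e: "0 < e" "e \<le> 1" and \<delta>: "0 < \<delta>" "400 * \<delta> \<le> 1" using \<epsilon> by (auto simp: e_def \<delta>_def)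
  have mk: "10 ^ 12 * (real k)\<^sup>2 \<le> real m * \<epsilon>\<^sup>2" using m \<epsilon> by (simp add: field_simps)
  moreover have "real m * \<epsilon>\<^sup>2 \<le> real m * 1" using \<epsilon> by (intro mult_left_mono) (auto simp: power_le_one)
  ultimately have mk': "10 ^ 12 * (real k)\<^sup>2 \<le> real m" by linarith
  have k2: "1 \<le> real k" "real k \<le> (real k)\<^sup>2" using k by (auto simp: power2_eq_square)
  have m0: "0 < m" using mk' k2 by (cases m) auto
  have km: "100 * k\<^sup>2 \<le> m"
  proof -
    have "real (100 * k\<^sup>2) \<le> real m" using mk' zero_le_power2[of "real k"] by simp
    then show ?thesis by (simp only: of_nat_le_iff)
  qed
  \<comment> \<open>The reservoir gets between \<open>a\<close> and \<open>2 * a\<close>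
    coordinates: large enough to restore weights, yet at most n / (40 k), so that it misses a core
    of size \<open>2 * k\<close> with probability at least 19/20.\<close>
  define a where "a = n div (80 * k)"
  define l where "l = (n - a) div m"
  have a: "m \<le> a" "80 * k * a \<le> n" "n < 80 * k * (a + 1)"
  proof -
    have "m * (80 * k) \<le> n" using n by (simp add: mult.commute mult.left_commute)
    then show "m \<le> a" unfolding a_def using k by (simp add: less_eq_div_iff_mult_less_eq)
    show "80 * k * a \<le> n" unfolding a_def by simp
    show "n < 80 * k * (a + 1)" unfolding a_def using k by (metis add.commute dividend_less_times_div less_eq_Suc_le One_nat_def mult_is_0 mult_Suc_right plus_1_eq_Suc neq0_conv nat_less_le zero_neq_numeral not_one_le_zero)
  qed
  have "80 * a * 1 \<le> 80 * a * k" using k by (intro mult_le_mono2)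
  moreover have "80 * a * k = 80 * k * a" by simp
  ultimately have a80: "80 * a \<le> n" using a(2) by linarith
  have lm: "l * m \<le> n - a" "n - a < l * m + m"
    unfolding l_def using m0 by (auto simp: dividend_less_div_times add.commute)
  have mn: "m * l \<le> n" using lm by (simp add: mult.commute)
  have w: "a \<le> n - m * l" "n - m * l \<le> 2 * a" using lm a(1) a80 by (simp_all add: mult.commute)
  have l: "0 < l"
  proof (rule ccontr)
    assume "\<not> 0 < l"
    then have "n - a < m" using lm by simp
    then show False using a(1) a80 m0 by linarith
  qed
  have n0: "0 < n" using a80 a(1) m0 by linarith
  have ln: "real m * real l \<le> real n" using mn by (metis of_nat_le_iff of_nat_mult)
  have eta: "avg n (\<lambda>u. of_bool (\<not> feasible n m l u)) \<le> e"
  proof -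
    have "m * l < n" using w a(1) m0 by linarith
    then have "avg n (\<lambda>u. of_bool (\<not> feasible n m l u))
       \<le> (real m * (real l)\<^sup>2 + real n) / (real (n - m * l))\<^sup>2"
      by (rule mean_not_feasible[OF _ l])
    also have "... \<le> ((real n)\<^sup>2 / real m + real n) / (real a)\<^sup>2"
    proof (rule frac_le)
      have "(real m * real l)\<^sup>2 \<le> (real n)\<^sup>2" using ln by (intro power_mono) auto
      then have "real m * (real l)\<^sup>2 \<le> (real n)\<^sup>2 / real m" using m0 by (simp add: field_simps power2_eq_square)
      then show "real m * (real l)\<^sup>2 + real n \<le> (real n)\<^sup>2 / real m + real n" by simp
      have "real a \<le> real (n - m * l)" using w(1) by (simp only: of_nat_le_iff)
      then show "(real a)\<^sup>2 \<le> (real (n - m * l))\<^sup>2" by (intro power_mono) auto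
      show "0 < (real a)\<^sup>2" using a(1) m0 by simp
    qed simp
    also have "... \<le> ((160 * real k * real a)\<^sup>2 / real m + 160 * real k * real a) / (real a)\<^sup>2"
    proof -
      have "n \<le> 160 * k * a"
      proof -
        have "80 * k * (a + 1) \<le> 80 * k * (2 * a)" using a(1) m0 by (intro mult_le_mono2) linarith
        also have "80 * k * (2 * a) = 160 * k * a" by simp
        finally show ?thesis using a(3) by linarith
      qed
      then have "real n \<le> real (160 * k * a)" by (simp only: of_nat_le_iff)
      then have na: "real n \<le> 160 * real k * real a" by simp
      then show ?thesis by (intro divide_right_mono add_mono power_mono) auto
    qed
    also have "... = 25600 * (real k)\<^sup>2 / real m + 160 * real k / real a"
      using a(1) m0 by (simp add: field_simps power2_eq_square)
    also have "... \<le> 25600 * (real k)\<^sup>2 / real m + 160 * (real k)\<^sup>2 / real m"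
      using a(1) m0 k2 by (intro add_left_mono frac_le) auto
    also have "... = 25760 * ((real k)\<^sup>2 / real m)" by simp
    also have "... \<le> 25760 * (\<epsilon>\<^sup>2 / 10 ^ 12)"
      using mk m0 by (intro mult_left_mono) (auto simp: field_simps)
    also have "... \<le> e"
    proof -
      have "\<epsilon>\<^sup>2 \<le> \<epsilon>" using \<epsilon> by (simp add: power2_eq_square mult_left_le)
      then show ?thesis using \<epsilon> by (simp add: e_def)
    qed
    finally show ?thesis .
  qed
  have sep: "avg_perm n (\<lambda>\<rho>. of_bool (\<not> separates m l C \<rho>)) \<le> 1/10"
    if C: "C \<subseteq> {..<n}" "card C \<le> 2 * k" for C
  proof -
    have cC: "real (card C) \<le> 2 * real k" using C(2) by linarith
    have "real (card C) * (real (n - m * l) / real n) \<le> (2 * real k) * (1 / (40 * real k))"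
    proof (intro mult_mono cC)
      have "40 * k * (n - m * l) \<le> 40 * k * (2 * a)" using w(2) by (intro mult_le_mono2)
      also have "... \<le> n" using a(2) by simp
      finally have "real (40 * k * (n - m * l)) \<le> real n" by (simp only: of_nat_le_iff)
      then have "40 * real k * real (n - m * l) \<le> real n" by (simp only: of_nat_mult of_nat_numeral)
      then show "real (n - m * l) / real n \<le> 1 / (40 * real k)"
        using n0 k2 by (simp only: pos_divide_le_eq of_nat_0_less_iff) (simp add: field_simps)
    qed auto
    moreover have "(real (card C))\<^sup>2 * (2 * real l / real n) \<le> (2 * real k)\<^sup>2 * (2 / real m)"
    proof (intro mult_mono power_mono cC)
      show "2 * real l / real n \<le> 2 / real m" using ln n0 m0 by (simp add: field_simps)
    qed auto
    moreover have "(2 * real k)\<^sup>2 * (2 / real m) \<le> 1/20"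
      using mk' m0 zero_le_power2[of "real k"] by (simp add: field_simps)
    moreover have "(2 * real k) * (1 / (40 * real k)) = 1/20" using k2 by simp
    ultimately show ?thesis using mean_not_separates[OF C(1) mn m0] by linarith
  qed
  obtain H where H: "finite H" "card H \<le> m ^ k" "\<And>\<pi>. \<pi> \<in> H \<Longrightarrow> \<pi> permutes {..<n} \<and> inv \<pi> ` K \<subseteq> {..<m}"
    "\<And>\<sigma>. \<sigma> permutes {..<n} \<Longrightarrow> inv \<sigma> ` K \<subseteq> {..<m} \<Longrightarrow> \<exists>\<pi>\<in>H. \<forall>i\<in>K. inv \<pi> i = inv \<sigma> i"
    using hypotheses_exist[OF K m0] by auto
  have "real (card H) \<le> real (m ^ k)" using H(2) by (simp only: of_nat_le_iff)
  then have "real (card H) * (1 - e) ^ q \<le> real m ^ k * (1 - e) ^ q"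
    using e by (intro mult_right_mono) auto
  also have "... \<le> 1/100" using e q m0 by (intro power_one_minus_le) auto
  finally have small: "real (card H) * (1 - e) ^ q \<le> 1/100" .
  define T where "T = tester n m l f K H q N"
  have "costs n (q + 2 * N) T" unfolding T_def by (rule costs_tester[OF mn])
  moreover have "2/3 \<le> acc_prob T g" if g: "isomorphic n g f" for g
  proof -
    have "real N * (2 * (e + e)) \<le> 140001 / \<epsilon> * (2 * (e + e))"
      using N e by (intro mult_right_mono) auto
    also have "... \<le> 1/10" using \<epsilon> by (simp add: e_def)
    finally have Ne: "real N * (2 * (e + e)) \<le> 1/10" .
    show ?thesis unfolding T_def
      by (rule tester_complete[OF mn l f K(1) H(1) H(3) H(4) e(2) small eta Ne _ g])
         (use sep K(2) in auto)
  qed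
  moreover have "2/3 \<le> 1 - acc_prob T g" if far: "far_from_iso n \<epsilon> g f" for g
  proof (rule ccontr)
    assume "\<not> ?thesis"
    then have acc: "1/3 < acc_prob (tester n m l f K H q N) g" by (simp add: T_def)
    have "(1 - \<delta>) ^ N \<le> 1 ^ 0 * (1/100)"
      using power_one_minus_le[of \<delta> 1 0 N] \<delta> N(1) \<epsilon> by (simp add: \<delta>_def)
    then have "1 \<le> \<delta> \<or> (\<delta> \<le> 1 \<and> (1 - \<delta>) ^ N \<le> 1/100)" using \<delta> by auto
    from tester_sound[OF H(1) e(2) small this acc]
    obtain h where h: "isomorphic n h f"
      "bdist n g h \<le> 11 * (401 * \<delta> + sqrt (2 * real k / real m)) + e + e"
      using close_to_isomorphic[OF k l mn km \<delta> K H(3) eta sep] by blast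
    \<comment> \<open>The left side is at most 2 \<epsilon>^2 / 10^12, and (1/500000)^2 is 4 /
      10^12.\<close>
    have "2 * real k / real m \<le> (\<epsilon> / 500000)\<^sup>2"
    proof -
      have "10 ^ 12 * real k \<le> 10 ^ 12 * (real k)\<^sup>2" using k2(2) by (intro mult_left_mono) auto
      then have "10 ^ 12 * real k \<le> real m * \<epsilon>\<^sup>2" using mk by (rule order_trans)
      then show ?thesis using m0 by (simp add: power_divide field_simps)
    qed
    then have "sqrt (2 * real k / real m) \<le> sqrt ((\<epsilon> / 500000)\<^sup>2)" by (rule real_sqrt_le_mono)
    then have "sqrt (2 * real k / real m) \<le> \<epsilon> / 500000" using \<epsilon> by simp
    moreover have "11 * (401 * \<delta> + s) + e + e < \<epsilon>" if "s \<le> \<epsilon> / 500000" for s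
      using that \<epsilon>(1) unfolding e_def \<delta>_def by (simp add: field_simps)
    ultimately have "bdist n g h < \<epsilon>" using h(2) by (meson le_less_trans)
    then show False using far h(1) unfolding far_from_iso_def by force
  qed
  ultimately show ?thesis unfolding iso_tester_def by auto
qed

text \<open>Since \<open>ln M\<close> is O(1 + ln k + 1/\<epsilon>), dividing by \<open>e\<close>
  gives the second power of 1/\<epsilon>: one factor replaces the logarithm of 1/\<epsilon>. The
  maximum in \<open>B\<close> covers \<open>k0\<close> at most 1, where \<open>k0 * ln k0\<close> is
  0.\<close>

lemma query_bound:
  fixes \<epsilon> M :: real and k0 :: nat
  defines "k \<equiv> max 1 k0" and "e \<equiv> \<epsilon> / 6000000" and "B \<equiv> max 1 (real k0 * ln (real k0))"
  assumes \<epsilon>: "0 < \<epsilon>" "\<epsilon> \<le> 1" and M: "1 \<le> M" "M \<le> 2 ^ 48 * (real k ^ 3 / \<epsilon>\<^sup>2)"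
    and q: "real q \<le> (real k * ln M + 7) / e + 1" and N: "real N \<le> 140001 / \<epsilon>"
  shows "real (q + 2 * N) \<le> 10 ^ 9 * B / \<epsilon>\<^sup>2"
proof -
  have B: "1 \<le> B" "real k * ln (real k) \<le> B"
    by (auto simp: B_def k_def max_def)
  have k1: "1 \<le> real k" by (simp add: k_def)
  \<comment> \<open>For k \<ge> 2 this uses ln k \<ge> 1/2; for k = 1 it uses B \<ge> 1.\<close>
  have kB: "real k \<le> 2 * B"
  proof (cases "k \<le> 1")
    case True
    then show ?thesis using B by simp
  next
    case False
    then have "ln 2 \<le> ln (real k)" by simp
    then have "1/2 \<le> ln (real k)" using ln2_ge_two_thirds by linarith
    then have "real k * (1/2) \<le> real k * ln (real k)" by (intro mult_left_mono) auto
    then show ?thesis using B by linarith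
  qed
  have inv: "1 \<le> 1 / \<epsilon>" using \<epsilon> by simp
  have "ln M \<le> ln (2 ^ 48 * (real k ^ 3 / \<epsilon>\<^sup>2))" using M by simp
  also have "... = 48 * ln 2 + (3 * ln (real k) - 2 * ln \<epsilon>)"
  proof -
    have "ln ((2::real) ^ 48) = 48 * ln 2" by (subst ln_realpow) simp_all
    moreover have "ln (real k ^ 3 / \<epsilon>\<^sup>2) = 3 * ln (real k) - 2 * ln \<epsilon>"
      using \<epsilon> k1 by (simp add: ln_div ln_realpow)
    moreover have "ln (2 ^ 48 * (real k ^ 3 / \<epsilon>\<^sup>2)) = ln (2 ^ 48) + ln (real k ^ 3 / \<epsilon>\<^sup>2)"
      using \<epsilon> k1 by (intro ln_mult_pos) auto
    ultimately show ?thesis by simp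
  qed
  also have "... \<le> 48 + (3 * ln (real k) + 2 / \<epsilon>)"
  proof -
    have "ln (1 / \<epsilon>) \<le> 1 / \<epsilon> - 1" using \<epsilon> by (intro ln_le_minus_one) auto
    then have "- ln \<epsilon> \<le> 1 / \<epsilon>" using \<epsilon> by (simp add: ln_div)
    then show ?thesis using ln_2_less_1 by simp
  qed
  finally have "real k * ln M \<le> real k * (48 + (3 * ln (real k) + 2 / \<epsilon>))"
    by (intro mult_left_mono) auto
  also have "... = 48 * real k + 3 * (real k * ln (real k)) + 2 * (real k * (1 / \<epsilon>))"
    by (simp add: algebra_simps)
  also have "... \<le> 48 * (2 * B) + 3 * B + 2 * (2 * B * (1 / \<epsilon>))"
    using kB B inv \<epsilon> by (intro add_mono mult_left_mono mult_right_mono) auto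
  finally have 1: "real k * ln M \<le> 99 * B + 4 * (B * (1 / \<epsilon>))" by simp
  have BB: "B * 1 \<le> B * (1 / \<epsilon>)" using B inv by (intro mult_left_mono) auto
  have "real k * ln M + 7 \<le> 110 * (B * (1 / \<epsilon>))" using 1 BB B by linarith
  then have "(real k * ln M + 7) / e \<le> 110 * (B * (1 / \<epsilon>)) / e"
    using \<epsilon> by (intro divide_right_mono) (auto simp: e_def)
  also have "... = 660000000 * (B / \<epsilon>\<^sup>2)" using \<epsilon> by (simp add: e_def power2_eq_square field_simps)
  finally have 2: "(real k * ln M + 7) / e \<le> 660000000 * (B / \<epsilon>\<^sup>2)" .
  have "1 / \<epsilon> * 1 \<le> 1 / \<epsilon> * (1 / \<epsilon>)" using inv \<epsilon> by (intro mult_left_mono) auto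
  also have "... = 1 * (1 / \<epsilon>\<^sup>2)" by (simp add: power2_eq_square)
  also have "... \<le> B * (1 / \<epsilon>\<^sup>2)" using B by (intro mult_right_mono) auto
  finally have 3: "1 / \<epsilon> \<le> B / \<epsilon>\<^sup>2" by simp
  have "140001 / \<epsilon> = 140001 * (1 / \<epsilon>)" by simp
  then have "real (q + 2 * N) \<le> 660000000 * (B / \<epsilon>\<^sup>2) + 1 + 280002 * (1 / \<epsilon>)"
    using q N 2 by simp
  also have "... \<le> 10 ^ 9 * (B / \<epsilon>\<^sup>2)" using 3 inv by simp
  finally show ?thesis by simp
qed

text \<open>Distances are at most 1 and \<open>f\<close> is a copy of itself, so no function is
  far.\<close>

lemma iso_tester_trivial:
  assumes "1 < \<epsilon>"
  shows "iso_tester n \<epsilon> f (return_pmf (Leaf True))"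
proof -
  have "\<not> far_from_iso n \<epsilon> g f" for g
  proof
    assume far: "far_from_iso n \<epsilon> g f"
    have "isomorphic n f f" unfolding isomorphic_def by (intro exI[of _ id]) (auto simp: permutes_id[unfolded id_def])
    then have "\<epsilon> \<le> bdist n g f" using far unfolding far_from_iso_def by blast
    moreover have "bdist n g f \<le> 1" unfolding bdist_mean by (rule mean_of_bool_le_1)
    ultimately show False using assms by simp
  qed
  then show ?thesis unfolding iso_tester_def by simp
qed

theorem theorem1:
  shows "\<exists>C::real. C > 0 \<and>
    (\<forall>n k f \<epsilon>. k \<le> n \<longrightarrow> t_symmetric n (n - k) f \<longrightarrow> \<epsilon> > 0 \<longrightarrow>
       (\<exists>T. query_alg n (C * max 1 (real k * ln (real k)) / \<epsilon>^2) T \<and> iso_tester n \<epsilon> f T))"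
proof (intro exI[of _ "10 ^ 9"] conjI allI impI)
  fix n k0 :: nat and f :: "(nat \<Rightarrow> bool) \<Rightarrow> bool" and \<epsilon> :: real
  assume k0: "k0 \<le> n" and sym: "t_symmetric n (n - k0) f" and \<epsilon>: "0 < \<epsilon>"
  define B where "B = max 1 (real k0 * ln (real k0))"
  \<comment> \<open>At least one core coordinate is allowed, which covers a fully symmetric
    \<open>f\<close>.\<close>
  define k where "k = max 1 k0"
  define e where "e = \<epsilon> / 6000000"
  have query_alg: "query_alg n (10 ^ 9 * B / \<epsilon>\<^sup>2) T" if "costs n d T" "real d \<le> 10 ^ 9 * B / \<epsilon>\<^sup>2" for d T
    using that unfolding query_alg_def costs_def by (meson of_nat_le_iff order_trans)
  have "\<exists>T. query_alg n (10 ^ 9 * B / \<epsilon>\<^sup>2) T \<and> iso_tester n \<epsilon> f T"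
  proof (cases "\<epsilon> \<le> 1")
    case False
    have "query_alg n (10 ^ 9 * B / \<epsilon>\<^sup>2) (return_pmf (Leaf True))"
      by (rule query_alg[of 0]) (auto simp: costs_Leaf B_def)
    then show ?thesis using iso_tester_trivial False by auto
  next
    case True
    obtain J where J: "J \<subseteq> {..<n}" "n - k0 \<le> card J" "J_symmetric n J f"
      using sym unfolding t_symmetric_def by blast
    define K where "K = {..<n} - J"
    have f: "core_dep n K f" unfolding K_def by (rule J_symmetric_core_dep[OF J(1,3)])
    have "card K = n - card J"
      unfolding K_def using J(1) finite_subset[OF J(1)] by (simp add: card_Diff_subset)
    then have K: "K \<subseteq> {..<n}" "card K \<le> k" using J(2) k0 by (auto simp: K_def k_def)
    have k: "1 \<le> k" by (simp add: k_def)
    have e: "0 < e" "e < \<epsilon>" "e \<le> 1" using \<epsilon> True by (auto simp: e_def)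
    define m where "m = nat \<lceil>10 ^ 12 * (real k)\<^sup>2 / \<epsilon>\<^sup>2\<rceil>"
    define R where "R = real k ^ 3 / \<epsilon>\<^sup>2"
    have k2: "1 \<le> real k" using k by simp
    have eps2: "\<epsilon>\<^sup>2 \<le> 1" "0 < \<epsilon>\<^sup>2" using \<epsilon> True by (auto simp: power_le_one)
    have "1 \<le> real k ^ 3" using k2 by (rule one_le_power)
    then have R1: "1 \<le> R" using eps2 by (simp add: R_def)
    have m: "10 ^ 12 * (real k)\<^sup>2 / \<epsilon>\<^sup>2 \<le> real m" "real m \<le> 10 ^ 12 * (real k)\<^sup>2 / \<epsilon>\<^sup>2 + 1"
      unfolding m_def using eps2 by (auto intro: real_nat_ceiling_ge of_nat_ceiling)
    have "real k * real m \<le> real k * (10 ^ 12 * (real k)\<^sup>2 / \<epsilon>\<^sup>2 + 1)" using m(2) by (intro mult_left_mono) auto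
    also have "... = 10 ^ 12 * R + real k * 1" by (simp add: R_def field_simps power2_eq_square power3_eq_cube)
    also have "real k * 1 \<le> R"
    proof -
      have "real k * 1 \<le> real k ^ 3 / 1" using k2 by (simp add: self_le_power)
      also have "... \<le> R" unfolding R_def using eps2 by (intro divide_left_mono) auto
      finally show ?thesis .
    qed
    finally have kmR: "real k * real m \<le> 10 ^ 12 * R + R" by simp
    have "1 * real m \<le> real k * real m" using k2 by (intro mult_right_mono) auto
    then have mR: "real m \<le> 10 ^ 12 * R + R" using kmR by linarith
    have m1: "1 \<le> real m"
    proof -
      have "1 \<le> (real k)\<^sup>2" using k2 by (rule one_le_power)
      then have "1 \<le> 10 ^ 12 * (real k)\<^sup>2 / \<epsilon>\<^sup>2" using eps2 by (simp add: field_simps)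
      then show ?thesis using m(1) by linarith
    qed
    show ?thesis
    \<comment> \<open>Below this threshold, which is of order k^3 / \<epsilon>^2,
      \<open>ln n\<close> is O(1 + ln (k / \<epsilon>)) and singleton classes are
      affordable.\<close>
    proof (cases "80 * k * m \<le> n")
      case large: True
      define q where "q = nat \<lceil>(real k * ln (real m) + 7) / e\<rceil>"
      define N where "N = nat \<lceil>140000 / \<epsilon>\<rceil>"
      have "0 \<le> real k * ln (real m)" using m1 by simp
      then have "0 \<le> (real k * ln (real m) + 7) / e" using e by simp
      then have q: "(real k * ln (real m) + 7) / e \<le> real q" "real q \<le> (real k * ln (real m) + 7) / e + 1"
        unfolding q_def by (auto intro: real_nat_ceiling_ge of_nat_ceiling)
      have N: "140000 / \<epsilon> \<le> real N" "real N \<le> 140000 / \<epsilon> + 1"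
        unfolding N_def using \<epsilon> by (auto intro: real_nat_ceiling_ge of_nat_ceiling)
      have "140000 / \<epsilon> + 1 \<le> 140001 / \<epsilon>" using \<epsilon> True by (simp add: field_simps)
      then have N': "real N \<le> 140001 / \<epsilon>" using N by linarith
      obtain T where T: "costs n (q + 2 * N) T" "iso_tester n \<epsilon> f T"
        using tester_large[OF \<epsilon> True k K f m(1) large q(1)[unfolded e_def] N(1) N'] by blast
      have "real m \<le> 2 ^ 48 * R" using mR R1 by simp
      then have "real (q + 2 * N) \<le> 10 ^ 9 * B / \<epsilon>\<^sup>2"
        using query_bound[OF \<epsilon> True m1 _ q(2)[unfolded e_def k_def] N'] by (simp add: B_def R_def k_def)
      then show ?thesis using T query_alg by blast
    next
      case small: False
      define M where "M = max 1 (real n)"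
      define q where "q = nat \<lceil>(real k * ln M + 7) / e\<rceil>"
      have M1: "1 \<le> M" by (simp add: M_def)
      have "0 \<le> real k * ln M" using M1 by simp
      then have "0 \<le> (real k * ln M + 7) / e" using e by simp
      then have q: "(real k * ln M + 7) / e \<le> real q" "real q \<le> (real k * ln M + 7) / e + 1"
        unfolding q_def by (auto intro: real_nat_ceiling_ge of_nat_ceiling)
      obtain T where T: "costs n q T" "iso_tester n \<epsilon> f T"
        using tester_small[OF e K f q(1)[unfolded M_def]] by blast
      have "real n \<le> real (80 * k * m)" using small by (simp only: of_nat_le_iff)
      then have "real n \<le> 80 * (real k * real m)" by simp
      \<comment> \<open>The constant works because 80 (10^12 + 1) < 2^48.\<close>
      then have "M \<le> 2 ^ 48 * R" using kmR R1 by (simp add: M_def)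
      then have "real (q + 2 * 0) \<le> 10 ^ 9 * B / \<epsilon>\<^sup>2"
        using query_bound[OF \<epsilon> True M1 _ q(2)[unfolded e_def k_def], of 0] \<epsilon> by (simp add: B_def R_def k_def)
      then show ?thesis using T query_alg by auto
    qed
  qed
  then show "\<exists>T. query_alg n (10 ^ 9 * max 1 (real k0 * ln (real k0)) / \<epsilon>\<^sup>2) T \<and> iso_tester n \<epsilon> f T"
    by (simp add: B_def)
qed simp

end
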